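(* Let $n\ge2$, let $P$ be a simple $K_{1,n}$-module and let $\lambda'\in\Gamma(\mathbf{-1})$ with $|\lambda'|=-1-n$. The filtration of $F(P,N_{n,1}(\mathbf{-1}))$ by $\mathcal{S}'(1,n)$-submodules $$0\subseteq\mathrm{diff}(F(P,N_{n,1}(\lambda')))\subseteq\tilde F(P,\mathbf{-1})\subseteq F(P,N_{n,1}(\mathbf{-1}))$$ satisfies the following properties. (1) $\mathrm{diff}(F(P,N_{n,1}(\lambda')))$ is the unique simple submodule of $F(P,N_{n,1}(\mathbf{-1}))$. (2) $\tilde F(P,\mathbf{-1})/\mathrm{diff}(F(P,N_{n,1}(\lambda')))$ is either zero or a trivial module. (3) If $P\ncong A_{1,n}$, then $F(P,N_{n,1}(\mathbf{-1}))/\tilde F(P,\mathbf{-1})\cong\Pi(\Delta P)$ is simple. (4) If $P\cong A_{1,n}$, then $F(P,N_{n,1}(\mathbf{-1}))/\tilde F(P,\mathbf{-1})\cong\Pi(\Delta A_{1,n})$, which has a trivial submodule $\mathbb{C}$ with the corresponding quotient $\Delta A_{1,n}/\mathbb{C}$ being simple. In particular, $F(P,N_{n,1}(\mathbf{-1}))$ is not simple.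
   Context: All vector spaces are over $\mathbb{C}$; $n\ge 2$; modules over superalgebras are $\mathbb{Z}_2$-graded, and $\Pi$ (parity-change) interchanges the grading. A module $M$ over an algebra $A$ is trivial if $M\neq0$ and $AM=0$. $[1,n]=\{1,\dots,n\}$; $\mathbf{-1}=(-1,\dots,-1)\in\mathbb{C}^n$; $|\lambda|=\lambda_1+\dots+\lambda_n$. The algebra $\mathcal{S}'(1,n)$. $\Lambda(n)$ is the exterior algebra in odd variables $\xi_1,\dots,\xi_n$; for $I=\{i_1<\dots<i_r\}\subseteq[1,n]$, $\xi_I=\xi_{i_1}\cdots\xi_{i_r}$, $\xi_\varnothing=1$. $\mathcal{W}(1,n)=\mathrm{Der}(\mathbb{C}[t^{\pm1}]\otimes\Lambda(n))$ is the Lie superalgebra of superderivations $f_0\frac{d}{dt}+\sum_i f_i\frac{\partial}{\partial\xi_i}$. $\mathcal{S}(1,n)\subset\mathcal{W}(1,n)$ is the subalgebra of superderivations with zero superdivergence, i.e. $\frac{d(f_0)}{dt}+\sum_i(-1)^{|f_i|}\frac{\partial(f_i)}{\partial\xi_i}=0$, and $\mathcal{S}'(1,n)=[\mathcal{S}(1,n),\mathcal{S}(1,n)]$. It is spanned by $t^k\frac{\partial(\xi_I)}{\partial\xi_i}\frac{d}{dt}+(-1)^{1+|I|}kt^{k-1}\xi_I\frac{\partial}{\partial\xi_i}$ and $t^k\frac{\partial(\xi_I)}{\partial\xi_i}\frac{\partial}{\partial\xi_j}+t^k\frac{\partial(\xi_I)}{\partial\xi_j}\frac{\partial}{\partial\xi_i}$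 ($k\in\mathbb{Z}$, $I\subseteq[1,n]$, $i,j\in[1,n]$). $\mathfrak{gl}(1,n)$ has basis $E_{i,j}$, $0\le i,j\le n$ (odd: $E_{0,i},E_{i,0}$ with $i\ge1$; the others even), with the supercommutator bracket; $\mathfrak{sl}(1,n)=\{A:\ a_{0,0}-\sum_{i\ge1}a_{i,i}=0\}$. Shen-Larsson modules. $K_{1,n}=\mathbb{C}[t^{\pm1},\xi_1,\dots,\xi_n,\frac{d}{dt},\frac{\partial}{\partial\xi_1},\dots,\frac{\partial}{\partial\xi_n}]$ is the Weyl superalgebra. There is a Lie superalgebra homomorphism $\pi:\mathcal{W}(1,n)\to K_{1,n}\otimes U(\mathfrak{gl}(1,n))$ (super tensor product) given by $$\pi(t^k\xi_I\tfrac{d}{dt})=t^k\xi_I\tfrac{d}{dt}\otimes1+kt^{k-1}\xi_I\otimes E_{0,0}+(-1)^{|I|-1}\sum_{s=1}^n\tfrac{\partial(t^k\xi_I)}{\partial\xi_s}\otimes E_{s,0},$$ $$\pi(t^k\xi_I\tfrac{\partial}{\partial\xi_i})=t^k\xi_I\tfrac{\partial}{\partial\xi_i}\otimes1+kt^{k-1}\xi_I\otimes E_{0,i}+(-1)^{|I|-1}\sum_{s=1}^n\tfrac{\partial(t^k\xi_I)}{\partial\xi_s}\otimes E_{s,i},$$ and $\pi(\mathcal{S}'(1,n))\subseteq K_{1,n}\otimes U(\mathfrak{sl}(1,n))$. For a $K_{1,n}$-module $P$ and an $\mathfrak{sl}(1,n)$-module $M$, $F(P,M)$ is the $\mathcal{S}'(1,n)$-module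 $P\otimes M$ with $x\cdot(p\otimes v)=\pi(x)(p\otimes v)$, where $(a\otimes b)(p\otimes v)=(-1)^{|b||p|}ap\otimes bv$. The modules $N_{n,1}(\lambda)$. $K^+_{n,1}=\mathbb{C}[t_1,\dots,t_n,\xi,\frac{\partial}{\partial t_1},\dots,\frac{\partial}{\partial t_n},\frac{\partial}{\partial\xi}]$ with one odd variable $\xi$. Here only weights $\lambda\in\Gamma(\mathbf{-1}):=(\mathbb{Z}_{<0})^n$ are needed: for these $A^+_{n,1}(\lambda)=A^+_{n,1}(\mathbf{-1})=\bigotimes_{i=1}^n\big(\mathbb{C}[t_i^{\pm1}]/\mathbb{C}[t_i]\big)\otimes\Lambda(1)$ with $\Lambda(1)=\mathbb{C}\oplus\mathbb{C}\xi$, a $K^+_{n,1}$-module, which is a $\mathfrak{gl}(1,n)$-module via $E_{0,0}\mapsto\xi\frac{\partial}{\partial\xi}$, $E_{i,j}\mapsto t_i\frac{\partial}{\partial t_j}$, $E_{0,l}\mapsto\xi\frac{\partial}{\partial t_l}$, $E_{l,0}\mapsto t_l\frac{\partial}{\partial\xi}$ ($i,j,l\in[1,n]$), and $$N_{n,1}(\lambda)=\Big\{v\in A^+_{n,1}(\lambda):\Big(\xi\tfrac{\partial}{\partial\xi}+\sum_{s=1}^nt_s\tfrac{\partial}{\partial t_s}\Big)v=|\lambda|v\Big\},$$ a simple $\mathfrak{sl}(1,n)$-module. The map diff. The element $\mathrm{diff}=\frac{d}{dt}\otimes\xi-\sum_{s=1}^n\frac{\partial}{\partial\xi_s}\otimes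 t_s\in K_{1,n}\otimes K^+_{n,1}$ acts on $F(P,A^+_{n,1}(\mathbf{-1}))=P\otimes A^+_{n,1}(\mathbf{-1})$; it satisfies $\mathrm{diff}^2=0$ and $[\mathrm{diff},\pi(x)]=0$ for all $x\in\mathcal{W}(1,n)$. Put $\tilde F(P,\lambda)=\{v\in F(P,N_{n,1}(\lambda)):\mathrm{diff}(v)=0\}$. $A_{1,n}=\mathbb{C}[t^{\pm1}]\otimes\Lambda(n)$ is the natural simple weight $K_{1,n}$-module, with constants $\mathbb{C}\subset A_{1,n}$. Any $K_{1,n}$-module $P$ is an $\mathcal{S}'(1,n)$-module by restriction along $\mathcal{S}'(1,n)\subset K_{1,n}$, and $\Delta P=\frac{d}{dt}P+\sum_{i=1}^n\frac{\partial}{\partial\xi_i}P$ is an $\mathcal{S}'(1,n)$-submodule of $P$.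
   Formalization: Isomorphisms (in P≅A_{1,n} and in the quotients ≅Π(ΔP), Π(ΔA_{1,n})) may be even or odd; with even ones only, (3) fails for P=Π(A_{1,n}) and (4) fails for P=A_{1,n}, where the quotient is evenly isomorphic to ΔA_{1,n}, not to its parity change. *)

theory Defs
  imports
    "HOL-Algebra.Algebraic_Closure_Type"
    "HOL-Library.Cardinality"
    "HOL-Library.Poly_Mapping"
    "HOL-Library.Function_Algebras"
    "HOL-Library.Z2"
begin

text \<open>
  The index set \<open>[1,n]\<close> is a type \<open>'n\<close> of sorts finite and linorder with \<open>CARD('n) = n\<close>;
  \<open>[0,n]\<close> is \<open>'n option\<close>, with \<^const>\<open>None\<close> in the role of \<open>0\<close>.
  Parities are elements of the field \<^typ>\<open>bit\<close> with two elements.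
\<close>

abbreviation "supp \<equiv> Poly_Mapping.keys"
abbreviation "coef \<equiv> Poly_Mapping.lookup"
abbreviation "single \<equiv> Poly_Mapping.single"

definition psign :: "bit \<Rightarrow> complex" where
  "psign e = (if e = 0 then 1 else - 1)"

text \<open>Scalar multiplication on finitely supported functions into a space with scaling \<open>sc\<close>.\<close>

definition pscale ::
    "(complex \<Rightarrow> 'v::zero \<Rightarrow> 'v) \<Rightarrow> complex \<Rightarrow> ('b \<Rightarrow>\<^sub>0 'v) \<Rightarrow> ('b \<Rightarrow>\<^sub>0 'v)" where
  "pscale sc c = Poly_Mapping.map (sc c)"


section \<open>Graded modules over a set of operators\<close>

text \<open>
  The complex vector space underlying a module is a \<^locale>\<open>module\<close> record over \<open>\<complex>\<close>; \<open>part\<close> is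
  the grading. The acting algebra is a set \<open>L\<close> of elements of \<open>'x\<close>; since the parity of its elements
  matters for odd maps, \<open>isomorphic\<close> below also takes the family \<open>Lh\<close> of the sets of its
  homogeneous elements.
\<close>

record ('x, 'v) supermodule = "(complex, 'v) module" +
  part :: "bit \<Rightarrow> 'v set"
  act :: "'x \<Rightarrow> 'v \<Rightarrow> 'v"

definition supermodule_on ::
    "(complex \<Rightarrow> 'v::ab_group_add \<Rightarrow> 'v) \<Rightarrow> (bit \<Rightarrow> 'v set) \<Rightarrow> ('x \<Rightarrow> 'v \<Rightarrow> 'v) \<Rightarrow> 'v set
      \<Rightarrow> ('x, 'v) supermodule" where
  "supermodule_on sc V r H =
    \<lparr>carrier = H, monoid.mult = undefined, one = undefined, ring.zero = 0, add = (+),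
     module.smult = sc, part = (\<lambda>e. V e \<inter> H), act = r\<rparr>"

definition restrict_to :: "('x, 'v) supermodule \<Rightarrow> 'v set \<Rightarrow> ('x, 'v) supermodule" where
  "restrict_to M H = M\<lparr>carrier := H, part := (\<lambda>e. part M e \<inter> H)\<rparr>"

definition parity_change :: "('x, 'v) supermodule \<Rightarrow> ('x, 'v) supermodule" where
  "parity_change M = M\<lparr>part := (\<lambda>e. part M (e + 1))\<rparr>"

definition quotient_by :: "('x, 'v) supermodule \<Rightarrow> 'v set \<Rightarrow> ('x, 'v set) supermodule" where
  "quotient_by M H =
    \<lparr>carrier = a_rcosets\<^bsub>M\<^esub> H, monoid.mult = undefined, one = undefined,
     ring.zero = H, add = set_add M,
     module.smult = (\<lambda>c Y. \<Union>v\<in>Y. H +>\<^bsub>M\<^esub> (c \<odot>\<^bsub>M\<^esub> v)),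
     part = (\<lambda>e. (\<lambda>v. H +>\<^bsub>M\<^esub> v) ` part M e),
     act = (\<lambda>x Y. \<Union>v\<in>Y. H +>\<^bsub>M\<^esub> act M x v)\<rparr>"

definition graded_submodule :: "'x set \<Rightarrow> ('x, 'v) supermodule \<Rightarrow> 'v set \<Rightarrow> bool" where
  "graded_submodule L M H \<longleftrightarrow>
    submodule H (ring_of_type_algebra :: complex ring) M \<and>
    (\<forall>v\<in>H. \<exists>a \<in> H \<inter> part M 0. \<exists>b \<in> H \<inter> part M 1. v = a \<oplus>\<^bsub>M\<^esub> b) \<and>
    (\<forall>x\<in>L. \<forall>v\<in>H. act M x v \<in> H)"

definition zero_module :: "('x, 'v) supermodule \<Rightarrow> bool" where
  "zero_module M \<longleftrightarrow> carrier M = {\<zero>\<^bsub>M\<^esub>}"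

definition simple_module :: "'x set \<Rightarrow> ('x, 'v) supermodule \<Rightarrow> bool" where
  "simple_module L M \<longleftrightarrow> \<not> zero_module M \<and>
    (\<forall>H. graded_submodule L M H \<longrightarrow> H = {\<zero>\<^bsub>M\<^esub>} \<or> H = carrier M)"

definition trivial_module :: "'x set \<Rightarrow> ('x, 'v) supermodule \<Rightarrow> bool" where
  "trivial_module L M \<longleftrightarrow> \<not> zero_module M \<and>
    (\<forall>x\<in>L. \<forall>v\<in>carrier M. act M x v = \<zero>\<^bsub>M\<^esub>)"

text \<open>
  Homomorphisms are homogeneous but need not be even: a map \<open>f\<close> of parity \<open>e\<close> satisfies
  \<open>f (x v) = (-1)^(e |x|) x f(v)\<close>. In particular \<open>M\<close> and \<open>\<Pi> M\<close> are isomorphic;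
  restricted to even maps, the classification of the last quotient by \<open>P \<cong> A_(1,n)\<close> would fail for
  \<open>P = \<Pi> A_(1,n)\<close>.
\<close>

definition isomorphic ::
    "(bit \<Rightarrow> 'x set) \<Rightarrow> ('x, 'v) supermodule \<Rightarrow> ('x, 'w) supermodule \<Rightarrow> bool" where
  "isomorphic Lh M N \<longleftrightarrow>
    (\<exists>f e. bij_betw f (carrier M) (carrier N) \<and>
      (\<forall>v\<in>carrier M. \<forall>w\<in>carrier M. f (v \<oplus>\<^bsub>M\<^esub> w) = f v \<oplus>\<^bsub>N\<^esub> f w) \<and>
      (\<forall>c. \<forall>v\<in>carrier M. f (c \<odot>\<^bsub>M\<^esub> v) = c \<odot>\<^bsub>N\<^esub> f v) \<and>
      (\<forall>q. f ` part M q = part N (q + e)) \<and>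
      (\<forall>q. \<forall>x\<in>Lh q. \<forall>v\<in>carrier M. f (act M x v) = psign (e * q) \<odot>\<^bsub>N\<^esub> act N x (f v)))"


section \<open>The superalgebra of Laurent polynomials and its superderivations\<close>

text \<open>The key \<open>(k, I)\<close> stands for \<open>t^k \<xi>_I\<close>, with the factors of \<open>\<xi>_I\<close> in increasing order.\<close>

type_synonym 'n laurent = "(int \<times> 'n set) \<Rightarrow>\<^sub>0 complex"

definition mon :: "int \<Rightarrow> 'n set \<Rightarrow> 'n laurent" where
  "mon k I = single (k, I) 1"

text \<open>\<open>\<xi>_I \<xi>_J = xi_sign I J \<xi>_(I \<union> J)\<close>\<close>

definition xi_sign :: "'n::linorder set \<Rightarrow> 'n set \<Rightarrow> complex" where
  "xi_sign I J = (if I \<inter> J = {} then (- 1) ^ card {(i, j). i \<in> I \<and> j \<in> J \<and> j < i} else 0)"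

definition lmult :: "'n::linorder laurent \<Rightarrow> 'n laurent \<Rightarrow> 'n laurent" where
  "lmult f g = (\<Sum>(k, I)\<in>supp f. \<Sum>(l, J)\<in>supp g.
     single (k + l, I \<union> J) (coef f (k, I) * coef g (l, J) * xi_sign I J))"

definition lpart :: "bit \<Rightarrow> 'n laurent set" where
  "lpart e = {f. \<forall>(k, I)\<in>supp f. of_nat (card I) = e}"

definition ddt :: "'n laurent \<Rightarrow> 'n laurent" where
  "ddt f = (\<Sum>(k, I)\<in>supp f. single (k - 1, I) (of_int k * coef f (k, I)))"

definition dxi :: "'n::linorder \<Rightarrow> 'n laurent \<Rightarrow> 'n laurent" where
  "dxi i f = (\<Sum>(k, I)\<in>supp f. if i \<in> I
     then single (k, I - {i}) ((- 1) ^ card {j\<in>I. j < i} * coef f (k, I)) else 0)"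

fun partial :: "'n::linorder option \<Rightarrow> 'n laurent \<Rightarrow> 'n laurent" where
  "partial None = ddt"
| "partial (Some i) = dxi i"

text \<open>\<open>f \<mapsto> (-1)^|f| f\<close>\<close>

definition linvol :: "'n laurent \<Rightarrow> 'n laurent" where
  "linvol f = (\<Sum>(k, I)\<in>supp f. single (k, I) ((- 1) ^ card I * coef f (k, I)))"

type_synonym 'n lop = "'n laurent \<Rightarrow> 'n laurent"

definition op_scale :: "complex \<Rightarrow> 'n lop \<Rightarrow> 'n lop" where
  "op_scale c x = (\<lambda>f. pscale (*) c (x f))"

definition homogeneous :: "'n lop set \<Rightarrow> bit \<Rightarrow> 'n lop set" where
  "homogeneous L e = {x\<in>L. \<forall>q. x ` lpart q \<subseteq> lpart (e + q)}"

text \<open>\<open>f_0 d/dt + \<Sum>_i f_i \<partial>/\<partial>\<xi>_i\<close>; every superderivation of the Laurent superalgebra has this form.\<close>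

definition superderivation :: "('n::{finite,linorder} option \<Rightarrow> 'n laurent) \<Rightarrow> 'n lop" where
  "superderivation f = (\<lambda>g. \<Sum>j\<in>UNIV. lmult (f j) (partial j g))"

definition W_alg :: "'n::{finite,linorder} lop set" where
  "W_alg = range superderivation"

definition superdivergence :: "('n::{finite,linorder} option \<Rightarrow> 'n laurent) \<Rightarrow> 'n laurent" where
  "superdivergence f = ddt (f None) + (\<Sum>i\<in>UNIV. dxi i (linvol (f (Some i))))"

definition S_alg :: "'n::{finite,linorder} lop set" where
  "S_alg = superderivation ` {f. superdivergence f = 0}"

text \<open>\<open>[S, S]\<close>: the span of the supercommutators of homogeneous elements.\<close>

definition S'_alg :: "'n::{finite,linorder} lop set" where
  "S'_alg = module.span op_scale
     {(\<lambda>g. x (y g) - pscale (*) (psign (e * q)) (y (x g))) | x y e q.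
        x \<in> homogeneous S_alg e \<and> y \<in> homogeneous S_alg q}"

text \<open>
  The Weyl superalgebra \<open>K_(1,n)\<close>, realised by its faithful action on Laurent polynomials, so that
  \<^const>\<open>W_alg\<close> is a subset of it.
\<close>

inductive_set K_alg :: "'n::{finite,linorder} lop set" where
  unit: "(\<lambda>f. f) \<in> K_alg"
| t: "lmult (mon 1 {}) \<in> K_alg"
| t_inv: "lmult (mon (- 1) {}) \<in> K_alg"
| xi: "lmult (mon 0 {i}) \<in> K_alg"
| partial: "partial j \<in> K_alg"
| add: "a \<in> K_alg \<Longrightarrow> b \<in> K_alg \<Longrightarrow> a + b \<in> K_alg"
| scale: "a \<in> K_alg \<Longrightarrow> op_scale c a \<in> K_alg"
| comp: "a \<in> K_alg \<Longrightarrow> b \<in> K_alg \<Longrightarrow> a \<circ> b \<in> K_alg"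

text \<open>
  A unital graded \<open>K_(1,n)\<close>-module structure on all of \<open>'p\<close>. The action \<open>r\<close> is relevant only
  on \<^const>\<open>K_alg\<close>.
\<close>

definition K_module ::
    "(complex \<Rightarrow> 'p::ab_group_add \<Rightarrow> 'p) \<Rightarrow> (bit \<Rightarrow> 'p set)
      \<Rightarrow> ('n::{finite,linorder} lop \<Rightarrow> 'p \<Rightarrow> 'p) \<Rightarrow> bool" where
  "K_module sc V r \<longleftrightarrow>
    vector_space sc \<and>
    (\<forall>e. module.subspace sc (V e)) \<and> V 0 \<inter> V 1 = {0} \<and> (\<forall>p. \<exists>a\<in>V 0. \<exists>b\<in>V 1. p = a + b) \<and>
    (\<forall>a\<in>K_alg. Vector_Spaces.linear sc sc (r a)) \<and>
    (\<forall>p. r (\<lambda>f. f) p = p) \<and>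
    (\<forall>a\<in>K_alg. \<forall>b\<in>K_alg. \<forall>p. r (a + b) p = r a p + r b p) \<and>
    (\<forall>c. \<forall>a\<in>K_alg. \<forall>p. r (op_scale c a) p = sc c (r a p)) \<and>
    (\<forall>a\<in>K_alg. \<forall>b\<in>K_alg. \<forall>p. r (a \<circ> b) p = r a (r b p)) \<and>
    (\<forall>e q. \<forall>a\<in>homogeneous K_alg e. r a ` V q \<subseteq> V (e + q))"

definition A_mod :: "('n::{finite,linorder} lop, 'n laurent) supermodule" where
  "A_mod = supermodule_on (pscale (*)) lpart (\<lambda>x. x) UNIV"

definition Delta ::
    "('n::{finite,linorder} lop \<Rightarrow> 'p::ab_group_add \<Rightarrow> 'p) \<Rightarrow> 'p set" where
  "Delta r = {\<Sum>j\<in>UNIV. r (partial j) (p j) | p. True}"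

definition constants :: "'n laurent set" where
  "constants = {pscale (*) c (mon 0 {}) | c. True}"


section \<open>The modules \<open>N_(n,1)(\<mu>)\<close>\<close>

text \<open>
  The key \<open>(\<alpha>, e)\<close> stands for \<open>t^\<alpha> \<xi>^e\<close>, a monomial of parity \<open>e\<close>. The classes of the monomials
  with all exponents negative form a basis of \<open>A^+_(n,1)(-1)\<close>, the other monomials having class zero.
\<close>

type_synonym 'n amon = "('n \<Rightarrow> int) \<times> bit"
type_synonym 'n aplus = "'n amon \<Rightarrow>\<^sub>0 complex"

definition A_plus :: "'n aplus set" where
  "A_plus = {v. \<forall>(\<alpha>, e)\<in>supp v. \<forall>i. \<alpha> i < 0}"

definition tmult :: "'n \<Rightarrow> 'n aplus \<Rightarrow> 'n aplus" where
  "tmult i v = (\<Sum>(\<alpha>, e)\<in>supp v. if \<alpha> i + 1 < 0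
     then single (\<alpha>(i := \<alpha> i + 1), e) (coef v (\<alpha>, e)) else 0)"

definition tder :: "'n \<Rightarrow> 'n aplus \<Rightarrow> 'n aplus" where
  "tder i v = (\<Sum>(\<alpha>, e)\<in>supp v.
     single (\<alpha>(i := \<alpha> i - 1), e) (of_int (\<alpha> i) * coef v (\<alpha>, e)))"

definition xmult :: "'n aplus \<Rightarrow> 'n aplus" where
  "xmult v = (\<Sum>(\<alpha>, e)\<in>supp v. if e = 0 then single (\<alpha>, 1) (coef v (\<alpha>, e)) else 0)"

definition xder :: "'n aplus \<Rightarrow> 'n aplus" where
  "xder v = (\<Sum>(\<alpha>, e)\<in>supp v. if e = 1 then single (\<alpha>, 0) (coef v (\<alpha>, e)) else 0)"

text \<open>The action of the matrix unit \<open>E_(a,b)\<close> of \<open>gl(1,n)\<close>, and its parity.\<close>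

fun E_op :: "'n option \<Rightarrow> 'n option \<Rightarrow> 'n aplus \<Rightarrow> 'n aplus" where
  "E_op None None = xmult \<circ> xder"
| "E_op None (Some l) = xmult \<circ> tder l"
| "E_op (Some l) None = tmult l \<circ> xder"
| "E_op (Some i) (Some j) = tmult i \<circ> tder j"

definition E_par :: "'n option \<Rightarrow> 'n option \<Rightarrow> bit" where
  "E_par a b = (if (a = None) = (b = None) then 0 else 1)"

definition Gamma_neg :: "('n \<Rightarrow> int) set" where
  "Gamma_neg = {\<mu>. \<forall>i. \<mu> i < 0}"

definition N_mod :: "('n::finite \<Rightarrow> int) \<Rightarrow> 'n aplus set" where
  "N_mod \<mu> = {v\<in>A_plus.
     xmult (xder v) + (\<Sum>s\<in>UNIV. tmult s (tder s v)) = pscale (*) (of_int (\<Sum>s\<in>UNIV. \<mu> s)) v}"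


section \<open>Shen-Larsson modules\<close>

text \<open>
  \<open>P \<otimes> A^+_(n,1)(-1)\<close> is realised as the finitely supported functions from monomials to \<open>P\<close>,
  the pure tensor \<open>p \<otimes> v\<close> having the value \<open>v(m) p\<close> at the monomial \<open>m\<close>.
\<close>

definition tensor ::
    "(complex \<Rightarrow> 'p::ab_group_add \<Rightarrow> 'p) \<Rightarrow> 'p \<Rightarrow> 'n aplus \<Rightarrow> ('n amon \<Rightarrow>\<^sub>0 'p)" where
  "tensor sc p v = Poly_Mapping.map (\<lambda>c. sc c p) v"

text \<open>The operator \<open>p \<mapsto> (-1)^(e |p|) p\<close>.\<close>

definition twist ::
    "(complex \<Rightarrow> 'p::ab_group_add \<Rightarrow> 'p) \<Rightarrow> (bit \<Rightarrow> 'p set) \<Rightarrow> bit \<Rightarrow> 'p \<Rightarrow> 'p" where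
  "twist sc V e p = (THE q. \<exists>a\<in>V 0. \<exists>b\<in>V 1. p = a + b \<and> q = a + sc (psign e) b)"

text \<open>
  The operator \<open>p \<otimes> v \<mapsto> (-1)^(e |p|) a p \<otimes> b v\<close>, where \<open>e\<close> is the parity of \<open>b\<close>, extended linearly
  from the tensors \<open>p \<otimes> m\<close> with \<open>m\<close> a monomial.
\<close>

definition tensor_op ::
    "(complex \<Rightarrow> 'p::ab_group_add \<Rightarrow> 'p) \<Rightarrow> (bit \<Rightarrow> 'p set) \<Rightarrow> ('p \<Rightarrow> 'p) \<Rightarrow> bit
      \<Rightarrow> ('n aplus \<Rightarrow> 'n aplus) \<Rightarrow> ('n amon \<Rightarrow>\<^sub>0 'p) \<Rightarrow> ('n amon \<Rightarrow>\<^sub>0 'p)" where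
  "tensor_op sc V a e b u =
    (\<Sum>m\<in>supp u. tensor sc (a (twist sc V e (coef u m))) (b (single m 1)))"

text \<open>
  The action of \<open>\<pi>(t^k \<xi>_I \<partial>_j)\<close>, where \<open>\<partial>_0 = d/dt\<close> and \<open>\<partial>_i = \<partial>/\<partial>\<xi>_i\<close>. The sign \<open>(-1)^(|I|-1)\<close> is
  written \<open>(-1)^(|I|+1)\<close>.
\<close>

definition pi_basis ::
    "(complex \<Rightarrow> 'p::ab_group_add \<Rightarrow> 'p) \<Rightarrow> (bit \<Rightarrow> 'p set)
      \<Rightarrow> ('n::{finite,linorder} lop \<Rightarrow> 'p \<Rightarrow> 'p)
      \<Rightarrow> int \<Rightarrow> 'n set \<Rightarrow> 'n option \<Rightarrow> ('n amon \<Rightarrow>\<^sub>0 'p) \<Rightarrow> ('n amon \<Rightarrow>\<^sub>0 'p)" where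
  "pi_basis sc V r k I j u =
    tensor_op sc V (r (lmult (mon k I) \<circ> partial j)) 0 (\<lambda>v. v) u
    + pscale sc (of_int k)
        (tensor_op sc V (r (lmult (mon (k - 1) I))) (E_par None j) (E_op None j) u)
    + pscale sc ((- 1) ^ (card I + 1))
        (\<Sum>s\<in>UNIV. tensor_op sc V (r (lmult (dxi s (mon k I))))
           (E_par (Some s) j) (E_op (Some s) j) u)"

text \<open>The coefficient of \<open>\<partial>_j\<close> in a superderivation is its value at \<open>t\<close>, respectively \<open>\<xi>_j\<close>.\<close>

fun coefficient :: "'n lop \<Rightarrow> 'n option \<Rightarrow> 'n laurent" where
  "coefficient x None = x (mon 1 {})"
| "coefficient x (Some i) = x (mon 0 {i})"

definition pi_act ::
    "(complex \<Rightarrow> 'p::ab_group_add \<Rightarrow> 'p) \<Rightarrow> (bit \<Rightarrow> 'p set)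
      \<Rightarrow> ('n::{finite,linorder} lop \<Rightarrow> 'p \<Rightarrow> 'p)
      \<Rightarrow> 'n lop \<Rightarrow> ('n amon \<Rightarrow>\<^sub>0 'p) \<Rightarrow> ('n amon \<Rightarrow>\<^sub>0 'p)" where
  "pi_act sc V r x u = (\<Sum>j\<in>UNIV. \<Sum>(k, I)\<in>supp (coefficient x j).
     pscale sc (coef (coefficient x j) (k, I)) (pi_basis sc V r k I j u))"

definition F_part :: "(bit \<Rightarrow> 'p::zero set) \<Rightarrow> bit \<Rightarrow> ('n amon \<Rightarrow>\<^sub>0 'p) set" where
  "F_part V e = {u. \<forall>(\<alpha>, q)\<in>supp u. coef u (\<alpha>, q) \<in> V (e + q)}"

definition F_mod ::
    "(complex \<Rightarrow> 'p::ab_group_add \<Rightarrow> 'p) \<Rightarrow> (bit \<Rightarrow> 'p set)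
      \<Rightarrow> ('n::{finite,linorder} lop \<Rightarrow> 'p \<Rightarrow> 'p) \<Rightarrow> 'n aplus set
      \<Rightarrow> ('n lop, 'n amon \<Rightarrow>\<^sub>0 'p) supermodule" where
  "F_mod sc V r M = supermodule_on (pscale sc) (F_part V) (pi_act sc V r)
     (module.span (pscale sc) {tensor sc p v | p v. v \<in> M})"

definition diff ::
    "(complex \<Rightarrow> 'p::ab_group_add \<Rightarrow> 'p) \<Rightarrow> (bit \<Rightarrow> 'p set)
      \<Rightarrow> ('n::{finite,linorder} lop \<Rightarrow> 'p \<Rightarrow> 'p)
      \<Rightarrow> ('n amon \<Rightarrow>\<^sub>0 'p) \<Rightarrow> ('n amon \<Rightarrow>\<^sub>0 'p)" where
  "diff sc V r u = tensor_op sc V (r ddt) 1 xmult u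
     - (\<Sum>s\<in>UNIV. tensor_op sc V (r (dxi s)) 0 (tmult s) u)"

definition F_tilde ::
    "(complex \<Rightarrow> 'p::ab_group_add \<Rightarrow> 'p) \<Rightarrow> (bit \<Rightarrow> 'p set)
      \<Rightarrow> ('n::{finite,linorder} lop \<Rightarrow> 'p \<Rightarrow> 'p) \<Rightarrow> ('n \<Rightarrow> int) \<Rightarrow> ('n amon \<Rightarrow>\<^sub>0 'p) set" where
  "F_tilde sc V r \<mu> = {u \<in> carrier (F_mod sc V r (N_mod \<mu>)). diff sc V r u = 0}"

end

theory Submission
  imports Defs
begin

text \<open>
  View elements of \<open>P \<otimes> N(-1)\<close> as vector fields \<open>\<Sum>_c p_c \<partial>_c\<close> with coefficients in \<open>P\<close>; the map
  \<open>diff\<close> is the superdivergence on them, and it identifies the top quotient with \<open>\<Delta>P\<close>. The action of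
  a field \<open>x\<close> is the supercommutator of \<open>diff\<close> with the contraction by \<open>x\<close>. Hence \<open>diff\<close> commutes
  with the action, and every field maps the kernel of \<open>diff\<close> into its image.

  Minimality of the image of \<open>diff\<close>, and simplicity of \<open>\<Delta>P\<close> modulo invariants, use the same trick.
  For a subspace \<open>U\<close> of \<open>P\<close> that is stable under all \<open>\<partial>_c\<close>, the \<open>q\<close> with \<open>\<partial>_i f q \<in> U\<close> for all Laurent
  polynomials \<open>f\<close> form a submodule over the Weyl superalgebra. By simplicity of \<open>P\<close>, a single
  nonzero such \<open>q\<close> gives \<open>\<partial>_i P \<subseteq> U\<close>. Products of fields \<open>t^k \<xi>_J \<partial>_i\<close> with \<open>i \<notin> J\<close> provide such a \<open>q\<close>.
  A nonzero invariant \<open>p\<close> of \<open>P\<close> yields the isomorphism \<open>f \<mapsto> f p\<close> from \<open>A_(1,n)\<close> to \<open>P\<close>, up to parity.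
\<close>

section \<open>Finitely supported functions\<close>

text \<open>Monomials of A^+ have degree at most 1 - n, and that degree contains only
  \<open>omega\<close>. The monomials of N(-1), one degree lower, are up to sign its contractions by
  the n + 1 derivations; so \<open>omega\<close> plays the role of a volume form, elements of the
  middle term read as vector fields, and diff maps them to one copy of P. On \<open>omega\<close> a
  field acts as on P plus multiplication by its superdivergence, which is why divergence-free fields
  see the restriction of P there.

  The obstacle is the scarcity of usable fields: the derived algebra is given as a span of brackets,
  and t^k d/dt lies in it only for k = 0. The minimality arguments use three families: t^k \<xi>_J
  \<partial>_i with \<open>i \<notin> J\<close>, \<xi>_i d/dt, and the derivations. Most are found
  by bracketing with \<xi>_i \<partial>_i - \<xi>_j \<partial>_j, which takes a second odd variable.
  The direction d/dt has to be recovered from odd ones: \<partial>_i \<xi>_i + \<xi>_i \<partial>_i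
  = 1 turns \<xi>_i d/dt into d/dt, and comparing products of fields with the same total power of t
  isolates the coefficient of d/dt in a vector field.\<close>

lemma sum_singles: "(\<Sum>k\<in>supp f. single k (coef f k)) = f"
proof (rule poly_mapping_eqI)
  fix k
  have "coef (\<Sum>k\<in>supp f. single k (coef f k)) k = (\<Sum>l\<in>supp f. if l = k then coef f l else 0)"
    by (auto simp: lookup_sum lookup_single when_def intro!: sum.cong)
  also have "\<dots> = coef f k"
    by (auto simp: in_keys_iff)
  finally show "coef (\<Sum>k\<in>supp f. single k (coef f k)) k = coef f k" .
qed

text \<open>Reduces identities between additive operators to single monomials. The keys are
  restricted to \<open>supp f\<close> because some identities hold only there: supercommutation for
  homogeneous factors, Cartan's formula for negative exponents.\<close>

lemma additive_ext:
  fixes F G :: "('k \<Rightarrow>\<^sub>0 'v::ab_group_add) \<Rightarrow> 'w::ab_group_add"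
  assumes F: "\<And>f g. F (f + g) = F f + F g" and G: "\<And>f g. G (f + g) = G f + G g"
    and eq: "\<And>k c. k \<in> supp f \<Longrightarrow> F (single k c) = G (single k c)"
  shows "F f = G f"
proof -
  interpret F: Modules.additive F by unfold_locales (rule F)
  interpret G: Modules.additive G by unfold_locales (rule G)
  have "F f = (\<Sum>k\<in>supp f. F (single k (coef f k)))"
    by (subst sum_singles[symmetric], subst F.sum) simp
  also have "\<dots> = (\<Sum>k\<in>supp f. G (single k (coef f k)))"
    by (intro sum.cong refl eq)
  also have "\<dots> = G f"
    by (subst (4) sum_singles[symmetric], subst G.sum) simp
  finally show ?thesis .
qed

lemma sum_supp_superset:
  fixes \<phi> :: "'k \<Rightarrow> 'v::zero \<Rightarrow> 'w::comm_monoid_add"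
  assumes "finite B" "supp f \<subseteq> B" "\<And>k. \<phi> k 0 = 0"
  shows "(\<Sum>k\<in>supp f. \<phi> k (coef f k)) = (\<Sum>k\<in>B. \<phi> k (coef f k))"
  using assms by (intro sum.mono_neutral_left) (auto simp: in_keys_iff)

text \<open>Operators are defined by sums over the support, which changes under addition. Padding
  all sums with zero terms over the union of the supports gives their additivity.\<close>

lemma sum_supp_add:
  fixes \<phi> :: "'k \<Rightarrow> 'v::ab_group_add \<Rightarrow> 'w::ab_group_add"
  assumes \<phi>: "\<And>k x y. \<phi> k (x + y) = \<phi> k x + \<phi> k y"
  shows "(\<Sum>k\<in>supp (f + g). \<phi> k (coef (f + g) k)) =
    (\<Sum>k\<in>supp f. \<phi> k (coef f k)) + (\<Sum>k\<in>supp g. \<phi> k (coef g k))"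
proof -
  have 0: "\<phi> k 0 = 0" for k
    using \<phi>[of k 0 0] by simp
  define B where "B = supp f \<union> supp g"
  have B: "finite B" "supp f \<subseteq> B" "supp g \<subseteq> B" "supp (f + g) \<subseteq> B"
    unfolding B_def using Poly_Mapping.keys_add[of f g] by auto
  show ?thesis
    using sum_supp_superset[where f = f, OF B(1,2), of \<phi>] sum_supp_superset[where f = g, OF B(1,3), of \<phi>]
      sum_supp_superset[where f = "f + g", OF B(1,4), of \<phi>]
    by (simp add: 0 lookup_add \<phi> sum.distrib)
qed

lemma sum_supp_single:
  fixes \<phi> :: "'k \<Rightarrow> 'v::ab_group_add \<Rightarrow> 'w::ab_group_add"
  assumes "\<And>k. \<phi> k 0 = 0"
  shows "(\<Sum>k\<in>supp (single l c). \<phi> k (coef (single l c) k)) = \<phi> l c"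
  using assms by simp

lemma coef_map:
  assumes "f 0 = 0"
  shows "coef (Poly_Mapping.map f u) k = f (coef u k)"
  using assms by transfer (auto simp: when_def)

lemma pscale_mult [simp]:
  "coef (pscale (*) c u) k = c * coef u k"
  by (simp add: pscale_def coef_map)

lemma pscale_mult_single [simp]: "pscale (*) c (single k d) = single k (c * d)"
  by (simp add: pscale_def map_single)

lemma pscale_mult_add: "pscale (*) c (u + v) = pscale (*) c u + pscale (*) c (v::'k \<Rightarrow>\<^sub>0 complex)"
  by (rule poly_mapping_eqI) (simp add: lookup_add algebra_simps)

lemma pscale_mult_one [simp]: "pscale (*) 1 u = (u::'k \<Rightarrow>\<^sub>0 complex)"
  by (rule poly_mapping_eqI) simp

lemma pscale_mult_zero [simp]: "pscale (*) c 0 = (0::'k \<Rightarrow>\<^sub>0 complex)" "pscale (*) 0 u = (0::'k \<Rightarrow>\<^sub>0 complex)"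
  by (rule poly_mapping_eqI; simp)+

lemma vector_space_pscale_mult: "vector_space (pscale (*) :: complex \<Rightarrow> ('k \<Rightarrow>\<^sub>0 complex) \<Rightarrow> _)"
  by unfold_locales (auto intro!: poly_mapping_eqI simp: lookup_add algebra_simps)

lemma psign_simps [simp]:
  "psign 0 = 1" "psign 1 = -1" "psign e * psign e = 1" "psign e * (psign e * x) = x"
  by (cases e; simp add: psign_def)+

lemma psign_add: "psign (e + q) = psign e * psign q"
  by (cases e; cases q; simp add: psign_def)

lemma psign_of_nat: "psign (of_nat n) = (-1) ^ n"
  by (induction n) (simp_all only: of_nat_Suc psign_add psign_simps power_Suc of_nat_0 power_0)

lemma bit_double [simp]: "e + e = (0::bit)" "e + (e + q) = (q::bit)"
  by (cases e; cases q; simp)+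

section \<open>Laurent polynomials in super variables\<close>

lemma lmult_alt: "lmult f g = (\<Sum>p\<in>supp f. \<Sum>q\<in>supp g.
     single (fst p + fst q, snd p \<union> snd q) (coef f p * coef g q * xi_sign (snd p) (snd q)))"
  by (simp add: lmult_def case_prod_beta)

lemma lmult_add_left: "lmult (f + g) h = lmult f h + lmult g h"
  unfolding lmult_alt
  by (rule sum_supp_add[where \<phi> = "\<lambda>p c. \<Sum>q\<in>supp h.
      single (fst p + fst q, snd p \<union> snd q) (c * coef h q * xi_sign (snd p) (snd q))"])
    (simp add: sum.distrib[symmetric] single_add[symmetric] algebra_simps)

lemma lmult_add_right: "lmult f (g + h) = lmult f g + lmult f h"
  unfolding lmult_alt
  by (subst sum_supp_add[where \<phi> = "\<lambda>q c. single (_ + fst q, _ \<union> snd q) (_ * c * xi_sign _ (snd q))"])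
    (simp_all add: sum.distrib[symmetric] single_add[symmetric] algebra_simps)

lemma lmult_single [simp]: "lmult (single (k, I) c) (single (l, J) d) =
    single (k + l, I \<union> J) (c * d * xi_sign I J)"
  by (simp add: lmult_alt)

lemma ddt_add: "ddt (f + g) = ddt f + ddt g"
proof -
  have "ddt f = (\<Sum>p\<in>supp f. single (fst p - 1, snd p) (of_int (fst p) * coef f p))" for f :: "'a laurent"
    by (auto simp: ddt_def intro!: sum.cong)
  then show ?thesis
    by (simp only:, intro sum_supp_add) (simp add: single_add[symmetric] algebra_simps)
qed

lemma ddt_single [simp]: "ddt (single (k, I) c) = single (k - 1, I) (of_int k * c)"
  by (simp add: ddt_def)

lemma dxi_add: "dxi i (f + g) = dxi i f + dxi i g"
proof -
  have "dxi i f = (\<Sum>p\<in>supp f. if i \<in> snd p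
     then single (fst p, snd p - {i}) ((- 1) ^ card {j\<in>snd p. j < i} * coef f p) else 0)" for f :: "'a laurent"
    by (auto simp: dxi_def intro!: sum.cong)
  then show ?thesis
    by (simp only:, intro sum_supp_add) (simp add: single_add[symmetric] algebra_simps)
qed

lemma dxi_single [simp]: "dxi i (single (k, I) c) =
    (if i \<in> I then single (k, I - {i}) ((- 1) ^ card {j\<in>I. j < i} * c) else 0)"
  by (simp add: dxi_def)

lemma linvol_add: "linvol (f + g) = linvol f + linvol g"
proof -
  have "linvol f = (\<Sum>p\<in>supp f. single p ((- 1) ^ card (snd p) * coef f p))" for f :: "'a laurent"
    by (auto simp: linvol_def intro!: sum.cong)
  then show ?thesis
    by (simp only:, intro sum_supp_add) (simp add: single_add[symmetric] algebra_simps)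
qed

lemma linvol_single [simp]: "linvol (single (k, I) c) = single (k, I) ((- 1) ^ card I * c)"
  by (simp add: linvol_def)

lemma partial_add: "partial j (f + g) = partial j f + partial j g"
  by (cases j) (simp_all add: ddt_add dxi_add)

lemma additive_lmult_left: "Modules.additive (\<lambda>f. lmult f g)"
  by unfold_locales (rule lmult_add_left)
lemma additive_lmult_right: "Modules.additive (lmult f)"
  by unfold_locales (rule lmult_add_right)
lemma additive_partial: "Modules.additive (partial j)"
  by unfold_locales (rule partial_add)
lemma additive_ddt: "Modules.additive ddt"
  by unfold_locales (rule ddt_add)
lemma additive_dxi: "Modules.additive (dxi i)"
  by unfold_locales (rule dxi_add)
lemma additive_linvol: "Modules.additive linvol"
  by unfold_locales (rule linvol_add)

lemmas laurent_zero [simp] =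
  Modules.additive.zero[OF additive_lmult_left] Modules.additive.zero[OF additive_lmult_right]
  Modules.additive.zero[OF additive_partial] Modules.additive.zero[OF additive_ddt]
  Modules.additive.zero[OF additive_dxi] Modules.additive.zero[OF additive_linvol]

lemmas laurent_sum =
  Modules.additive.sum[OF additive_lmult_left] Modules.additive.sum[OF additive_lmult_right]
  Modules.additive.sum[OF additive_partial] Modules.additive.sum[OF additive_ddt]
  Modules.additive.sum[OF additive_dxi] Modules.additive.sum[OF additive_linvol]

lemmas laurent_diff =
  Modules.additive.diff[OF additive_lmult_left] Modules.additive.diff[OF additive_lmult_right]
  Modules.additive.diff[OF additive_partial] Modules.additive.diff[OF additive_ddt]
  Modules.additive.diff[OF additive_dxi] Modules.additive.diff[OF additive_linvol]

lemmas laurent_minus =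
  Modules.additive.minus[OF additive_lmult_left] Modules.additive.minus[OF additive_lmult_right]
  Modules.additive.minus[OF additive_partial] Modules.additive.minus[OF additive_ddt]
  Modules.additive.minus[OF additive_dxi] Modules.additive.minus[OF additive_linvol]

lemma lmult_scale_left: "lmult (pscale (*) c f) g = pscale (*) c (lmult f g)"
proof (rule additive_ext[where F = "\<lambda>f. lmult (pscale (*) c f) g"])
  show "lmult (pscale (*) c (single k d)) g = pscale (*) c (lmult (single k d) g)" for k d
    by (rule additive_ext[where f = g]; cases k)
      (auto simp: lmult_add_left lmult_add_right pscale_mult_add mult_ac)
qed (simp_all add: lmult_add_left pscale_mult_add)

lemma lmult_scale_right: "lmult f (pscale (*) c g) = pscale (*) c (lmult f g)"
proof (rule additive_ext[where F = "\<lambda>f. lmult f (pscale (*) c g)"])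
  show "lmult (single k d) (pscale (*) c g) = pscale (*) c (lmult (single k d) g)" for k d
    by (rule additive_ext[where f = g]; cases k)
      (auto simp: lmult_add_left lmult_add_right pscale_mult_add mult_ac)
qed (simp_all add: lmult_add_left pscale_mult_add)

lemma partial_scale: "partial j (pscale (*) c f) = pscale (*) c (partial j f)"
  by (rule additive_ext[where f = f]; cases j) (auto simp: ddt_add dxi_add pscale_mult_add mult_ac)

lemma xi_sign_empty [simp]: "xi_sign {} J = 1" "xi_sign I {} = 1"
  by (simp_all add: xi_sign_def)

lemma lmult_one [simp]: "lmult (mon 0 {}) f = f" "lmult f (mon 0 {}) = f"
  by (rule additive_ext[where f = f]; force simp: mon_def lmult_add_right lmult_add_left)+

section \<open>Signs from sorting odd variables, associativity and the Leibniz rules\<close>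

definition inv_count :: "'n::linorder set \<Rightarrow> 'n set \<Rightarrow> nat" where
  "inv_count I J = card {(i, j). i \<in> I \<and> j \<in> J \<and> j < i}"

lemma xi_sign_alt: "xi_sign I J = (if I \<inter> J = {} then (- 1) ^ inv_count I J else 0)"
  by (simp add: xi_sign_def inv_count_def)

lemma inv_count_Un_left:
  fixes I J K :: "'n::{finite,linorder} set"
  assumes "I \<inter> J = {}"
  shows "inv_count (I \<union> J) K = inv_count I K + inv_count J K"
proof -
  have "{(i, j). i \<in> I \<union> J \<and> j \<in> K \<and> j < i} =
      {(i, j). i \<in> I \<and> j \<in> K \<and> j < i} \<union> {(i, j). i \<in> J \<and> j \<in> K \<and> j < i}"
    by auto
  then show ?thesis
    unfolding inv_count_def using assms by (simp only:, intro card_Un_disjoint) auto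
qed

lemma inv_count_Un_right:
  fixes I J K :: "'n::{finite,linorder} set"
  assumes "J \<inter> K = {}"
  shows "inv_count I (J \<union> K) = inv_count I J + inv_count I K"
proof -
  have "{(i, j). i \<in> I \<and> j \<in> J \<union> K \<and> j < i} =
      {(i, j). i \<in> I \<and> j \<in> J \<and> j < i} \<union> {(i, j). i \<in> I \<and> j \<in> K \<and> j < i}"
    by auto
  then show ?thesis
    unfolding inv_count_def using assms by (simp only:, intro card_Un_disjoint) auto
qed

lemma inv_count_singleton:
  fixes I J :: "'n::{finite,linorder} set"
  shows "inv_count {i} J = card {j \<in> J. j < i}" "inv_count I {i} = card {j \<in> I. i < j}"
proof -
  have "{(a, j). a \<in> {i} \<and> j \<in> J \<and> j < a} = Pair i ` {j \<in> J. j < i}"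
    "{(a, j). a \<in> I \<and> j \<in> {i} \<and> j < a} = (\<lambda>a. (a, i)) ` {j \<in> I. i < j}"
    by auto
  then show "inv_count {i} J = card {j \<in> J. j < i}" "inv_count I {i} = card {j \<in> I. i < j}"
    unfolding inv_count_def by (auto simp: card_image inj_on_def)
qed

text \<open>Disjointness leaves no ties, so every pair in \<open>I \<times> J\<close> is an
  inversion in exactly one of the two orders.\<close>

lemma inv_count_swap:
  fixes I J :: "'n::{finite,linorder} set"
  assumes "I \<inter> J = {}"
  shows "inv_count I J + inv_count J I = card I * card J"
proof -
  have "I \<times> J = {(i, j). i \<in> I \<and> j \<in> J \<and> j < i} \<union> prod.swap ` {(i, j). i \<in> J \<and> j \<in> I \<and> j < i}"
    using assms by (auto simp: image_iff)
  then have "card (I \<times> J) = card {(i, j). i \<in> I \<and> j \<in> J \<and> j < i}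
      + card (prod.swap ` {(i, j). i \<in> J \<and> j \<in> I \<and> j < i})"
    by (simp only:, intro card_Un_disjoint) auto
  then show ?thesis
    by (simp add: inv_count_def card_image card_cartesian_product)
qed

lemma xi_sign_assoc:
  fixes I J K :: "'n::{finite,linorder} set"
  shows "xi_sign I J * xi_sign (I \<union> J) K = xi_sign J K * xi_sign I (J \<union> K)"
  by (auto simp: xi_sign_alt inv_count_Un_left inv_count_Un_right power_add Int_Un_distrib Int_Un_distrib2)

lemma lmult_assoc:
  fixes f g h :: "'n::{finite,linorder} laurent"
  shows "lmult (lmult f g) h = lmult f (lmult g h)"
proof (rule additive_ext[where F = "\<lambda>f. lmult (lmult f g) h"])
  fix p :: "int \<times> 'n set" and c
  show "lmult (lmult (single p c) g) h = lmult (single p c) (lmult g h)"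
  proof (rule additive_ext[where F = "\<lambda>g. lmult (lmult (single p c) g) h"])
    fix q :: "int \<times> 'n set" and d
    show "lmult (lmult (single p c) (single q d)) h = lmult (single p c) (lmult (single q d) h)"
    proof (rule additive_ext[where f = h])
      fix r :: "int \<times> 'n set" and e
      obtain k I l J m K where "p = (k, I)" "q = (l, J)" "r = (m, K)"
        by (metis surj_pair)
      then show "lmult (lmult (single p c) (single q d)) (single r e) =
          lmult (single p c) (lmult (single q d) (single r e))"
        using xi_sign_assoc[of I J K] by (simp add: Un_assoc add.assoc mult_ac)
    qed (simp_all add: lmult_add_left lmult_add_right)
  qed (simp_all add: lmult_add_left lmult_add_right)
qed (simp_all add: lmult_add_left lmult_add_right)

lemma xi_sign_commute:
  fixes I J :: "'n::{finite,linorder} set"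
  shows "xi_sign J I = (-1) ^ (card I * card J) * xi_sign I J"
proof (cases "I \<inter> J = {}")
  case True
  have "(-1::complex) ^ (card I * card J) * (-1) ^ inv_count I J =
      (-1) ^ (inv_count I J + inv_count I J) * (-1) ^ inv_count J I"
    unfolding inv_count_swap[OF True, symmetric] by (simp add: power_add)
  also have "\<dots> = (-1) ^ inv_count J I"
    by simp
  finally show ?thesis
    using True by (simp add: xi_sign_alt Int_commute)
qed (auto simp: xi_sign_def Int_commute)

lemma ddt_lmult:
  fixes f g :: "'n::linorder laurent"
  shows "ddt (lmult f g) = lmult (ddt f) g + lmult f (ddt g)"
proof (rule additive_ext[where F = "\<lambda>f. ddt (lmult f g)"])
  fix p :: "int \<times> 'n set" and c
  show "ddt (lmult (single p c) g) = lmult (ddt (single p c)) g + lmult (single p c) (ddt g)"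
  proof (rule additive_ext[where f = g])
    fix q :: "int \<times> 'n set" and d
    show "ddt (lmult (single p c) (single q d)) =
        lmult (ddt (single p c)) (single q d) + lmult (single p c) (ddt (single q d))"
      by (cases p; cases q) (simp add: single_add[symmetric] algebra_simps)
  qed (simp_all add: lmult_add_right ddt_add)
qed (simp_all add: lmult_add_left ddt_add)

lemma sign_move: "(-1) ^ m * a = b \<Longrightarrow> a = (-1) ^ m * (b::complex)"
  by auto

text \<open>The elements of \<open>J\<close> below \<open>i\<close> count twice on the left, once
  when \<partial>_i moves to its variable and once as inversions with \<open>i\<close>, and cancel
  modulo 2.\<close>

lemma dxi_lmult_sign:
  fixes I J :: "'n::{finite,linorder} set"
  assumes "i \<in> I" "i \<notin> J"
  shows "(-1) ^ card {j \<in> I \<union> J. j < i} * xi_sign I J =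
    (-1) ^ card {j \<in> I. j < i} * xi_sign (I - {i}) J"
proof (cases "I \<inter> J = {}")
  case True
  have "{j \<in> I \<union> J. j < i} = {j \<in> I. j < i} \<union> {j \<in> J. j < i}"
    by auto
  then have "card {j \<in> I \<union> J. j < i} = card {j \<in> I. j < i} + card {j \<in> J. j < i}"
    using True by (simp only:, intro card_Un_disjoint) auto
  moreover have "inv_count I J = card {j \<in> J. j < i} + inv_count (I - {i}) J"
    using inv_count_Un_left[of "{i}" "I - {i}" J] assms(1)
    by (simp add: inv_count_singleton insert_absorb)
  moreover have "(I - {i}) \<inter> J = {}"
    using True by auto
  ultimately show ?thesis
    using True by (simp add: xi_sign_alt power_add)
next
  case False
  then have "(I - {i}) \<inter> J \<noteq> {}"
    using assms by auto
  with False show ?thesis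
    by (simp add: xi_sign_def)
qed

lemma card_split_at:
  fixes I :: "'n::{finite,linorder} set"
  assumes "i \<notin> I"
  shows "card I = card {j \<in> I. j < i} + card {j \<in> I. i < j}"
proof -
  have "I = {j \<in> I. j < i} \<union> {j \<in> I. i < j}"
    using assms by (auto intro: le_neq_trans)
  then show ?thesis
    by (metis (no_types, lifting) card_Un_disjoint disjoint_iff finite mem_Collect_eq order_less_asym)
qed

text \<open>The elements of \<open>I\<close> below \<open>i\<close> are passed by the derivative,
  those above \<open>i\<close> are inversions with \<open>i\<close>. Together they give the sign
  (-1)^|I| of moving \<partial>_i past \<xi>_I.\<close>

lemma dxi_lmult_sign':
  fixes I J :: "'n::{finite,linorder} set"
  assumes "i \<notin> I" "i \<in> J"
  shows "(-1) ^ card {j \<in> I \<union> J. j < i} * xi_sign I J =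
    (-1) ^ card I * (-1) ^ card {j \<in> J. j < i} * xi_sign I (J - {i})"
proof (cases "I \<inter> J = {}")
  case True
  have "{j \<in> I \<union> J. j < i} = {j \<in> I. j < i} \<union> {j \<in> J. j < i}"
    by auto
  then have "card {j \<in> I \<union> J. j < i} = card {j \<in> I. j < i} + card {j \<in> J. j < i}"
    using True by (simp only:, intro card_Un_disjoint) auto
  moreover have "inv_count I J = card {j \<in> I. i < j} + inv_count I (J - {i})"
    using inv_count_Un_right[of "{i}" "J - {i}" I] assms(2)
    by (simp add: inv_count_singleton insert_absorb)
  moreover have "I \<inter> (J - {i}) = {}"
    using True by auto
  ultimately show ?thesis
    using True card_split_at[OF assms(1)] by (simp add: xi_sign_alt power_add)
next
  case False
  then have "I \<inter> (J - {i}) \<noteq> {}"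
    using assms by auto
  with False show ?thesis
    by (simp add: xi_sign_def)
qed

lemma dxi_lmult:
  fixes f g :: "'n::{finite,linorder} laurent"
  shows "dxi i (lmult f g) = lmult (dxi i f) g + lmult (linvol f) (dxi i g)"
proof (rule additive_ext[where F = "\<lambda>f. dxi i (lmult f g)"])
  fix p :: "int \<times> 'n set" and c
  show "dxi i (lmult (single p c) g) = lmult (dxi i (single p c)) g + lmult (linvol (single p c)) (dxi i g)"
  proof (rule additive_ext[where f = g])
    fix q :: "int \<times> 'n set" and d
    obtain k I l J where [simp]: "p = (k, I)" "q = (l, J)"
      by (metis surj_pair)
    consider "i \<in> I" "i \<in> J" | "i \<in> I" "i \<notin> J" | "i \<notin> I" "i \<in> J" | "i \<notin> I" "i \<notin> J"
      by blast
    then show "dxi i (lmult (single p c) (single q d)) =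
        lmult (dxi i (single p c)) (single q d) + lmult (linvol (single p c)) (dxi i (single q d))"
    proof cases
      case 1
      then have a: "xi_sign I J = 0" "I - {i} \<union> J = I \<union> J" "I \<union> (J - {i}) = I \<union> J"
        by (auto simp: xi_sign_def)
      \<comment> \<open>The product is zero here, while each term of the Leibniz rule may be
        nonzero. Both signs are expressed through that of \<open>I - {i}\<close> and
        \<open>J - {i}\<close>; they are opposite because \<open>I\<close> has one element more than
        \<open>I - {i}\<close>.\<close>
      have 0: "(-1) ^ card {j \<in> I. j < i} * xi_sign (I - {i}) J
          + (-1) ^ card I * ((-1) ^ card {j \<in> J. j < i} * xi_sign I (J - {i})) = 0"
      proof -
        have eq: "{j \<in> I. j < i} = {j \<in> I - {i}. j < i}" "I - {i} \<union> J = I \<union> J"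
          "I \<union> (J - {i}) = I \<union> J"
          using 1 by auto
        define s where "s = xi_sign (I - {i}) (J - {i})"
        define A B C where "A = card {j \<in> I \<union> J. j < i}" and "B = card {j \<in> J. j < i}"
          and "C = card {j \<in> I. j < i}"
        have *: "xi_sign (I - {i}) J = (-1) ^ A * ((-1) ^ card (I - {i}) * (-1) ^ B * s)"
          by (rule sign_move) (use dxi_lmult_sign'[of i "I - {i}" J] 1 in
              \<open>simp add: A_def B_def s_def eq(2)\<close>)
        have **: "xi_sign I (J - {i}) = (-1) ^ A * ((-1) ^ C * s)"
          by (rule sign_move) (use dxi_lmult_sign[of i I "J - {i}"] 1 in
              \<open>simp add: A_def C_def s_def eq(3)\<close>)
        have c: "card I = Suc (card (I - {i}))"
          by (rule card_Suc_Diff1[symmetric]) (use 1 in auto)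
        show ?thesis
          unfolding * ** c A_def[symmetric] B_def[symmetric] C_def[symmetric]
          by (simp add: mult_ac)
      qed
      show ?thesis
        using 1 a arg_cong[OF 0, of "\<lambda>x. c * d * x"]
        by (simp add: single_add[symmetric] algebra_simps)
    next
      case 2
      have a: "I \<union> J - {i} = I - {i} \<union> J"
        using 2 by auto
      show ?thesis
        using 2 dxi_lmult_sign[OF 2] by (simp add: a algebra_simps)
    next
      case 3
      have a: "I \<union> J - {i} = I \<union> (J - {i})"
        using 3 by auto
      show ?thesis
        using 3 dxi_lmult_sign'[OF 3] by (simp add: a algebra_simps)
    qed simp
  qed (simp_all add: lmult_add_right dxi_add)
qed (simp_all add: lmult_add_left linvol_add dxi_add)

lemma ddt_dxi: "ddt (dxi i f) = dxi i (ddt f)"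
  by (rule additive_ext[where f = f]) (auto simp: ddt_add dxi_add mult.left_commute)

lemma dxi_dxi:
  fixes f :: "'n::{finite,linorder} laurent"
  shows "dxi i (dxi j f) = - dxi j (dxi i f)"
proof (rule additive_ext[where f = f])
  fix p :: "int \<times> 'n set" and c
  obtain k I where p: "p = (k, I)"
    by (cases p)
  have "dxi i (dxi j (single (k, I) c)) = - dxi j (dxi i (single (k, I) c))" if "i < j" "i \<in> I" "j \<in> I" for i j
  proof -
    have "{l \<in> I. l < j} = insert i {l \<in> I - {i}. l < j}" "{l \<in> I - {j}. l < i} = {l \<in> I. l < i}"
      using that by auto
    moreover have "I - {i} - {j} = I - {j} - {i}"
      by auto
    ultimately show ?thesis
      using that by (simp add: single_uminus[symmetric] mult.left_commute del: single_uminus)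
  qed
  note * = this
  show "dxi i (dxi j (single p c)) = - dxi j (dxi i (single p c))"
  proof (cases "i \<in> I \<and> j \<in> I")
    case True
    then show ?thesis
      using *[of i j] *[of j i] unfolding p by (cases i j rule: linorder_cases) simp_all
  qed (auto simp: p)
qed (simp_all add: dxi_add)

declare add_bit_eq_xor [simp del] mult_bit_eq_and [simp del] bit_not_zero_iff [simp del] bit_not_one_iff [simp del]

section \<open>Parity, supercommutativity and the super Leibniz rule\<close>

abbreviation par :: "'n option \<Rightarrow> bit" where
  "par j \<equiv> E_par None j"

lemma par_simps [simp]: "E_par None None = 0" "E_par None (Some i) = 1"
  "E_par (Some i) None = 1" "E_par (Some i) (Some j) = 0"
  by (simp_all add: E_par_def)

lemma lpart_iff: "f \<in> lpart e \<longleftrightarrow> (\<forall>k I. coef f (k, I) \<noteq> 0 \<longrightarrow> of_nat (card I) = e)"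
  by (auto simp: lpart_def in_keys_iff)

lemma lpart_zero [simp]: "0 \<in> lpart e"
  by (simp add: lpart_iff)

lemma lpart_add: "f \<in> lpart e \<Longrightarrow> g \<in> lpart e \<Longrightarrow> f + g \<in> lpart e"
  by (simp add: lpart_iff lookup_add) (metis add.right_neutral)

lemma lpart_scale: "f \<in> lpart e \<Longrightarrow> pscale (*) c f \<in> lpart e"
  by (auto simp: lpart_iff)

lemma lpart_sum: "(\<And>a. a \<in> A \<Longrightarrow> f a \<in> lpart e) \<Longrightarrow> sum f A \<in> lpart e"
  by (induction A rule: infinite_finite_induct) (auto intro: lpart_add)

lemma lpart_single: "of_nat (card I) = e \<Longrightarrow> single (k, I) c \<in> lpart e"
  by (auto simp: lpart_iff lookup_single when_def)

lemma lpart_linear_image: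
  assumes add: "\<And>f g. F (f + g) = F f + F g"
    and single: "\<And>k I c. of_nat (card I) = e \<Longrightarrow> F (single (k, I) c) \<in> lpart q"
    and f: "f \<in> lpart e"
  shows "F f \<in> lpart q"
proof -
  interpret Modules.additive F by unfold_locales (rule add)
  have "F f = (\<Sum>k\<in>supp f. F (single k (coef f k)))"
    by (subst sum_singles[symmetric], subst sum) simp
  also have "\<dots> \<in> lpart q"
    using f by (intro lpart_sum) (auto simp: lpart_iff[of f] in_keys_iff split_paired_all intro!: single)
  finally show ?thesis .
qed

lemma lpart_partial:
  fixes f :: "'n::{finite,linorder} laurent"
  assumes "f \<in> lpart e"
  shows "partial j f \<in> lpart (par j + e)"
proof (rule lpart_linear_image[where f = f])
  fix k :: int and I :: "'n set" and c
  assume e: "of_nat (card I) = e"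
  show "partial j (single (k, I) c) \<in> lpart (par j + e)"
  proof (cases j)
    case (Some i)
    have "of_nat (card (I - {i})) = 1 + e" if "i \<in> I"
      using card_Suc_Diff1[of I i] that by (simp only: e[symmetric]) (metis bit_double(2) finite of_nat_Suc)
    then show ?thesis
      using Some by (auto intro!: lpart_single)
  qed (simp add: lpart_single e)
qed (simp_all add: partial_add assms)

lemma lpart_lmult:
  fixes f g :: "'n::{finite,linorder} laurent"
  assumes "f \<in> lpart e" "g \<in> lpart q"
  shows "lmult f g \<in> lpart (e + q)"
proof (rule lpart_linear_image[where f = f and F = "\<lambda>f. lmult f g"])
  fix k :: int and I :: "'n set" and c
  assume e: "of_nat (card I) = e"
  show "lmult (single (k, I) c) g \<in> lpart (e + q)"
  proof (rule lpart_linear_image[where f = g])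
    fix l :: int and J :: "'n set" and d
    assume q: "of_nat (card J) = q"
    show "lmult (single (k, I) c) (single (l, J) d) \<in> lpart (e + q)"
      by (cases "I \<inter> J = {}")
        (auto simp: xi_sign_def card_Un_disjoint e[symmetric] q[symmetric] intro!: lpart_single)
  qed (simp_all add: lmult_add_right assms)
qed (simp_all add: lmult_add_left assms)

lemma linvol_coef: "coef (linvol f) (k, I) = (-1) ^ card I * coef f (k, I)"
  by (rule additive_ext[where F = "\<lambda>f. coef (linvol f) (k, I)" and G = "\<lambda>f. (-1) ^ card I * coef f (k, I)"])
    (auto simp: linvol_add lookup_add algebra_simps split_paired_all lookup_single when_def)

lemma linvol_linvol [simp]: "linvol (linvol f) = f"
  by (rule poly_mapping_eqI) (simp add: linvol_coef split_paired_all)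

lemma linvol_lpart: "f \<in> lpart e \<Longrightarrow> linvol f = pscale (*) (psign e) f"
  by (rule poly_mapping_eqI) (auto simp: linvol_coef split_paired_all lpart_iff psign_of_nat[symmetric])

lemma partial_lmult:
  fixes f g :: "'n::{finite,linorder} laurent"
  assumes "f \<in> lpart e"
  shows "partial j (lmult f g) = lmult (partial j f) g + pscale (*) (psign (par j * e)) (lmult f (partial j g))"
  by (cases j) (simp_all add: ddt_lmult dxi_lmult linvol_lpart[OF assms] lmult_scale_left)

lemma pscale_mult_minus_one [simp]: "pscale (*) (-1) u = - (u::'k \<Rightarrow>\<^sub>0 complex)"
  by (rule poly_mapping_eqI) simp

lemma partial_commute:
  fixes f :: "'n::{finite,linorder} laurent"
  shows "partial i (partial j f) = pscale (*) (psign (par i * par j)) (partial j (partial i f))"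
proof (cases i; cases j)
  fix a b assume "i = Some a" "j = Some b"
  then show ?thesis
    using dxi_dxi[of a b f] by simp
qed (simp_all add: ddt_dxi)

lemma lmult_commute:
  fixes f g :: "'n::{finite,linorder} laurent"
  assumes "f \<in> lpart e" "g \<in> lpart q"
  shows "lmult f g = pscale (*) (psign (e * q)) (lmult g f)"
proof (rule additive_ext[where F = "\<lambda>f. lmult f g"])
  fix p :: "int \<times> 'n set" and c assume p: "p \<in> supp f"
  show "lmult (single p c) g = pscale (*) (psign (e * q)) (lmult g (single p c))"
  proof (rule additive_ext[where f = g])
    fix r :: "int \<times> 'n set" and d assume r: "r \<in> supp g"
    obtain k I l J where [simp]: "p = (k, I)" "r = (l, J)"
      by (metis surj_pair)
    have "e = of_nat (card I)" "q = of_nat (card J)"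
      using p r assms by (auto simp: lpart_iff in_keys_iff)
    then have "psign (e * q) = (-1) ^ (card I * card J)"
      by (simp add: psign_of_nat[symmetric])
    then show "lmult (single p c) (single r d) = pscale (*) (psign (e * q)) (lmult (single r d) (single p c))"
      using xi_sign_commute[of J I] by (simp add: Un_commute add.commute mult_ac)
  qed (simp_all add: lmult_add_right lmult_add_left pscale_mult_add)
qed (simp_all add: lmult_add_left lmult_add_right pscale_mult_add)

section \<open>The Weyl superalgebra and the Lie superalgebras inside it\<close>

lemma vector_space_op_scale: "vector_space (op_scale :: complex \<Rightarrow> 'n lop \<Rightarrow> 'n lop)"
  by unfold_locales (auto simp: op_scale_def fun_eq_iff intro!: poly_mapping_eqI simp: lookup_add algebra_simps)

interpretation op: vector_space "op_scale :: complex \<Rightarrow> 'n lop \<Rightarrow> 'n lop"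
  by (rule vector_space_op_scale)

interpretation laurent: vector_space "pscale (*) :: complex \<Rightarrow> ('k \<Rightarrow>\<^sub>0 complex) \<Rightarrow> _"
  by (rule vector_space_pscale_mult)

lemma op_simps: "(a + b) f = a f + b f" "(a \<circ> b) f = a (b f)" "op_scale c a f = pscale (*) c (a f)"
    "sum h A f = (\<Sum>j\<in>A. h j f)" "(a - b) f = a f - b f" "(- a) f = - (a f)" "(0 :: 'n lop) f = 0"
  for a b :: "'n lop"
  by (simp_all add: op_scale_def) (induction A rule: infinite_finite_induct; simp)

lemma K_alg_zero: "0 \<in> K_alg"
  using K_alg.scale[OF K_alg.unit, of 0] by simp

lemma K_alg_sum: "(\<And>a. a \<in> A \<Longrightarrow> h a \<in> K_alg) \<Longrightarrow> sum h A \<in> K_alg"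
  by (induction A rule: infinite_finite_induct) (auto intro: K_alg.add K_alg_zero)

lemma K_alg_additive: "a \<in> K_alg \<Longrightarrow> a (f + g) = a f + a g"
  by (induction arbitrary: f g rule: K_alg.induct)
    (simp_all add: lmult_add_right partial_add op_simps pscale_mult_add algebra_simps)

lemma K_alg_scale: "a \<in> K_alg \<Longrightarrow> a (pscale (*) c f) = pscale (*) c (a f)"
  by (induction arbitrary: f rule: K_alg.induct)
    (simp_all add: lmult_scale_right partial_scale op_simps pscale_mult_add algebra_simps)

lemma lmult_comp:
  fixes f g :: "'n::{finite,linorder} laurent"
  shows "lmult f \<circ> lmult g = lmult (lmult f g)"
  by (simp add: fun_eq_iff lmult_assoc)

lemma lmult_t: "lmult (mon k {}) (mon l J) = mon (k + l) J"
  by (simp add: mon_def)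

lemma xi_sign_square: "I \<inter> J = {} \<Longrightarrow> xi_sign I J * xi_sign I J = 1"
  by (simp add: xi_sign_def)

lemma lmult_mon_K_alg: "lmult (mon k I :: 'n::{finite,linorder} laurent) \<in> K_alg"
proof -
  have t: "lmult (mon k {} :: 'n laurent) \<in> K_alg" for k
  proof (induction k rule: int_induct[where k = 0])
    case base
    have "lmult (mon 0 {} :: 'n laurent) = (\<lambda>f. f)"
      by (simp add: fun_eq_iff)
    then show ?case
      using K_alg.unit by simp
  next
    case (step1 i)
    show ?case
      using K_alg.comp[OF K_alg.t step1(2)] by (simp add: lmult_comp lmult_t add.commute)
  next
    case (step2 i)
    show ?case
      using K_alg.comp[OF K_alg.t_inv step2(2)] by (simp add: lmult_comp lmult_t)
  qed
  have xi: "lmult (mon 0 I :: 'n laurent) \<in> K_alg"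
  proof (induction I rule: finite_induct[OF finite])
    case (2 i I)
    \<comment> \<open>The sign from sorting is its own inverse, since \<open>i\<close> is not in
      \<open>I\<close>.\<close>
    have "lmult (mon 0 (insert i I)) = op_scale (xi_sign {i} I) (lmult (mon 0 {i}) \<circ> lmult (mon 0 I))"
      using 2 by (simp add: lmult_comp mon_def fun_eq_iff op_scale_def lmult_scale_left[symmetric] xi_sign_square)
    then show ?case
      using 2 by (auto intro: K_alg.intros)
  qed (rule t)
  show ?thesis
    using K_alg.comp[OF t xi] by (simp add: lmult_comp lmult_t)
qed

lemma lmult_expand: "lmult f = (\<Sum>(k, I)\<in>supp f. op_scale (coef f (k, I)) (lmult (mon k I)))"
proof
  fix g
  have "lmult f g = (\<Sum>p\<in>supp f. lmult (single p (coef f p)) g)"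
    by (subst sum_singles[symmetric], subst laurent_sum) simp
  also have "\<dots> = (\<Sum>(k, I)\<in>supp f. op_scale (coef f (k, I)) (lmult (mon k I))) g"
    unfolding op_simps by (rule sum.cong) (auto simp: op_simps lmult_scale_left[symmetric] mon_def)
  finally show "lmult f g = (\<Sum>(k, I)\<in>supp f. op_scale (coef f (k, I)) (lmult (mon k I))) g" .
qed

lemma lmult_K_alg: "lmult (f :: 'n::{finite,linorder} laurent) \<in> K_alg"
  by (subst lmult_expand) (auto intro!: K_alg_sum K_alg.scale lmult_mon_K_alg)

section \<open>Superderivations, their brackets and integration by parts\<close>

lemma superderivation_alt: "superderivation f = (\<Sum>j\<in>UNIV. lmult (f j) \<circ> partial j)"
  by (simp add: superderivation_def fun_eq_iff op_simps)

lemma superderivation_K_alg: "superderivation f \<in> K_alg"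
  unfolding superderivation_alt by (intro K_alg_sum K_alg.comp lmult_K_alg K_alg.partial)

lemma superderivation_add: "superderivation (\<lambda>j. f j + g j) = superderivation f + superderivation g"
  by (simp add: superderivation_def fun_eq_iff lmult_add_left sum.distrib)

lemma superderivation_scale: "superderivation (\<lambda>j. pscale (*) c (f j)) = op_scale c (superderivation f)"
  by (simp add: superderivation_def fun_eq_iff op_scale_def lmult_scale_left laurent.scale_sum_right)

lemma superderivation_diff: "superderivation (\<lambda>j. f j - g j) = superderivation f - superderivation g"
  by (simp add: superderivation_def fun_eq_iff laurent_diff sum_subtractf)

lemma superderivation_single:
  "superderivation (\<lambda>i. if i = j then f else 0) = lmult f \<circ> partial j"
proof
  fix g
  have "superderivation (\<lambda>i. if i = j then f else 0) g
      = (\<Sum>i\<in>UNIV. if i = j then lmult f (partial i g) else 0)"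
    unfolding superderivation_def by (rule sum.cong) auto
  then show "superderivation (\<lambda>i. if i = j then f else 0) g = (lmult f \<circ> partial j) g"
    by simp
qed

lemma UNIV_option_sum: "(\<Sum>j\<in>UNIV. h j) = h None + (\<Sum>i\<in>UNIV. h (Some i))"
  for h :: "'n::finite option \<Rightarrow> 'a::comm_monoid_add"
  by (simp add: UNIV_option_conv sum.reindex)

lemma coefficient_superderivation [simp]: "coefficient (superderivation f) j = f j"
proof (cases j)
  case None
  have "dxi i (mon 1 {}) = 0" "ddt (mon 1 {} :: 'a laurent) = mon 0 {}" for i :: 'a
    by (simp_all add: mon_def)
  then show ?thesis
    using None by (simp add: superderivation_def UNIV_option_sum)
next
  case (Some i)
  have "lmult (f l) (partial l (mon 0 {i})) = (if l = j then f j else 0)" for l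
  proof (cases l)
    case (Some m)
    have *: "{j \<in> {i}. j < i} = {}" by auto
    have "dxi i (mon 0 {i}) = mon 0 {}"
      by (simp only: mon_def dxi_single * card.empty) simp
    moreover have "dxi m (mon 0 {i}) = 0" if "m \<noteq> i"
      using that by (simp add: mon_def)
    ultimately show ?thesis
      using Some \<open>j = Some i\<close> by auto
  qed (simp add: Some mon_def)
  then show ?thesis
    by (simp add: Some superderivation_def)
qed

lemma coefficient_homogeneous:
  assumes "\<And>q. x ` lpart q \<subseteq> lpart (e + q)"
  shows "coefficient x j \<in> lpart (e + par j)"
proof (cases j)
  case None
  have "mon 1 {} \<in> lpart 0" by (simp add: mon_def lpart_single)
  then show ?thesis using None assms[of 0] by auto
next
  case (Some i)
  have "mon 0 {i} \<in> lpart 1" by (simp add: mon_def lpart_single)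
  then show ?thesis using Some assms[of 1] by auto
qed

lemma superderivation_lpart:
  assumes "\<And>j. f j \<in> lpart (e + par j)"
  shows "superderivation f ` lpart q \<subseteq> lpart (e + q)"
proof
  fix u assume "u \<in> superderivation f ` lpart q"
  then obtain g where g: "g \<in> lpart q" "u = superderivation f g"
    by auto
  have "lmult (f j) (partial j g) \<in> lpart (e + q)" for j
    using lpart_lmult[OF assms[of j] lpart_partial[OF g(1), of j]] by (simp add: add.assoc)
  then show "u \<in> lpart (e + q)"
    by (simp add: g superderivation_def lpart_sum)
qed

text \<open>Each composite is a first-order field plus a second-order part. Coefficients and
  derivations both supercommute, so the second-order parts of the two orders agree up to
  \<open>psign (e * q)\<close> and cancel.\<close>

lemma superderivation_bracket:
  fixes f g :: "'n::{finite,linorder} option \<Rightarrow> 'n laurent"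
  assumes f: "\<And>j. f j \<in> lpart (e + par j)" and g: "\<And>j. g j \<in> lpart (q + par j)"
  defines "x \<equiv> superderivation f" and "y \<equiv> superderivation g"
  shows "x (y h) - pscale (*) (psign (e * q)) (y (x h)) =
    superderivation (\<lambda>j. x (g j) - pscale (*) (psign (e * q)) (y (f j))) h"
proof -
  have second: "superderivation f (superderivation g h) = superderivation (\<lambda>j. superderivation f (g j)) h
      + (\<Sum>a\<in>UNIV. \<Sum>b\<in>UNIV. pscale (*) (psign (par a * (q + par b)))
          (lmult (lmult (f a) (g b)) (partial a (partial b h))))"
    if g: "\<And>j. g j \<in> lpart (q + par j)" for f g :: "'n option \<Rightarrow> 'n laurent" and q
  proof -
    have "superderivation f (superderivation g h) =
        (\<Sum>a\<in>UNIV. \<Sum>b\<in>UNIV. lmult (lmult (f a) (partial a (g b))) (partial b h) +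
          pscale (*) (psign (par a * (q + par b))) (lmult (lmult (f a) (g b)) (partial a (partial b h))))"
      unfolding superderivation_def
      by (simp add: laurent_sum partial_lmult[OF g] lmult_add_right lmult_scale_right lmult_assoc)
    moreover have "superderivation (\<lambda>j. superderivation f (g j)) h =
        (\<Sum>b\<in>UNIV. \<Sum>a\<in>UNIV. lmult (lmult (f a) (partial a (g b))) (partial b h))"
      unfolding superderivation_def by (simp add: laurent_sum)
    ultimately show ?thesis
      by (subst (asm) (2) sum.swap) (simp add: sum.distrib)
  qed
  have eq: "pscale (*) (psign (par a * (q + par b))) (lmult (lmult (f a) (g b)) (partial a (partial b h))) =
      pscale (*) (psign (e * q)) (pscale (*) (psign (par b * (e + par a)))
        (lmult (lmult (g b) (f a)) (partial b (partial a h))))" for a b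
  proof -
    have "psign (par a * (q + par b)) * (psign ((e + par a) * (q + par b)) * psign (par a * par b)) =
        psign (e * q) * psign (par b * (e + par a))"
      by (cases "par a"; cases "par b"; cases e; cases q) (simp_all add: psign_def)
    then show ?thesis
      by (simp add: lmult_commute[OF f g] partial_commute[of a b] lmult_scale_left lmult_scale_right mult_ac)
  qed
  have "(\<Sum>a\<in>UNIV. \<Sum>b\<in>UNIV. pscale (*) (psign (par a * (e + par b)))
          (lmult (lmult (g a) (f b)) (partial a (partial b h)))) =
      (\<Sum>a\<in>UNIV. \<Sum>b\<in>UNIV. pscale (*) (psign (par b * (e + par a)))
          (lmult (lmult (g b) (f a)) (partial b (partial a h))))"
    by (rule sum.swap)
  then show ?thesis
    unfolding x_def y_def second[OF g] second[OF f] superderivation_diff superderivation_scale op_simps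
    by (simp add: eq laurent.scale_right_distrib laurent.scale_sum_right)
qed

text \<open>Integration by parts: a superderivation is the adjoint of its transpose up to its superdivergence.\<close>

lemma superderivation_by_parts:
  "superderivation f + lmult (superdivergence f) =
    (ddt \<circ> lmult (f None)) + (\<Sum>i\<in>UNIV. dxi i \<circ> lmult (linvol (f (Some i))))"
proof
  fix g
  have "(ddt \<circ> lmult (f None)) g + (\<Sum>i\<in>UNIV. dxi i \<circ> lmult (linvol (f (Some i)))) g =
      lmult (f None) (ddt g) + (\<Sum>i\<in>UNIV. lmult (f (Some i)) (dxi i g)) + lmult (superdivergence f) g"
    by (simp add: op_simps ddt_lmult dxi_lmult sum.distrib superdivergence_def lmult_add_left laurent_sum)
  then show "(superderivation f + lmult (superdivergence f)) g =
      ((ddt \<circ> lmult (f None)) + (\<Sum>i\<in>UNIV. dxi i \<circ> lmult (linvol (f (Some i))))) g"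
    by (simp add: superderivation_def UNIV_option_sum)
qed

text \<open>The coefficient at \<open>t^-1 \<xi>_[1,n]\<close> is the Berezin integral composed with the residue.\<close>

lemma berezin_partial: "coef (partial j f) (- 1, UNIV) = 0"
  by (rule additive_ext[where f = f and G = "\<lambda>_. 0"])
    (cases j; auto simp: partial_add ddt_add dxi_add lookup_add lookup_single when_def)+

text \<open>Only \<xi>_I is completed to the full product by the complementary monomial: an overlap
  gives zero, and a gap leaves a variable missing.\<close>

lemma berezin_nondegenerate:
  fixes d :: "'n::{finite,linorder} laurent"
  shows "coef (lmult d (mon (- 1 - k) (- I))) (- 1, UNIV) = coef d (k, I) * xi_sign I (- I)"
proof (rule additive_ext[where f = d and F = "\<lambda>d. coef (lmult d (mon (- 1 - k) (- I))) (- 1, UNIV)"])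
  fix p :: "int \<times> 'n set" and c
  obtain l J where "p = (l, J)" by (metis surj_pair)
  then show "coef (lmult (single p c) (mon (- 1 - k) (- I))) (- 1, UNIV) =
      coef (single p c) (k, I) * xi_sign I (- I)"
    by (auto simp: mon_def lookup_single when_def xi_sign_def)
qed (simp_all add: lmult_add_left lookup_add algebra_simps)

text \<open>Describes divergence-free fields by a condition on their values: the Berezin integral
  vanishes on the range. The condition is linear and holds for both composites in a bracket, so the
  divergence of a bracket is never computed.\<close>

lemma superdivergence_zero_iff:
  "superdivergence f = 0 \<longleftrightarrow> (\<forall>g. coef (superderivation f g) (- 1, UNIV) = 0)"
proof -
  have eq: "coef (superderivation f g) (- 1, UNIV) = - coef (lmult (superdivergence f) g) (- 1, UNIV)" for g
  proof -
    have "(superderivation f + lmult (superdivergence f)) g =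
        ((ddt \<circ> lmult (f None)) + (\<Sum>i\<in>UNIV. dxi i \<circ> lmult (linvol (f (Some i))))) g"
      by (simp only: superderivation_by_parts)
    from arg_cong[OF this, of "\<lambda>u. coef u (- 1, UNIV)"]
    have "coef (superderivation f g) (- 1, UNIV) + coef (lmult (superdivergence f) g) (- 1, UNIV) = 0"
      using berezin_partial[of None "lmult (f None) g"]
        sum.neutral[of UNIV "\<lambda>i. coef (partial (Some i) (lmult (linvol (f (Some i))) g)) (- 1, UNIV)"]
      by (simp add: op_simps lookup_add lookup_sum berezin_partial del: partial.simps(2)) (simp add: berezin_partial[of "Some _", simplified])
    then show ?thesis
      by (simp add: eq_neg_iff_add_eq_0)
  qed
  show ?thesis
  proof
    assume *: "\<forall>g. coef (superderivation f g) (- 1, UNIV) = 0"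
    have "coef (superdivergence f) (k, I) = 0" for k I
    proof -
      have "coef (superdivergence f) (k, I) * xi_sign I (- I) = 0"
        using * eq[of "mon (- 1 - k) (- I)"] by (simp add: berezin_nondegenerate)
      then show ?thesis
        by (simp add: xi_sign_def)
    qed
    then show "superdivergence f = 0"
      by (intro poly_mapping_eqI) (simp add: split_paired_all)
  qed (simp add: eq)
qed

section \<open>Divergence-free fields and the derived algebra\<close>

lemma S_alg_iff: "x \<in> S_alg \<longleftrightarrow> x \<in> W_alg \<and> (\<forall>g. coef (x g) (- 1, UNIV) = 0)"
  by (auto simp: S_alg_def W_alg_def superdivergence_zero_iff)

lemma S_alg_subspace: "op.subspace S_alg"
proof (rule op.subspaceI)
  show "0 \<in> S_alg"
    using superderivation_scale[of 0 "\<lambda>_. 0"] superdivergence_zero_iff[of "\<lambda>_. 0"]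
    by (auto simp: S_alg_def image_iff superdivergence_def intro!: exI[of _ "\<lambda>_. 0"])
  show "x + y \<in> S_alg" if "x \<in> S_alg" "y \<in> S_alg" for x y
    using that by (auto simp: S_alg_iff W_alg_def op_simps lookup_add superderivation_add[symmetric])
  show "op_scale c x \<in> S_alg" if "x \<in> S_alg" for c x
    using that by (auto simp: S_alg_iff W_alg_def op_simps superderivation_scale[symmetric])
qed

lemma S_alg_bracket:
  assumes "x \<in> homogeneous S_alg e" "y \<in> homogeneous S_alg q"
  shows "(\<lambda>g. x (y g) - pscale (*) (psign (e * q)) (y (x g))) \<in> S_alg"
proof -
  obtain f g where x: "x = superderivation f" and y: "y = superderivation g"
    using assms by (auto simp: homogeneous_def S_alg_def)
  have "f j \<in> lpart (e + par j)" "g j \<in> lpart (q + par j)" for j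
    using coefficient_homogeneous[of x e j] coefficient_homogeneous[of y q j] assms
    by (auto simp: homogeneous_def x y)
  note superderivation_bracket[OF this]
  then have "(\<lambda>g. x (y g) - pscale (*) (psign (e * q)) (y (x g))) =
      superderivation (\<lambda>j. x (g j) - pscale (*) (psign (e * q)) (y (f j)))"
    by (simp add: x y fun_eq_iff)
  then have "(\<lambda>g. x (y g) - pscale (*) (psign (e * q)) (y (x g))) \<in> W_alg"
    by (simp add: W_alg_def)
  with assms show ?thesis
    by (auto simp: S_alg_iff homogeneous_def lookup_minus)
qed

lemma S'_alg_subset_S_alg: "S'_alg \<subseteq> S_alg"
  unfolding S'_alg_def
  by (rule op.span_minimal[OF _ S_alg_subspace]) (use S_alg_bracket in blast)

lemma S'_alg_superderivation:
  assumes "x \<in> S'_alg"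
  obtains f where "x = superderivation f" "superdivergence f = 0"
  using assms S'_alg_subset_S_alg by (auto simp: S_alg_def)

lemma S'_alg_subset_K_alg: "S'_alg \<subseteq> K_alg"
  using S'_alg_superderivation superderivation_K_alg by blast

lemma homogeneous_S'_alg: "x \<in> homogeneous S'_alg e \<Longrightarrow> x \<in> homogeneous K_alg e"
  using S'_alg_subset_K_alg by (auto simp: homogeneous_def)

lemma S'_alg_bracketI:
  assumes "x \<in> homogeneous S_alg e" "y \<in> homogeneous S_alg q"
    and "\<And>g. x (y g) - pscale (*) (psign (e * q)) (y (x g)) = pscale (*) c (z g)" "c \<noteq> 0"
  shows "z \<in> S'_alg"
proof -
  have "(\<lambda>g. x (y g) - pscale (*) (psign (e * q)) (y (x g))) \<in> S'_alg"
    unfolding S'_alg_def by (rule op.span_base) (use assms in blast)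
  moreover have "(\<lambda>g. x (y g) - pscale (*) (psign (e * q)) (y (x g))) = op_scale c z"
    using assms by (simp add: fun_eq_iff op_scale_def)
  ultimately have "op_scale c z \<in> S'_alg"
    by simp
  then have "op_scale (inverse c) (op_scale c z) \<in> S'_alg"
    unfolding S'_alg_def by (rule op.span_scale)
  then show ?thesis
    using assms(4) by simp
qed

section \<open>Explicit fields in the derived algebra\<close>

lemma lmult_dxi_single:
  fixes I :: "'n::{finite,linorder} set"
  shows "lmult (mon 0 {i}) (dxi i (single (k, I) c)) = single (k, I) (of_bool (i \<in> I) * c)"
proof (cases "i \<in> I")
  case True
  then have "xi_sign {i} (I - {i}) = (- 1) ^ card {j \<in> I - {i}. j < i}"
    by (simp add: xi_sign_alt inv_count_singleton)
  moreover have "{j \<in> I - {i}. j < i} = {j \<in> I. j < i}"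
    by auto
  ultimately show ?thesis
    using True by (simp add: mon_def insert_absorb mult_ac)
qed simp

text \<open>\<xi>_i \<partial>_i alone has superdivergence -1. For distinct indices the difference
  is divergence-free, and it acts diagonally on monomials.\<close>

definition cartan :: "'n::{finite,linorder} \<Rightarrow> 'n \<Rightarrow> 'n lop" where
  "cartan i j = (lmult (mon 0 {i}) \<circ> dxi i) - (lmult (mon 0 {j}) \<circ> dxi j)"

lemma cartan_add: "cartan i j (f + g) = cartan i j f + cartan i j g"
  by (simp add: cartan_def dxi_add lmult_add_right)

lemma cartan_zero: "cartan i j 0 = 0"
  by (simp add: cartan_def)

lemma cartan_single:
  "cartan i j (single (k, I) c) = single (k, I) ((of_bool (i \<in> I) - of_bool (j \<in> I)) * c)"
  by (simp add: cartan_def lmult_dxi_single single_diff[symmetric] left_diff_distrib del: dxi_single)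

lemma cartan_superderivation:
  assumes "i \<noteq> j"
  shows "cartan i j = superderivation (\<lambda>a. if a = Some i then mon 0 {i} else if a = Some j then - mon 0 {j} else 0)"
proof -
  have "cartan i j = superderivation (\<lambda>a. if a = Some i then mon 0 {i} else 0) -
      superderivation (\<lambda>a. if a = Some j then mon 0 {j} else 0)"
    by (simp add: superderivation_single cartan_def)
  also have "\<dots> = superderivation (\<lambda>a. if a = Some i then mon 0 {i} else if a = Some j then - mon 0 {j} else 0)"
    unfolding superderivation_diff[symmetric]
    by (rule arg_cong[where f = superderivation]) (use assms in auto)
  finally show ?thesis .
qed

lemma mon_lpart: "of_nat (card I) = e \<Longrightarrow> mon k I \<in> lpart e"
  by (simp add: mon_def lpart_single)

lemma dxi_mon_self [simp]: "dxi i (mon k {i}) = mon k {}"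
proof -
  have *: "{j \<in> {i}. j < i} = {}" by auto
  show ?thesis
    by (simp only: mon_def dxi_single * card.empty) simp
qed

lemma lpart_minus: "f \<in> lpart e \<Longrightarrow> - f \<in> lpart e"
  using lpart_scale[of f e "-1"] by simp

lemma homogeneous_S_algI:
  assumes "x = superderivation f" "superdivergence f = 0" "\<And>j. f j \<in> lpart (e + par j)"
  shows "x \<in> homogeneous S_alg e"
  using assms superderivation_lpart[of f e] by (auto simp: homogeneous_def S_alg_def)

lemma linvol_mon: "linvol (mon k I) = pscale (*) ((-1) ^ card I) (mon k I)"
  by (simp add: mon_def)

lemma dxi_scale: "dxi i (pscale (*) c f) = pscale (*) c (dxi i f)"
  using partial_scale[of "Some i"] by simp

lemma cartan_homogeneous:
  assumes "i \<noteq> j"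
  shows "cartan i j \<in> homogeneous S_alg 0"
proof (rule homogeneous_S_algI[OF cartan_superderivation[OF assms]])
  let ?f = "\<lambda>a. if a = Some i then mon 0 {i} else if a = Some j then - mon 0 {j} else 0"
  have "dxi l (linvol (?f (Some l))) = (if l = i then - mon 0 {} else 0) + (if l = j then mon 0 {} else 0)" for l
    using assms by (simp add: linvol_mon laurent_minus)
  then show "superdivergence ?f = 0"
    by (simp add: superdivergence_def sum.distrib)
  show "?f a \<in> lpart (0 + par a)" for a
    by (auto intro!: mon_lpart lpart_minus)
qed

text \<open>The superdivergence vanishes because the coefficient does not involve the variable of
  its own derivative; for d/dt this means \<open>k = 0\<close>.\<close>

lemma lmult_partial_homogeneous:
  assumes "\<And>l. a = Some l \<Longrightarrow> l \<notin> J" "a = None \<Longrightarrow> k = 0"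
  shows "lmult (mon k J) \<circ> partial a \<in> homogeneous S_alg (of_nat (card J) + par a)"
proof (rule homogeneous_S_algI[OF superderivation_single[symmetric]])
  let ?f = "\<lambda>i. if i = a then mon k J else 0"
  show "superdivergence ?f = 0"
  proof (cases a)
    case None
    then show ?thesis using assms by (simp add: superdivergence_def mon_def)
  next
    case (Some l)
    have "l \<notin> J"
      using Some assms by simp
    then have "dxi i (linvol (?f (Some i))) = 0" for i
      using Some by (auto simp: linvol_mon dxi_scale mon_def)
    then show ?thesis
      using Some by (simp add: superdivergence_def)
  qed
  show "?f j \<in> lpart (of_nat (card J) + par a + par j)" for j
    by (auto intro!: mon_lpart simp: add.assoc)
qed

text \<open>
  The bracket with \<open>\<xi>_i \<partial>_i - \<xi>_j \<partial>_j\<close> multiplies a monomial field by its weight, which puts the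
  field into the derived algebra as soon as the weight is nonzero.
\<close>

lemma cartan_bracket:
  fixes J :: "'n::{finite,linorder} set"
  shows "cartan i j (lmult (mon k J) (partial a g)) - lmult (mon k J) (partial a (cartan i j g)) =
    pscale (*) (of_bool (i \<in> J) - of_bool (j \<in> J) - of_bool (a = Some i) + of_bool (a = Some j))
      (lmult (mon k J) (partial a g))"
proof (rule additive_ext[where f = g])
  fix p :: "int \<times> 'n set" and c
  obtain m I where p: "p = (m, I)" by (metis surj_pair)
  show "cartan i j (lmult (mon k J) (partial a (single p c))) - lmult (mon k J) (partial a (cartan i j (single p c))) =
    pscale (*) (of_bool (i \<in> J) - of_bool (j \<in> J) - of_bool (a = Some i) + of_bool (a = Some j))
      (lmult (mon k J) (partial a (single p c)))"
  proof (cases a)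
    case None
    show ?thesis
    proof (cases "J \<inter> I = {}")
      case True
      then show ?thesis
        unfolding None p cartan_single by (auto simp: mon_def cartan_single single_diff[symmetric] algebra_simps)
    next
      case False
      then show ?thesis
        unfolding None p cartan_single by (simp add: mon_def xi_sign_def cartan_zero)
    qed
  next
    case (Some l)
    show ?thesis
    proof (cases "l \<in> I \<and> J \<inter> (I - {l}) = {}")
      case True
      then show ?thesis
        unfolding Some p cartan_single by (auto simp: mon_def cartan_single single_diff[symmetric] algebra_simps)
    next
      case False
      then have "lmult (mon k J) (partial a (single (m, I) d)) = 0" for d
        using Some by (auto simp: mon_def xi_sign_def)
      then show ?thesis
        unfolding p cartan_single by (simp add: cartan_zero)
    qed
  qed
qed (simp_all add: cartan_add lmult_add_right partial_add pscale_mult_add)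

lemma exists_other:
  fixes i :: "'n::finite"
  assumes "CARD('n) \<ge> 2"
  obtains j where "j \<noteq> i"
proof -
  have "UNIV \<noteq> {i}"
  proof
    assume "UNIV = {i}"
    then have "CARD('n) = card {i}" by (rule arg_cong)
    with assms show False by simp
  qed
  then show ?thesis using that by auto
qed

lemma S'_alg_lmult_dxi:
  fixes i :: "'n::{finite,linorder}"
  assumes "CARD('n) \<ge> 2" "i \<notin> J"
  shows "lmult (mon k J) \<circ> dxi i \<in> S'_alg"
proof -
  obtain j where j: "j \<noteq> i"
    using exists_other[OF assms(1)] .
  \<comment> \<open>The weight of t^k \<xi>_J \<partial>_i under \<open>cartan j i\<close>. It is 1
    or 2, as \<open>i\<close> is not in \<open>J\<close> and \<open>j\<close> differs from
    \<open>i\<close>.\<close>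
  let ?c = "of_bool (j \<in> J) - of_bool (i \<in> J) - of_bool (Some i = Some j) + of_bool (Some i = Some i) :: complex"
  show ?thesis
  proof (rule S'_alg_bracketI[OF cartan_homogeneous[OF j] lmult_partial_homogeneous[where a = "Some i" and J = J and k = k]])
    show "cartan j i ((lmult (mon k J) \<circ> partial (Some i)) g) -
         pscale (*) (psign (0 * (of_nat (card J) + par (Some i)))) ((lmult (mon k J) \<circ> partial (Some i)) (cartan j i g)) =
         pscale (*) ?c ((lmult (mon k J) \<circ> dxi i) g)" for g
      using cartan_bracket[of j i k J "Some i" g] by simp
    show "?c \<noteq> 0"
      using assms j by auto
  qed (use assms in auto)
qed

lemma S'_alg_xi_ddt:
  fixes i :: "'n::{finite,linorder}"
  assumes "CARD('n) \<ge> 2"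
  shows "lmult (mon 0 {i}) \<circ> ddt \<in> S'_alg"
proof -
  obtain j where j: "j \<noteq> i"
    using exists_other[OF assms(1)] .
  have "i \<noteq> j" using j by simp
  show ?thesis
  proof (rule S'_alg_bracketI[OF cartan_homogeneous[OF \<open>i \<noteq> j\<close>] lmult_partial_homogeneous[where a = None and J = "{i}" and k = 0]])
    show "cartan i j ((lmult (mon 0 {i}) \<circ> partial None) g) -
         pscale (*) (psign (0 * (of_nat (card {i}) + par None))) ((lmult (mon 0 {i}) \<circ> partial None) (cartan i j g)) =
         pscale (*) 1 ((lmult (mon 0 {i}) \<circ> ddt) g)" for g
      using cartan_bracket[of i j 0 "{i}" None g] j by simp
  qed auto
qed

text \<open>Every \<open>cartan i j\<close> commutes with d/dt, so another partner is taken: t d/dt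
  + \<xi>_i \<partial>_i. Its superdivergence is 1 - 1 = 0, and its bracket with d/dt is d/dt
  again.\<close>

lemma S'_alg_ddt: "(ddt :: 'n::{finite,linorder} lop) \<in> S'_alg"
proof -
  define i :: 'n where "i = undefined"
  let ?f = "\<lambda>a. if a = None then mon 1 {} else if a = Some i then mon 0 {i} else 0"
  define y where "y = superderivation ?f"
  have y: "y g = lmult (mon 1 {}) (ddt g) + lmult (mon 0 {i}) (dxi i g)" for g
  proof -
    have "y = superderivation (\<lambda>a. if a = None then mon 1 {} else 0) +
        superderivation (\<lambda>a. if a = Some i then mon 0 {i} else 0)"
      unfolding y_def superderivation_add[symmetric] by (rule arg_cong[where f = superderivation]) auto
    then show ?thesis
      by (simp add: superderivation_single)
  qed
  have ddt_mon: "ddt (mon 1 {} :: 'n laurent) = mon 0 {}" "ddt (mon 0 {i}) = 0"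
    by (simp_all add: mon_def)
  have "y \<in> homogeneous S_alg 0"
  proof (rule homogeneous_S_algI[OF y_def])
    have "dxi l (linvol (?f (Some l))) = (if l = i then - mon 0 {} else 0)" for l
      by (simp add: linvol_mon laurent_minus)
    then show "superdivergence ?f = 0"
      by (simp add: superdivergence_def ddt_mon)
    show "?f a \<in> lpart (0 + par a)" for a
      by (auto intro!: mon_lpart)
  qed
  note y_homogeneous = this
  have ddt_homogeneous: "ddt \<in> homogeneous S_alg (0 :: bit)"
    using lmult_partial_homogeneous[where a = None and J = "{}" and k = 0] by (simp add: comp_def)
  show ?thesis
  proof (rule S'_alg_bracketI[where c = 1, OF ddt_homogeneous y_homogeneous])
    show "ddt (y g) - pscale (*) (psign (0 * 0)) (y (ddt g)) = pscale (*) 1 (ddt g)" for g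
      by (simp add: y ddt_add ddt_lmult ddt_mon ddt_dxi)
  qed simp
qed

lemma S'_alg_partial:
  fixes j :: "'n::{finite,linorder} option"
  assumes "CARD('n) \<ge> 2"
  shows "partial j \<in> S'_alg"
proof (cases j)
  case (Some i)
  then show ?thesis
    using S'_alg_lmult_dxi[OF assms, of i "{}" 0] by (simp add: comp_def)
qed (simp add: S'_alg_ddt)

section \<open>The natural module\<close>

lemma lpart_subspace: "laurent.subspace (lpart e)"
  by (rule laurent.subspaceI) (auto intro: lpart_add lpart_scale)

lemma lpart_Int: "lpart 0 \<inter> lpart 1 = {0 :: 'n laurent}"
proof -
  have "f = 0" if "f \<in> lpart 0" "f \<in> lpart 1" for f :: "'n laurent"
    using that by (intro poly_mapping_eqI) (auto simp: lpart_iff split_paired_all)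
  then show ?thesis
    by auto
qed

lemma lpart_decompose: "\<exists>a\<in>lpart 0. \<exists>b\<in>lpart 1. f = a + b"
proof -
  have "\<exists>a\<in>lpart 0. \<exists>b\<in>lpart 1. (\<Sum>k\<in>A. single k (coef f k)) = a + b" if "finite A" for A
    using that
  proof (induction A)
    case (insert p A)
    then obtain a b where ab: "a \<in> lpart 0" "b \<in> lpart 1" "(\<Sum>k\<in>A. single k (coef f k)) = a + b"
      by blast
    obtain k I where p: "p = (k, I)" by (metis surj_pair)
    show ?case
    proof (cases "of_nat (card I) :: bit")
      case zero
      then have "single p (coef f p) + a \<in> lpart 0"
        by (simp add: p lpart_add lpart_single ab)
      then show ?thesis
        using insert ab by (metis (no_types, lifting) add.assoc sum.insert)
    next
      case one
      then have "single p (coef f p) + b \<in> lpart 1"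
        by (simp add: p lpart_add lpart_single ab)
      then show ?thesis
        using insert ab by (metis (no_types, lifting) add.left_commute sum.insert)
    qed
  qed (use lpart_zero in \<open>metis add.right_neutral sum.empty\<close>)
  from this[OF finite_keys, of f] show ?thesis
    by (simp add: sum_singles)
qed

lemma K_module_laurent: "K_module (pscale (*)) lpart (\<lambda>x. x :: 'n::{finite,linorder} lop)"
  unfolding K_module_def
proof (intro conjI allI ballI)
  show "vector_space (pscale (*) :: complex \<Rightarrow> 'n laurent \<Rightarrow> _)"
    by (rule vector_space_pscale_mult)
  show "Vector_Spaces.linear (pscale (*)) (pscale (*)) a" if "a \<in> K_alg" for a :: "'n lop"
    using that by unfold_locales (simp_all add: K_alg_additive K_alg_scale)
  show "\<exists>a\<in>lpart 0. \<exists>b\<in>lpart 1. p = a + b" for p :: "'n laurent"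
    by (rule lpart_decompose)
  show "lpart 0 \<inter> lpart 1 = {0 :: 'n laurent}"
    by (rule lpart_Int)
qed (auto simp: lpart_subspace op_simps homogeneous_def)

lemma coef_t_ddt: "coef (lmult (mon 1 {}) (ddt f)) (m, L) = of_int m * coef f (m, L)"
  by (rule additive_ext[where F = "\<lambda>f. coef (lmult (mon 1 {}) (ddt f)) (m, L)" and G = "\<lambda>f. of_int m * coef f (m, L)"])
    (auto simp: ddt_add lmult_add_right lookup_add algebra_simps mon_def lookup_single when_def split: if_splits)

lemma coef_xi_dxi:
  fixes f :: "'n::{finite,linorder} laurent"
  shows "coef (lmult (mon 0 {i}) (dxi i f)) (m, L) = of_bool (i \<in> L) * coef f (m, L)"
proof (rule additive_ext[where F = "\<lambda>f. coef (lmult (mon 0 {i}) (dxi i f)) (m, L)" and G = "\<lambda>f. of_bool (i \<in> L) * coef f (m, L)"])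
  fix r :: "int \<times> 'n set" and c
  show "coef (lmult (mon 0 {i}) (dxi i (single r c))) (m, L) = of_bool (i \<in> L) * coef (single r c) (m, L)"
    by (cases r) (simp only: lmult_dxi_single, simp add: lookup_single when_def)
qed (simp_all add: dxi_add lmult_add_right lookup_add algebra_simps)

text \<open>In a nonzero element with the fewest monomials, the diagonal operators t d/dt and
  \<xi>_i \<partial>_i cannot tell two monomials apart, since otherwise a combination would have
  smaller support. So it is a single monomial, which derivatives and a power of t reduce to
  1.\<close>

lemma K_stable_contains_one:
  fixes U :: "'n::{finite,linorder} laurent set"
  assumes U: "laurent.subspace U" and K: "\<And>a f. a \<in> K_alg \<Longrightarrow> f \<in> U \<Longrightarrow> a f \<in> U" and "U \<noteq> {0}"
  shows "mon 0 {} \<in> U"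
proof -
  have "\<exists>f. f \<in> U \<and> f \<noteq> 0"
    using assms laurent.subspace_0[OF U] by auto
  then obtain f where f: "f \<in> U" "f \<noteq> 0"
    and min: "\<And>g. g \<in> U \<Longrightarrow> g \<noteq> 0 \<Longrightarrow> card (supp f) \<le> card (supp g)"
    using exists_least_iff[of "\<lambda>n. \<exists>f. f \<in> U \<and> f \<noteq> 0 \<and> card (supp f) = n"]
    by (metis (mono_tags, lifting) not_le_imp_less)
  have no: False if "g \<in> U" "p \<in> supp f" "q \<in> supp f" "coef g p = 0" "coef g q \<noteq> 0" "supp g \<subseteq> supp f" for g p q
  proof -
    have "supp g \<subset> supp f"
      using that by (auto simp: in_keys_iff)
    then have "card (supp g) < card (supp f)"
      by (simp add: psubset_card_mono)
    moreover have "g \<noteq> 0"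
      using that by auto
    ultimately show False
      using min[OF that(1)] by simp
  qed
  have same: "p = q" if pq: "p \<in> supp f" "q \<in> supp f" for p q
  proof (rule ccontr)
    assume "p \<noteq> q"
    obtain k I l J where p: "p = (k, I)" and q: "q = (l, J)"
      by (metis surj_pair)
    have sub: "supp g \<subseteq> supp f" if "\<And>m L. coef g (m, L) = h m L * coef f (m, L)" for g and h :: "int \<Rightarrow> 'n set \<Rightarrow> complex"
      using that by (auto simp: in_keys_iff split_paired_all)
    have xiU: "lmult (mon 0 {i}) (dxi i f) \<in> U" for i
      using K[OF K_alg.comp[OF K_alg.xi[of i] K_alg.partial[of "Some i"]] f(1)] by simp
    have xino: "i \<in> I \<longleftrightarrow> i \<in> J" for i
      using no[OF xiU, of p q i] no[OF xiU, of q p i] sub[OF coef_xi_dxi] pq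
      by (auto simp: p q coef_xi_dxi in_keys_iff)
    show False
    proof (cases "k = l")
      case True
      then show False
        using xino \<open>p \<noteq> q\<close> by (auto simp: p q)
    next
      case False
      define g where "g = lmult (mon 1 {}) (ddt f) - pscale (*) (of_int k) f"
      have g: "coef g (m, L) = (of_int m - of_int k) * coef f (m, L)" for m L
        by (simp add: g_def lookup_minus coef_t_ddt algebra_simps)
      have "g \<in> U"
        unfolding g_def using K[OF K_alg.comp[OF K_alg.t K_alg.partial[of None]] f(1)] f
        by (intro laurent.subspace_diff[OF U] laurent.subspace_scale[OF U]) auto
      from no[OF this pq] show False
        using False pq sub[OF g] by (simp add: p q g in_keys_iff)
    qed
  qed
  obtain k I where p: "(k, I) \<in> supp f"
    using f by (metis all_not_in_conv keys_eq_empty surj_pair poly_mapping_eqI keys_zero in_keys_iff lookup_zero)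
  define c where "c = coef f (k, I)"
  have "f = single (k, I) c"
  proof (rule poly_mapping_eqI)
    show "coef f q = coef (single (k, I) c) q" for q
      using same[OF p, of q] by (auto simp: c_def lookup_single when_def in_keys_iff)
  qed
  moreover have "c \<noteq> 0"
    using p by (simp add: c_def in_keys_iff)
  ultimately have *: "single (k, I) c \<in> U" "c \<noteq> 0"
    using f by auto
  \<comment> \<open>Removing the odd variables one at a time changes the coefficient only by
    signs.\<close>
  have reduce: "single (k, {}) c \<in> U \<or> single (k, {}) (- c) \<in> U" if "single (k, I) c \<in> U" for I c
    using finite[of I] that
  proof (induction I arbitrary: c rule: finite_psubset_induct)
    case (psubset I)
    show ?case
    proof (cases "I = {}")
      case False
      then obtain i where i: "i \<in> I" by auto
      have "dxi i (single (k, I) c) \<in> U"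
        using K[OF K_alg.partial[of "Some i"] psubset.prems] by simp
      then have "single (k, I - {i}) ((- 1) ^ card {j \<in> I. j < i} * c) \<in> U"
        using i by simp
      from psubset.IH[OF _ this] show ?thesis
        using i psubset by (cases "even (card {j \<in> I. j < i})") auto
    qed (use psubset in auto)
  qed
  obtain d where d: "single (k, {}) d \<in> U" "d \<noteq> 0"
    using reduce[OF *(1)] *(2) by auto
  have "lmult (pscale (*) (inverse d) (mon (- k) {})) (single (k, {}) d) \<in> U"
    by (rule K[OF lmult_K_alg d(1)])
  then show ?thesis
    using d by (simp add: mon_def)
qed

section \<open>Supermodules as subspaces\<close>

lemma supermodule_on_simps [simp]:
  "carrier (supermodule_on sc V r G) = G" "\<zero>\<^bsub>supermodule_on sc V r G\<^esub> = 0"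
  "v \<oplus>\<^bsub>supermodule_on sc V r G\<^esub> w = v + w" "c \<odot>\<^bsub>supermodule_on sc V r G\<^esub> v = sc c v"
  "part (supermodule_on sc V r G) = (\<lambda>e. V e \<inter> G)" "act (supermodule_on sc V r G) = r"
  by (simp_all add: supermodule_on_def)

lemma restrict_to_supermodule_on:
  "H \<subseteq> G \<Longrightarrow> restrict_to (supermodule_on sc V r G) H = supermodule_on sc V r H"
  by (auto simp: restrict_to_def supermodule_on_def fun_eq_iff)

lemma parity_change_supermodule_on:
  "parity_change (supermodule_on sc V r G) = supermodule_on sc (\<lambda>e. V (e + 1)) r G"
  by (simp add: parity_change_def supermodule_on_def)

lemma zero_module_supermodule_on: "zero_module (supermodule_on sc V r G) \<longleftrightarrow> G = {0}"
  by (simp add: zero_module_def)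

locale complex_space = vector_space sc for sc :: "complex \<Rightarrow> 'v::ab_group_add \<Rightarrow> 'v"
begin

lemma graded_submodule_iff:
  assumes G: "subspace G"
  shows "graded_submodule L (supermodule_on sc V r G) H \<longleftrightarrow>
    H \<subseteq> G \<and> subspace H \<and> (\<forall>v\<in>H. \<exists>a\<in>H \<inter> V 0. \<exists>b\<in>H \<inter> V 1. v = a + b) \<and> (\<forall>x\<in>L. \<forall>v\<in>H. r x v \<in> H)"
proof -
  let ?M = "supermodule_on sc V r G"
  have inv: "inv\<^bsub>add_monoid ?M\<^esub> v = - v" if "v \<in> G" for v
    unfolding m_inv_def using that subspace_neg[OF G that]
    by (intro the_equality) (auto simp: eq_neg_iff_add_eq_0 add.commute)
  have sub: "submodule H (ring_of_type_algebra :: complex ring) ?M \<longleftrightarrow> H \<subseteq> G \<and> subspace H"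
  proof
    assume "submodule H (ring_of_type_algebra :: complex ring) ?M"
    then interpret submodule H "ring_of_type_algebra :: complex ring" ?M .
    have "sc c v \<in> H" if "v \<in> H" for c v
      using smult_closed[of c v] that by (simp add: ring_of_type_algebra_def)
    then show "H \<subseteq> G \<and> subspace H"
      using subset one_closed m_closed by (auto intro!: subspaceI)
  next
    assume H: "H \<subseteq> G \<and> subspace H"
    show "submodule H (ring_of_type_algebra :: complex ring) ?M"
    proof (intro submodule.intro subgroup.intro submodule_axioms.intro)
      show "inv\<^bsub>add_monoid ?M\<^esub> v \<in> H" if "v \<in> H" for v
        using that H inv[of v] subspace_neg[of H v] by auto
    qed (use H in \<open>auto intro: subspace_add subspace_0 subspace_scale\<close>)
  qed
  have part: "H \<inter> (V e \<inter> G) = H \<inter> V e" if "H \<subseteq> G" for e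
    using that by auto
  show ?thesis
    unfolding graded_submodule_def sub by (auto simp: part)
qed

lemma simple_module_iff:
  assumes "subspace G"
  shows "simple_module L (supermodule_on sc V r G) \<longleftrightarrow>
    G \<noteq> {0} \<and> (\<forall>H. graded_submodule L (supermodule_on sc V r G) H \<longrightarrow> H = {0} \<or> H = G)"
  by (simp add: simple_module_def zero_module_def)

end

text \<open>Stability of \<open>H\<close> and additivity of the action are what make the unions over
  representatives in \<open>quotient_by\<close> single cosets.\<close>

locale quotient_space = complex_space sc for sc :: "complex \<Rightarrow> 'v::ab_group_add \<Rightarrow> 'v" +
  fixes V :: "bit \<Rightarrow> 'v set" and r :: "'x \<Rightarrow> 'v \<Rightarrow> 'v" and G H :: "'v set" and L :: "'x set"
  assumes G: "subspace G" and H: "subspace H" "H \<subseteq> G"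
    and V: "\<And>e. subspace (V e)"
    and rG: "\<And>x v. x \<in> L \<Longrightarrow> v \<in> G \<Longrightarrow> r x v \<in> G"
    and rH: "\<And>x v. x \<in> L \<Longrightarrow> v \<in> H \<Longrightarrow> r x v \<in> H"
    and r_add: "\<And>x v w. x \<in> L \<Longrightarrow> v \<in> G \<Longrightarrow> w \<in> G \<Longrightarrow> r x (v + w) = r x v + r x w"
begin

abbreviation "M \<equiv> supermodule_on sc V r G"

definition coset :: "'v \<Rightarrow> 'v set" where
  "coset v = H +>\<^bsub>M\<^esub> v"

lemma coset_iff: "w \<in> coset v \<longleftrightarrow> w - v \<in> H"
proof -
  have "w \<in> coset v \<longleftrightarrow> (\<exists>h\<in>H. w = h + v)"
    by (simp add: coset_def a_r_coset_def')
  then show ?thesis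
    by (metis add_diff_cancel_right' diff_add_cancel)
qed

lemma coset_eq_iff: "coset v = coset w \<longleftrightarrow> v - w \<in> H"
proof
  assume "coset v = coset w"
  then show "v - w \<in> H"
    using coset_iff[of v v] coset_iff[of v w] subspace_0[OF H(1)] by simp
next
  assume *: "v - w \<in> H"
  have "u - v \<in> H \<longleftrightarrow> u - w \<in> H" for u
    using subspace_add[OF H(1), of "u - v" "v - w"] subspace_diff[OF H(1), of "u - w" "v - w"] * by auto
  then show "coset v = coset w"
    by (auto simp: coset_iff)
qed

lemma coset_self: "v \<in> coset v"
  using subspace_0[OF H(1)] by (simp add: coset_iff)

lemma coset_zero_iff: "coset v = H \<longleftrightarrow> v \<in> H"
proof -
  have "coset 0 = H" by (auto simp: coset_iff)
  then show ?thesis using coset_eq_iff[of v 0] by simp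
qed

lemma quotient_carrier: "carrier (quotient_by M H) = coset ` G"
  by (auto simp: quotient_by_def A_RCOSETS_def' coset_def)

lemma quotient_zero: "\<zero>\<^bsub>quotient_by M H\<^esub> = H"
  by (simp add: quotient_by_def)

lemma quotient_add: "coset v \<oplus>\<^bsub>quotient_by M H\<^esub> coset w = coset (v + w)"
proof -
  have "coset v \<oplus>\<^bsub>quotient_by M H\<^esub> coset w = {a + b | a b. a \<in> coset v \<and> b \<in> coset w}"
    by (auto simp: quotient_by_def set_add_def set_mult_def)
  also have "\<dots> = coset (v + w)"
  proof (intro Set.set_eqI iffI)
    fix u assume "u \<in> {a + b | a b. a \<in> coset v \<and> b \<in> coset w}"
    then obtain a b where "u = a + b" "a - v \<in> H" "b - w \<in> H"
      by (auto simp: coset_iff)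
    then show "u \<in> coset (v + w)"
      using subspace_add[OF H(1), of "a - v" "b - w"] by (simp add: coset_iff algebra_simps)
  next
    fix u assume "u \<in> coset (v + w)"
    then have "u - w \<in> coset v" "u = (u - w) + w"
      by (simp_all add: coset_iff algebra_simps)
    then show "u \<in> {a + b | a b. a \<in> coset v \<and> b \<in> coset w}"
      using coset_self by blast
  qed
  finally show ?thesis .
qed

lemma quotient_scale: "c \<odot>\<^bsub>quotient_by M H\<^esub> coset v = coset (sc c v)"
proof -
  have "coset (sc c u) = coset (sc c v)" if "u \<in> coset v" for u
    using that subspace_scale[OF H(1), of "u - v" c]
    by (simp add: coset_iff coset_eq_iff scale_right_diff_distrib)
  then have "(\<Union>u\<in>coset v. coset (sc c u)) = coset (sc c v)"
    using coset_self by blast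
  then show ?thesis
    by (simp add: quotient_by_def coset_def)
qed

lemma quotient_act:
  assumes "x \<in> L" "v \<in> G"
  shows "act (quotient_by M H) x (coset v) = coset (r x v)"
proof -
  have "coset (r x u) = coset (r x v)" if "u \<in> coset v" for u
  proof -
    have h: "u - v \<in> H" using that by (simp add: coset_iff)
    then have "r x u = r x (u - v) + r x v"
      using r_add[of x "u - v" v] assms H by auto
    then show ?thesis
      using rH[OF assms(1) h] by (simp add: coset_eq_iff)
  qed
  then have "(\<Union>u\<in>coset v. coset (r x u)) = coset (r x v)"
    using coset_self by blast
  then show ?thesis
    by (simp add: quotient_by_def coset_def)
qed

lemma quotient_part: "part (quotient_by M H) e = coset ` (V e \<inter> G)"
  by (simp add: quotient_by_def coset_def)

lemma quotient_zero_module_iff: "zero_module (quotient_by M H) \<longleftrightarrow> H = G"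
proof -
  have "coset ` G = {H} \<longleftrightarrow> (\<forall>v\<in>G. coset v = H)"
    using subspace_0[OF G] by blast
  then have "coset ` G = {H} \<longleftrightarrow> G \<subseteq> H"
    by (simp only: coset_zero_iff subset_eq)
  then show ?thesis
    using H by (auto simp: zero_module_def quotient_carrier quotient_zero)
qed

lemma quotient_trivial:
  assumes "\<And>x v. x \<in> L \<Longrightarrow> v \<in> G \<Longrightarrow> r x v \<in> H" "H \<noteq> G"
  shows "trivial_module L (quotient_by M H)"
  using assms by (auto simp: trivial_module_def quotient_zero_module_iff quotient_carrier
      quotient_act quotient_zero coset_zero_iff)

lemma quotient_simple:
  assumes graded: "\<And>v. v \<in> H \<Longrightarrow> \<exists>a\<in>H \<inter> V 0. \<exists>b\<in>H \<inter> V 1. v = a + b" and "H \<noteq> G"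
    and max: "\<And>G'. graded_submodule L M G' \<Longrightarrow> H \<subseteq> G' \<Longrightarrow> G' = H \<or> G' = G"
  shows "simple_module L (quotient_by M H)"
  unfolding simple_module_def
proof (intro conjI allI impI)
  show "\<not> zero_module (quotient_by M H)"
    using assms by (simp add: quotient_zero_module_iff)
next
  fix N assume N: "graded_submodule L (quotient_by M H) N"
  then interpret submodule N "ring_of_type_algebra :: complex ring" "quotient_by M H"
    by (simp add: graded_submodule_def)
  define G' where "G' = {v \<in> G. coset v \<in> N}"
  have N_image: "N = coset ` G'"
    using subset by (auto simp: G'_def quotient_carrier)
  have G'_sub: "subspace G'"
  proof (rule subspaceI)
    show "0 \<in> G'"
      using one_closed subspace_0[OF G] coset_zero_iff[of 0] subspace_0[OF H(1)]
      by (simp add: G'_def quotient_zero)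
    show "v + w \<in> G'" if "v \<in> G'" "w \<in> G'" for v w
      using that m_closed[of "coset v" "coset w"] subspace_add[OF G] by (simp add: G'_def quotient_add)
    show "sc c v \<in> G'" if "v \<in> G'" for c v
      using that smult_closed[of c "coset v"] subspace_scale[OF G]
      by (simp add: G'_def quotient_scale ring_of_type_algebra_def)
  qed
  have "H \<subseteq> G'"
    using H one_closed by (auto simp: G'_def quotient_zero coset_zero_iff[THEN iffD2])
  have "\<exists>a\<in>G' \<inter> V 0. \<exists>b\<in>G' \<inter> V 1. v = a + b" if "v \<in> G'" for v
  proof -
    have v: "coset v \<in> N" "v \<in> G" using that by (auto simp: G'_def)
    obtain A B where A: "A \<in> N \<inter> part (quotient_by M H) 0" and B: "B \<in> N \<inter> part (quotient_by M H) 1"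
      and eq: "coset v = A \<oplus>\<^bsub>quotient_by M H\<^esub> B"
      using N v by (auto simp: graded_submodule_def)
    obtain a b where a: "A = coset a" "a \<in> V 0" "a \<in> G" and b: "B = coset b" "b \<in> V 1" "b \<in> G"
      using A B by (auto simp: quotient_part)
    \<comment> \<open>Homogeneous representatives add up to \<open>v\<close> only modulo
      \<open>H\<close>. The error is split by the grading of \<open>H\<close> and distributed over
      the two parities.\<close>
    have "v - (a + b) \<in> H"
      using eq by (simp add: a b quotient_add coset_eq_iff)
    from graded[OF this] obtain h k where hk: "h \<in> H" "h \<in> V 0" "k \<in> H" "k \<in> V 1" "v - (a + b) = h + k"
      by blast
    have "a + h \<in> G' \<inter> V 0" "b + k \<in> G' \<inter> V 1"
      using A B a b hk H V subspace_add[OF G] coset_eq_iff[of "a + h" a] coset_eq_iff[of "b + k" b]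
      by (auto simp: G'_def intro: subspace_add)
    moreover have "v = (a + h) + (b + k)"
      using hk by (simp add: algebra_simps)
    ultimately show ?thesis by blast
  qed
  moreover have "r x v \<in> G'" if "x \<in> L" "v \<in> G'" for x v
  proof -
    have "act (quotient_by M H) x (coset v) \<in> N"
      using N that by (auto simp: graded_submodule_def G'_def)
    then show ?thesis
      using that rG by (simp add: G'_def quotient_act)
  qed
  ultimately have "graded_submodule L M G'"
    using G'_sub by (simp add: graded_submodule_iff[OF G]) (auto simp: G'_def)
  from max[OF this \<open>H \<subseteq> G'\<close>] show "N = {\<zero>\<^bsub>quotient_by M H\<^esub>} \<or> N = carrier (quotient_by M H)"
  proof
    assume "G' = H"
    then have "N = (\<lambda>_. H) ` H"
      unfolding N_image using coset_zero_iff by (intro image_cong) auto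
    then have "N = {H}"
      using subspace_0[OF H(1)] by auto
    then show ?thesis by (simp add: quotient_zero)
  qed (simp add: N_image quotient_carrier)
qed

lemma quotient_isomorphic:
  fixes g :: "'v \<Rightarrow> 'w::ab_group_add"
  assumes add: "\<And>v w. v \<in> G \<Longrightarrow> w \<in> G \<Longrightarrow> g (v + w) = g v + g w"
    and scale: "\<And>c v. v \<in> G \<Longrightarrow> g (sc c v) = sc' c (g v)"
    and ker: "\<And>v. v \<in> G \<Longrightarrow> g v = 0 \<longleftrightarrow> v \<in> H"
    and part: "\<And>q. g ` (V q \<inter> G) = V' (q + e) \<inter> G2"
    and surj: "g ` G = G2"
    and act: "\<And>q x v. x \<in> Lh q \<Longrightarrow> v \<in> G \<Longrightarrow> g (r x v) = sc' (psign (e * q)) (r' x (g v))"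
    and Lh: "\<And>q. Lh q \<subseteq> L"
  shows "isomorphic Lh (quotient_by M H) (supermodule_on sc' V' r' G2)"
proof -
  have g_eq: "g v = g w \<longleftrightarrow> coset v = coset w" if "v \<in> G" "w \<in> G" for v w
  proof -
    have "g v = g (v - w) + g w"
      using add[of "v - w" w] that subspace_diff[OF G] by simp
    then show ?thesis
      using ker[of "v - w"] that subspace_diff[OF G, of v w] by (simp add: coset_eq_iff)
  qed
  define f where "f Y = g (SOME v. v \<in> G \<and> coset v = Y)" for Y
  have f: "f (coset v) = g v" if "v \<in> G" for v
  proof -
    have "(SOME w. w \<in> G \<and> coset w = coset v) \<in> G \<and> coset (SOME w. w \<in> G \<and> coset w = coset v) = coset v"
      by (rule someI[where x = v]) (use that in simp)
    then show ?thesis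
      unfolding f_def using g_eq that by blast
  qed
  show ?thesis
    unfolding isomorphic_def
  proof (intro exI[of _ f] exI[of _ e] conjI allI ballI)
    show "bij_betw f (carrier (quotient_by M H)) (carrier (supermodule_on sc' V' r' G2))"
      unfolding bij_betw_def quotient_carrier
      using surj by (auto simp: inj_on_def f g_eq image_image cong: image_cong)
    show "f (v \<oplus>\<^bsub>quotient_by M H\<^esub> w) = f v \<oplus>\<^bsub>supermodule_on sc' V' r' G2\<^esub> f w"
      if "v \<in> carrier (quotient_by M H)" "w \<in> carrier (quotient_by M H)" for v w
      using that subspace_add[OF G] by (auto simp: quotient_carrier quotient_add f add)
    show "f (c \<odot>\<^bsub>quotient_by M H\<^esub> v) = c \<odot>\<^bsub>supermodule_on sc' V' r' G2\<^esub> f v"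
      if "v \<in> carrier (quotient_by M H)" for c v
      using that subspace_scale[OF G] by (auto simp: quotient_carrier quotient_scale f scale)
    have "f ` part (quotient_by M H) q = g ` (V q \<inter> G)" for q
      unfolding quotient_part image_image by (rule image_cong) (simp_all add: f)
    then show "f ` part (quotient_by M H) q = part (supermodule_on sc' V' r' G2) (q + e)" for q
      by (simp add: part)
    show "f (act (quotient_by M H) x v) =
        psign (e * q) \<odot>\<^bsub>supermodule_on sc' V' r' G2\<^esub> act (supermodule_on sc' V' r' G2) x (f v)"
      if "x \<in> Lh q" "v \<in> carrier (quotient_by M H)" for q x v
    proof -
      have "x \<in> L" using that Lh by auto
      then show ?thesis
        using that rG act by (auto simp: quotient_carrier quotient_act f)
    qed
  qed
qed

end

section \<open>Graded spaces and the parity involution\<close>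

locale graded_space = complex_space sc
  for sc :: "complex \<Rightarrow> 'p::ab_group_add \<Rightarrow> 'p" +
  fixes V :: "bit \<Rightarrow> 'p set"
  assumes V_subspace: "subspace (V e)" and V_Int: "V 0 \<inter> V 1 = {0}"
    and V_sum: "\<exists>a\<in>V 0. \<exists>b\<in>V 1. p = a + b"
begin

lemma V_decompose: obtains a b where "a \<in> V 0" "b \<in> V 1" "p = a + b"
  using V_sum by blast

lemma V_unique:
  assumes "a \<in> V 0" "b \<in> V 1" "a' \<in> V 0" "b' \<in> V 1" "a + b = a' + b'"
  shows "a = a'" "b = b'"
proof -
  have "a - a' = b' - b"
    using assms(5) by (simp add: algebra_simps)
  moreover have "a - a' \<in> V 0" "b' - b \<in> V 1"
    using assms V_subspace by (auto intro: subspace_diff)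
  ultimately have "a - a' \<in> V 0 \<inter> V 1"
    by simp
  then show "a = a'" "b = b'"
    using V_Int assms(5) by auto
qed

lemma twist_eq: "a \<in> V 0 \<Longrightarrow> b \<in> V 1 \<Longrightarrow> twist sc V e (a + b) = a + sc (psign e) b"
  unfolding twist_def by (rule the_equality) (use V_unique in \<open>blast+\<close>)

lemma twist_zero [simp]: "twist sc V 0 p = p"
  using V_decompose[of p] twist_eq[of _ _ 0] by (metis psign_simps(1) scale_one)

abbreviation tau :: "'p \<Rightarrow> 'p" where
  "tau \<equiv> twist sc V 1"

lemma tau_eq: "a \<in> V 0 \<Longrightarrow> b \<in> V 1 \<Longrightarrow> tau (a + b) = a - b"
  by (simp add: twist_eq)

lemma twist_V: "p \<in> V q \<Longrightarrow> twist sc V e p = sc (psign (e * q)) p"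
  using twist_eq[of p 0 e] twist_eq[of 0 p e] subspace_0[OF V_subspace] by (cases q) auto

lemma twist_add: "twist sc V e (p + q) = twist sc V e p + twist sc V e q"
proof -
  obtain a b where p: "a \<in> V 0" "b \<in> V 1" "p = a + b" by (rule V_decompose)
  obtain c d where q: "c \<in> V 0" "d \<in> V 1" "q = c + d" by (rule V_decompose)
  have "twist sc V e ((a + c) + (b + d)) = (a + c) + sc (psign e) (b + d)"
    using p q V_subspace by (intro twist_eq subspace_add)
  then show ?thesis
    using p q by (simp add: twist_eq algebra_simps scale_right_distrib)
qed

lemma twist_scale: "twist sc V e (sc c p) = sc c (twist sc V e p)"
proof -
  obtain a b where p: "a \<in> V 0" "b \<in> V 1" "p = a + b" by (rule V_decompose)
  have "twist sc V e (sc c a + sc c b) = sc c a + sc (psign e) (sc c b)"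
    using p V_subspace by (intro twist_eq subspace_scale)
  then show ?thesis
    using p by (simp add: twist_eq scale_right_distrib mult.commute)
qed

lemma twist_lin: "twist sc V e 0 = 0" "twist sc V e (- p) = - twist sc V e p"
  "twist sc V e (p - q) = twist sc V e p - twist sc V e q" "twist sc V e (sum f A) = (\<Sum>x\<in>A. twist sc V e (f x))"
proof -
  interpret Modules.additive "twist sc V e" by unfold_locales (rule twist_add)
  show "twist sc V e 0 = 0" "twist sc V e (- p) = - twist sc V e p"
    "twist sc V e (p - q) = twist sc V e p - twist sc V e q" "twist sc V e (sum f A) = (\<Sum>x\<in>A. twist sc V e (f x))"
    by (fact zero minus diff sum)+
qed

lemma twist_twist: "twist sc V e (twist sc V q p) = twist sc V (e + q) p"
proof -
  obtain a b where p: "a \<in> V 0" "b \<in> V 1" "p = a + b" by (rule V_decompose)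
  have "twist sc V e (a + sc (psign q) b) = a + sc (psign e) (sc (psign q) b)"
    using p V_subspace by (intro twist_eq subspace_scale)
  then show ?thesis
    using p by (simp add: twist_eq psign_add)
qed

lemma twist_involution [simp]: "twist sc V e (twist sc V e p) = p"
  by (simp add: twist_twist)

lemma V_iff_tau: "p \<in> V q \<longleftrightarrow> tau p = sc (psign q) p"
proof
  assume eq: "tau p = sc (psign q) p"
  obtain a b where p: "a \<in> V 0" "b \<in> V 1" "p = a + b" by (rule V_decompose)
  have double: "x = 0" if "x + x = 0" for x :: 'p
  proof -
    have "sc 2 x = x + x" by (metis one_add_one scale_left_distrib scale_one)
    then show ?thesis using that by simp
  qed
  have ab: "a - b = sc (psign q) (a + b)"
    using eq p tau_eq[OF p(1,2)] by simp
  show "p \<in> V q"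
  proof (cases q)
    case zero
    then have "b + b = 0" using ab by (simp add: algebra_simps)
    then show ?thesis using double[of b] p zero by simp
  next
    case one
    then have "a + a = 0" using ab by (simp add: algebra_simps eq_neg_iff_add_eq_0)
    then show ?thesis using double[of a] p one by simp
  qed
qed (simp add: twist_V)

text \<open>The homogeneous components of v are (v + tau v) / 2 and (v - tau v) / 2. Being graded
  thus becomes a closure condition, which is easy to carry through constructions of
  subspaces.\<close>

lemma graded_iff_tau:
  assumes "subspace U"
  shows "(\<forall>v\<in>U. \<exists>a\<in>U \<inter> V 0. \<exists>b\<in>U \<inter> V 1. v = a + b) \<longleftrightarrow> (\<forall>v\<in>U. tau v \<in> U)"
proof
  assume *: "\<forall>v\<in>U. \<exists>a\<in>U \<inter> V 0. \<exists>b\<in>U \<inter> V 1. v = a + b"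
  show "\<forall>v\<in>U. tau v \<in> U"
    using * assms by (metis IntD1 IntD2 subspace_diff tau_eq)
next
  assume *: "\<forall>v\<in>U. tau v \<in> U"
  show "\<forall>v\<in>U. \<exists>a\<in>U \<inter> V 0. \<exists>b\<in>U \<inter> V 1. v = a + b"
  proof
    fix v assume v: "v \<in> U"
    obtain a b where ab: "a \<in> V 0" "b \<in> V 1" "v = a + b" by (rule V_decompose)
    have two: "sc (1/2) (x + x) = x" for x
    proof -
      have "x + x = sc 2 x" by (metis one_add_one scale_left_distrib scale_one)
      then show ?thesis by simp
    qed
    have "sc (1/2) (v + tau v) = a" "sc (1/2) (v - tau v) = b"
      using two by (simp_all add: ab tau_eq)
    moreover have "sc (1/2) (v + tau v) \<in> U" "sc (1/2) (v - tau v) \<in> U"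
      using v * assms by (auto intro!: subspace_scale subspace_add subspace_diff)
    ultimately show "\<exists>a\<in>U \<inter> V 0. \<exists>b\<in>U \<inter> V 1. v = a + b"
      using ab by blast
  qed
qed

end

section \<open>Modules over the Weyl superalgebra\<close>

declare partial.simps [simp del]

lemma partial_mon:
  obtains c k' J' where "partial j (mon k J) = pscale (*) c (mon k' J')"
proof (cases j)
  case None
  show ?thesis by (rule that[of "of_int k" "k - 1" J]) (simp add: None mon_def partial.simps)
next
  case (Some i)
  show ?thesis
    by (rule that[of "if i \<in> J then (- 1) ^ card {j \<in> J. j < i} else 0" k "J - {i}"]) (simp add: Some mon_def partial.simps)
qed

lemma ddt_comp_lmult: "ddt \<circ> lmult f = lmult (ddt f) + (lmult f \<circ> ddt)"
  by (simp add: fun_eq_iff ddt_lmult)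

lemma dxi_comp_lmult:
  fixes f :: "'n::{finite,linorder} laurent"
  shows "dxi i \<circ> lmult f = lmult (dxi i f) + (lmult (linvol f) \<circ> dxi i)"
  by (simp add: fun_eq_iff dxi_lmult)

lemma lmult_homogeneous:
  fixes f :: "'n::{finite,linorder} laurent"
  shows "f \<in> lpart e \<Longrightarrow> lmult f \<in> homogeneous K_alg e"
  by (auto simp: homogeneous_def lmult_K_alg lpart_lmult)

lemma partial_homogeneous: "partial (j :: 'n::{finite,linorder} option) \<in> homogeneous K_alg (par j)"
  by (auto simp: homogeneous_def lpart_partial K_alg.partial)

lemma homogeneous_S'_algI: "x \<in> S'_alg \<Longrightarrow> x \<in> homogeneous K_alg e \<Longrightarrow> x \<in> homogeneous S'_alg e"
  by (simp add: homogeneous_def)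

lemma comp_homogeneous:
  assumes "a \<in> homogeneous K_alg e" "b \<in> homogeneous K_alg q"
  shows "a \<circ> b \<in> homogeneous K_alg (e + q)"
proof -
  have "(a \<circ> b) ` lpart p \<subseteq> lpart (e + q + p)" for p
    using assms unfolding homogeneous_def by (fastforce simp: add.assoc)
  then show ?thesis
    using assms K_alg.comp by (auto simp: homogeneous_def)
qed

locale K_mod =
  fixes sc :: "complex \<Rightarrow> 'p::ab_group_add \<Rightarrow> 'p" and V :: "bit \<Rightarrow> 'p set"
    and r :: "'n::{finite,linorder} lop \<Rightarrow> 'p \<Rightarrow> 'p"
  assumes K_module: "K_module sc V r"
begin

sublocale graded_space sc V
  using K_module by (simp add: K_module_def graded_space_def graded_space_axioms_def complex_space_def)

lemma r_linear: "a \<in> K_alg \<Longrightarrow> Vector_Spaces.linear sc sc (r a)"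
  using K_module by (simp add: K_module_def)

lemma r_add: "a \<in> K_alg \<Longrightarrow> r a (p + q) = r a p + r a q"
  and r_scale: "a \<in> K_alg \<Longrightarrow> r a (sc c p) = sc c (r a p)"
  using r_linear[of a] by (simp_all add: Vector_Spaces.linear_iff)

lemma r_additive: "a \<in> K_alg \<Longrightarrow> Modules.additive (r a)"
  by unfold_locales (rule r_add)

lemmas r_zero = Modules.additive.zero[OF r_additive]
  and r_minus = Modules.additive.minus[OF r_additive]
  and r_diff = Modules.additive.diff[OF r_additive]
  and r_sum = Modules.additive.sum[OF r_additive]

lemma r_unit: "r (\<lambda>f. f) p = p"
  and r_op_add: "a \<in> K_alg \<Longrightarrow> b \<in> K_alg \<Longrightarrow> r (a + b) p = r a p + r b p"
  and r_op_scale: "a \<in> K_alg \<Longrightarrow> r (op_scale c a) p = sc c (r a p)"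
  and r_comp: "a \<in> K_alg \<Longrightarrow> b \<in> K_alg \<Longrightarrow> r (a \<circ> b) p = r a (r b p)"
  using K_module by (auto simp: K_module_def)

lemma r_V: "a \<in> homogeneous K_alg e \<Longrightarrow> p \<in> V q \<Longrightarrow> r a p \<in> V (e + q)"
  using K_module unfolding K_module_def by (meson image_subset_iff)

lemma r_op_zero: "r 0 p = 0"
  using r_op_scale[OF K_alg.unit, of 0 p] by simp

lemma r_op_sum: "(\<And>x. x \<in> A \<Longrightarrow> h x \<in> K_alg) \<Longrightarrow> r (sum h A) p = (\<Sum>x\<in>A. r (h x) p)"
  by (induction A rule: infinite_finite_induct) (simp_all add: r_op_zero r_op_add K_alg_sum)

abbreviation dd :: "'n option \<Rightarrow> 'p \<Rightarrow> 'p" where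
  "dd j \<equiv> r (partial j)"

abbreviation mult :: "'n laurent \<Rightarrow> 'p \<Rightarrow> 'p" where
  "mult f \<equiv> r (lmult f)"

abbreviation mm :: "int \<Rightarrow> 'n set \<Rightarrow> 'p \<Rightarrow> 'p" where
  "mm k I \<equiv> mult (mon k I)"

lemmas r_lin = r_add[OF K_alg.partial] r_add[OF lmult_K_alg] r_scale[OF K_alg.partial] r_scale[OF lmult_K_alg]
  r_zero[OF K_alg.partial] r_zero[OF lmult_K_alg] r_minus[OF K_alg.partial] r_minus[OF lmult_K_alg]
  r_diff[OF K_alg.partial] r_diff[OF lmult_K_alg] r_sum[OF K_alg.partial] r_sum[OF lmult_K_alg]

lemma mult_mult: "mult f (mult g p) = mult (lmult f g) p"
  using r_comp[OF lmult_K_alg lmult_K_alg, of f g p] by (simp add: lmult_comp)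

lemma mult_add: "mult (f + g) p = mult f p + mult g p"
proof -
  have "lmult (f + g) = lmult f + lmult g" by (simp add: fun_eq_iff lmult_add_left)
  then show ?thesis using r_op_add[OF lmult_K_alg lmult_K_alg] by simp
qed

lemma mult_scale: "mult (pscale (*) c f) p = sc c (mult f p)"
proof -
  have "lmult (pscale (*) c f) = op_scale c (lmult f)" by (simp add: fun_eq_iff op_scale_def lmult_scale_left)
  then show ?thesis using r_op_scale[OF lmult_K_alg] by simp
qed

lemma mult_zero [simp]: "mult 0 p = 0"
  using mult_scale[of 0 0 p] by simp

lemma mult_one [simp]: "mm 0 {} p = p"
proof -
  have "lmult (mon 0 {} :: 'n laurent) = (\<lambda>f. f)" by (simp add: fun_eq_iff)
  then show ?thesis using r_unit by simp
qed

lemma mm_mm: "mm k I (mm l J p) = sc (xi_sign I J) (mm (k + l) (I \<union> J) p)"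
proof -
  have "lmult (mon k I) (mon l J) = pscale (*) (xi_sign I J) (mon (k + l) (I \<union> J))"
    by (simp add: mon_def)
  then show ?thesis by (simp add: mult_mult mult_scale)
qed

lemma ddt_mult: "dd None (mult f p) = mult (ddt f) p + mult f (dd None p)"
  using r_comp[OF K_alg.partial[of None] lmult_K_alg[of f], of p]
    r_op_add[OF lmult_K_alg[of "ddt f"] K_alg.comp[OF lmult_K_alg[of f] K_alg.partial[of None]], of p]
    r_comp[OF lmult_K_alg[of f] K_alg.partial[of None], of p]
  by (simp add: ddt_comp_lmult partial.simps)

lemma dxi_mult: "dd (Some i) (mult f p) = mult (dxi i f) p + mult (linvol f) (dd (Some i) p)"
  using r_comp[OF K_alg.partial[of "Some i"] lmult_K_alg[of f], of p]
    r_op_add[OF lmult_K_alg[of "dxi i f"] K_alg.comp[OF lmult_K_alg[of "linvol f"] K_alg.partial[of "Some i"]], of p]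
    r_comp[OF lmult_K_alg[of "linvol f"] K_alg.partial[of "Some i"], of p]
  by (simp add: dxi_comp_lmult partial.simps)

lemma dd_mult:
  assumes "f \<in> lpart e"
  shows "dd j (mult f p) = mult (partial j f) p + sc (psign (par j * e)) (mult f (dd j p))"
  using ddt_mult[of f p] dxi_mult[of _ f p] by (cases j) (simp_all add: linvol_lpart[OF assms] mult_scale partial.simps)

lemma dd_dd: "dd i (dd j p) = sc (psign (par i * par j)) (dd j (dd i p))"
proof -
  have "partial i \<circ> partial j = op_scale (psign (par i * par j)) (partial j \<circ> partial i)"
    using partial_commute[of i j] by (simp add: fun_eq_iff op_scale_def)
  then show ?thesis
    using r_comp[OF K_alg.partial[of i] K_alg.partial[of j], of p] r_comp[OF K_alg.partial[of j] K_alg.partial[of i], of p]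
      r_op_scale[OF K_alg.comp[OF K_alg.partial[of j] K_alg.partial[of i]], of _ p] by simp
qed

lemma dd_dd_odd: "dd (Some i) (dd (Some j) p) = - dd (Some j) (dd (Some i) p)"
  using dd_dd[of "Some i" "Some j" p] by simp

lemma dd_square: "dd (Some i) (dd (Some i) p) = 0"
proof -
  have "sc 2 (dd (Some i) (dd (Some i) p)) = dd (Some i) (dd (Some i) p) + dd (Some i) (dd (Some i) p)"
    by (metis one_add_one scale_left_distrib scale_one)
  also have "\<dots> = 0"
    using dd_dd_odd[of i i p] by (metis ab_left_minus)
  finally show ?thesis by simp
qed

lemma twist_r:
  assumes "a \<in> homogeneous K_alg q"
  shows "twist sc V e (r a p) = sc (psign (e * q)) (r a (twist sc V e p))"
proof -
  have K: "a \<in> K_alg" using assms by (simp add: homogeneous_def)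
  obtain b c where p: "b \<in> V 0" "c \<in> V 1" "p = b + c" by (rule V_decompose)
  have "twist sc V e (r a b) = sc (psign (e * q)) (r a b)"
    "twist sc V e (r a c) = sc (psign (e * (q + 1))) (r a c)"
    using twist_V r_V[OF assms p(1)] r_V[OF assms p(2)] by simp_all
  then show ?thesis
    by (simp add: p(3) r_add[OF K] r_scale[OF K] twist_add twist_V[OF p(1)] twist_V[OF p(2)]
        distrib_left psign_add scale_right_distrib)
qed

lemma twist_dd: "twist sc V e (dd j p) = sc (psign (e * par j)) (dd j (twist sc V e p))"
  by (rule twist_r[OF partial_homogeneous])

lemma twist_mm: "twist sc V e (mm k J p) = sc (psign (e * of_nat (card J))) (mm k J (twist sc V e p))"
  by (rule twist_r[OF lmult_homogeneous[OF mon_lpart]]) simp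

subsection \<open>The submodule \<open>\<Delta>P\<close>\<close>

lemma DeltaI: "(\<Sum>j\<in>UNIV. dd j (p j)) \<in> Delta r"
  by (auto simp: Delta_def)

lemma DeltaE:
  assumes "v \<in> Delta r" obtains p where "v = (\<Sum>j\<in>UNIV. dd j (p j))"
  using assms by (auto simp: Delta_def)

lemma Delta_subspace: "subspace (Delta r)"
proof (rule subspaceI)
  show "0 \<in> Delta r"
    using DeltaI[of "\<lambda>_. 0"] by (simp add: r_lin)
  show "v + w \<in> Delta r" if "v \<in> Delta r" "w \<in> Delta r" for v w
  proof -
    obtain p where p: "v = (\<Sum>j\<in>UNIV. dd j (p j))"
      using \<open>v \<in> Delta r\<close> by (rule DeltaE)
    obtain q where q: "w = (\<Sum>j\<in>UNIV. dd j (q j))"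
      using \<open>w \<in> Delta r\<close> by (rule DeltaE)
    show ?thesis
      using DeltaI[of "\<lambda>j. p j + q j"] by (simp add: p q r_lin sum.distrib)
  qed
  show "sc c v \<in> Delta r" if "v \<in> Delta r" for c v
  proof -
    obtain p where p: "v = (\<Sum>j\<in>UNIV. dd j (p j))"
      using \<open>v \<in> Delta r\<close> by (rule DeltaE)
    show ?thesis
      using DeltaI[of "\<lambda>j. sc c (p j)"] by (simp add: p r_lin scale_sum_right)
  qed
qed

lemma dd_Delta: "dd j p \<in> Delta r"
proof -
  have "(\<Sum>i\<in>UNIV. dd i (if i = j then p else 0)) = (\<Sum>i\<in>UNIV. if i = j then dd j p else 0)"
    by (intro sum.cong) (auto simp: r_lin)
  also have "\<dots> = dd j p"
    by simp
  finally show ?thesis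
    using DeltaI[of "\<lambda>i. if i = j then p else 0"] by simp
qed

lemma Delta_subset: "subspace U \<Longrightarrow> (\<And>j p. dd j p \<in> U) \<Longrightarrow> Delta r \<subseteq> U"
  unfolding Delta_def by (auto intro!: subspace_sum)

text \<open>Integration by parts: for a divergence-free field the derivations can be moved to the
  left of the coefficients, so its values lie in \<Delta>P.\<close>

lemma r_S_alg:
  assumes "x \<in> S_alg"
  shows "r x p \<in> Delta r"
proof -
  obtain f where f: "x = superderivation f" "superdivergence f = 0"
    using assms by (auto simp: S_alg_def)
  have "lmult 0 = (0 :: 'n lop)" by (simp add: fun_eq_iff)
  then have x: "x = (ddt \<circ> lmult (f None)) + (\<Sum>i\<in>UNIV. dxi i \<circ> lmult (linvol (f (Some i))))"
    using superderivation_by_parts[of f] f by simp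
  have K: "ddt \<circ> lmult (f None) \<in> K_alg" "dxi i \<circ> lmult (linvol (f (Some i))) \<in> K_alg" for i
    using K_alg.comp[OF K_alg.partial[of None] lmult_K_alg] K_alg.comp[OF K_alg.partial[of "Some i"] lmult_K_alg]
    by (auto simp: partial.simps)
  have "r x p = dd None (mult (f None) p) + (\<Sum>i\<in>UNIV. dd (Some i) (mult (linvol (f (Some i))) p))"
    unfolding x using K r_comp[OF K_alg.partial[of None] lmult_K_alg] r_comp[OF K_alg.partial[of "Some _"] lmult_K_alg]
    by (simp add: r_op_add r_op_sum K_alg_sum partial.simps)
  then show ?thesis
    by (simp only:) (intro subspace_add subspace_sum Delta_subspace dd_Delta)
qed

text \<open>
  The set \<open>{q. \<forall>k J. \<partial>_i t^k \<xi>_J q \<in> U}\<close> is a submodule over the Weyl superalgebra, because the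
  \<open>\<partial>_j\<close> supercommute with \<open>\<partial>_i\<close> and preserve \<open>U\<close>.
\<close>

lemma absorbing_stable:
  assumes U: "subspace U" "\<And>j p. p \<in> U \<Longrightarrow> dd j p \<in> U"
    and "a \<in> K_alg" "\<And>k J. dd (Some i) (mm k J q) \<in> U"
  shows "dd (Some i) (mm k J (r a q)) \<in> U"
  using assms(3,4)
proof (induction arbitrary: q k J rule: K_alg.induct)
  case (t)
  then show ?case by (simp add: mm_mm r_lin U subspace_scale)
next
  case (t_inv)
  then show ?case by (simp add: mm_mm r_lin U subspace_scale)
next
  case (xi l)
  then show ?case by (simp add: mm_mm r_lin U subspace_scale)
next
  case (partial j)
  define s where "s = psign (par j * of_nat (card J))"
  obtain c k' J' where c: "partial j (mon k J) = pscale (*) c (mon k' J')"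
    by (rule partial_mon)
  have "dd j (mm k J q) = mult (partial j (mon k J)) q + sc s (mm k J (dd j q))"
    unfolding s_def by (rule dd_mult) (rule mon_lpart, simp)
  \<comment> \<open>The super Leibniz rule is solved for \<open>mm k J (dd j q)\<close>. One
    resulting term is a monomial times \<open>q\<close>, covered by the hypothesis on
    \<open>q\<close>; the other has an outer \<partial>_j, which supercommutes with \<partial>_i and
    preserves \<open>U\<close>.\<close>
  then have "sc s (mm k J (dd j q)) = dd j (mm k J q) - sc c (mm k' J' q)"
    by (simp add: c mult_scale)
  then have "sc s (sc s (mm k J (dd j q))) = sc s (dd j (mm k J q) - sc c (mm k' J' q))"
    by simp
  then have eq: "mm k J (dd j q) = sc s (dd j (mm k J q) - sc c (mm k' J' q))"
    by (simp add: s_def)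
  have "dd (Some i) (dd j (mm k J q)) \<in> U"
    unfolding dd_dd[of "Some i" j] using partial U by (intro subspace_scale) auto
  then show ?case
    unfolding eq using partial U by (auto simp: r_lin intro!: subspace_scale subspace_diff)
next
  case (add a b)
  then show ?case
    using r_op_add[of a b q] by (simp add: r_lin U subspace_add plus_fun_def)
next
  case (scale a c)
  then show ?case by (simp add: r_op_scale r_lin U subspace_scale)
next
  case (comp a b)
  then show ?case
    using r_comp[of a b q] by (simp add: comp_def)
qed (simp add: r_unit)

end

locale simple_K_mod = K_mod sc V r
  for sc :: "complex \<Rightarrow> 'p::ab_group_add \<Rightarrow> 'p" and V :: "bit \<Rightarrow> 'p set"
    and r :: "'n::{finite,linorder} lop \<Rightarrow> 'p \<Rightarrow> 'p" +
  assumes n: "CARD('n) \<ge> 2"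
    and simple: "simple_module K_alg (supermodule_on sc V r UNIV)"
begin

lemma K_stable_eq_UNIV:
  assumes U: "subspace U" and tau: "\<And>v. v \<in> U \<Longrightarrow> tau v \<in> U"
    and r: "\<And>a v. a \<in> K_alg \<Longrightarrow> v \<in> U \<Longrightarrow> r a v \<in> U" and "q \<in> U" "q \<noteq> 0"
  shows "p \<in> U"
proof -
  have "graded_submodule K_alg (supermodule_on sc V r UNIV) U"
    using assms graded_iff_tau[OF U] by (simp add: graded_submodule_iff)
  then have "U = {0} \<or> U = UNIV"
    using simple by (simp add: simple_module_iff)
  then show ?thesis
    using assms by auto
qed

lemma nonzero: obtains p :: 'p where "p \<noteq> 0"
proof -
  have "UNIV \<noteq> {0 :: 'p}"
    using simple by (simp add: simple_module_iff)
  then show ?thesis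
    using that by blast
qed

lemma dd_spread:
  assumes U: "subspace U" "\<And>j p. p \<in> U \<Longrightarrow> dd j p \<in> U" "\<And>p. p \<in> U \<Longrightarrow> tau p \<in> U"
    and q: "\<And>k J. dd (Some i) (mm k J q) \<in> U" "q \<noteq> 0"
  shows "dd (Some i) p \<in> U"
proof -
  define Q where "Q = {q. \<forall>k J. dd (Some i) (mm k J q) \<in> U}"
  have "p \<in> Q"
  proof (rule K_stable_eq_UNIV)
    show "subspace Q"
      by (rule subspaceI) (auto simp: Q_def r_lin U subspace_0 subspace_add subspace_scale)
    \<comment> \<open>Simplicity of P speaks of graded submodules, so \<open>Q\<close> must be
      closed under \<open>tau\<close>.\<close>
    show "tau v \<in> Q" if "v \<in> Q" for v
      unfolding Q_def
    proof (intro CollectI allI)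
      fix k J
      have "tau (dd (Some i) (mm k J v)) \<in> U"
        using that U by (auto simp: Q_def)
      then have "sc (- psign (of_nat (card J))) (dd (Some i) (mm k J (tau v))) \<in> U"
        by (simp add: twist_dd twist_mm r_lin)
      then have "sc (- psign (of_nat (card J))) (sc (- psign (of_nat (card J))) (dd (Some i) (mm k J (tau v)))) \<in> U"
        by (rule subspace_scale[OF U(1)])
      then show "dd (Some i) (mm k J (tau v)) \<in> U"
        by (simp del: scale_minus_left)
    qed
    show "r a v \<in> Q" if "a \<in> K_alg" "v \<in> Q" for a v
      using absorbing_stable[OF U(1,2) that(1)] that(2) by (simp add: Q_def)
    show "q \<in> Q" "q \<noteq> 0"
      using q by (simp_all add: Q_def)
  qed
  then have "dd (Some i) (mm 0 {} p) \<in> U"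
    unfolding Q_def by blast
  then show ?thesis by simp
qed

text \<open>If \<partial>_i kills q, then \<partial>_i (t^k \<xi>_J q) is the derivative of the
  monomial times q, and that derivative is free of \<xi>_i. So it suffices to test monomials without
  \<xi>_i, for which fields in the derived algebra exist.\<close>

lemma dd_mm_kernel:
  assumes U: "subspace U" and "dd (Some i) q = 0" "\<And>k J. i \<notin> J \<Longrightarrow> mm k J q \<in> U"
  shows "dd (Some i) (mm k J q) \<in> U"
proof -
  have "dd (Some i) (mm k J q) = mult (dxi i (mon k J)) q"
    using dxi_mult[of i "mon k J" q] assms(2) by (simp add: r_lin)
  also have "\<dots> \<in> U"
  proof (cases "i \<in> J")
    case True
    then have "dxi i (mon k J) = pscale (*) ((- 1) ^ card {j \<in> J. j < i}) (mon k (J - {i}))"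
      by (simp add: mon_def)
    then show ?thesis
      using assms by (simp add: mult_scale subspace_scale)
  qed (simp add: mon_def U subspace_0)
  finally show ?thesis .
qed

lemma mult_minus: "mult (- f) p = - mult f p"
  using mult_scale[of "-1" f p] by simp

lemma dd_mm_self: "dd (Some i) (mm 0 {i} q) = q - mm 0 {i} (dd (Some i) q)"
  using dxi_mult[of i "mon 0 {i}" q] by (simp add: linvol_mon mult_minus)

text \<open>By \<partial>_i \<xi>_i + \<xi>_i \<partial>_i = 1, a module on which \<partial>_i
  vanishes is zero.\<close>

lemma dd_nonzero: obtains p where "dd (Some i) p \<noteq> (0 :: 'p)"
proof -
  obtain q :: 'p where q: "q \<noteq> 0" by (rule nonzero)
  have "q = dd (Some i) (mm 0 {i} q) + mm 0 {i} (dd (Some i) q)"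
    by (simp add: dd_mm_self)
  then show ?thesis
    using that q by (metis add.right_neutral r_zero[OF lmult_K_alg])
qed

text \<open>Take q with \<partial>_j q \<noteq> 0. Either \<partial>_j \<partial>_i q is nonzero, or
  \<partial>_j \<partial>_i (\<xi>_i q) = \<partial>_j q.\<close>

lemma dd_dd_nonzero:
  fixes i j :: 'n
  assumes "i \<noteq> j" obtains p where "dd (Some j) (dd (Some i) p) \<noteq> 0"
proof -
  obtain q :: 'p where q: "dd (Some j) q \<noteq> 0" by (rule dd_nonzero)
  have *: "dd (Some j) (dd (Some i) (mm 0 {i} q)) =
      dd (Some j) q + mm 0 {i} (dd (Some j) (dd (Some i) q))"
  proof -
    have "dxi j (mon 0 {i}) = 0"
      using assms by (simp add: mon_def)
    then show ?thesis
      using dxi_mult[of j "mon 0 {i}"] by (simp add: dd_mm_self r_lin linvol_mon mult_minus)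
  qed
  show ?thesis
  proof (cases "dd (Some j) (dd (Some i) q) = 0")
    case True
    then show ?thesis
      using that[of "mm 0 {i} q"] q * by (simp add: r_lin)
  qed (rule that)
qed

text \<open>Serves both the top quotient and \<Delta>A modulo constants. Stability is stated for
  homogeneous fields because \<open>dv\<close>, which supplies \<open>U\<close> in the first case,
  intertwines the actions only up to the sign of a homogeneous field.\<close>

lemma Delta_minimal:
  assumes U: "subspace U" "\<And>p. p \<in> U \<Longrightarrow> tau p \<in> U"
      "\<And>q x p. x \<in> homogeneous S'_alg q \<Longrightarrow> p \<in> U \<Longrightarrow> r x p \<in> U"
    and p: "p \<in> U" "dd j p \<noteq> 0"
  shows "Delta r \<subseteq> U"
proof -
  have Udd: "dd j p \<in> U" if "p \<in> U" for j p
    using U(3)[OF homogeneous_S'_algI[OF S'_alg_partial[OF n] partial_homogeneous] that] .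
  have field: "mm k J (dd (Some i) p) \<in> U" if "p \<in> U" "i \<notin> J" for i k J p
    using U(3)[OF homogeneous_S'_algI[OF S'_alg_lmult_dxi[OF n that(2), of k]
        comp_homogeneous[OF lmult_homogeneous[OF mon_lpart[OF refl]] partial_homogeneous[of "Some i", unfolded partial.simps]]] that(1)]
      r_comp[OF lmult_K_alg[of "mon k J"] K_alg.partial[of "Some i"], of p] by (simp add: partial.simps)
  have xi_ddt: "mm 0 {i} (dd None p) \<in> U" if "p \<in> U" for i p
    using U(3)[OF homogeneous_S'_algI[OF S'_alg_xi_ddt[OF n, of i]
        comp_homogeneous[OF lmult_homogeneous[OF mon_lpart[OF refl]] partial_homogeneous[of None, unfolded partial.simps]]] that]
      r_comp[OF lmult_K_alg[of "mon 0 {i}"] K_alg.partial[of None], of p] by (simp add: partial.simps)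
  have spread: "dd (Some i) q \<in> U" if "p \<in> U" "dd (Some i) p \<noteq> 0" for i p q
  proof (rule dd_spread[OF U(1) Udd U(2) dd_mm_kernel[OF U(1)]])
    show "mm k J (dd (Some i) p) \<in> U" if "i \<notin> J" for k J
      using field[OF \<open>p \<in> U\<close> that] .
  qed (use that dd_square in auto)
  \<comment> \<open>If every odd derivation killed \<open>U\<close>, then \<partial>_i (\<xi>_i d/dt
    p) would be zero; but it would also equal d/dt p, the only derivative of \<open>p\<close> that
    could then be nonzero.\<close>
  have "\<exists>i p. p \<in> U \<and> dd (Some i) p \<noteq> 0"
  proof (rule ccontr)
    assume *: "\<not> (\<exists>i p. p \<in> U \<and> dd (Some i) p \<noteq> 0)"
    then have "j = None"
      using p by (cases j) auto
    define i :: 'n where "i = undefined"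
    have "dd (Some i) (dd None p) = 0"
      using * Udd[OF p(1)] by blast
    then have "dd (Some i) (mm 0 {i} (dd None p)) = dd None p"
      by (simp add: dd_mm_self r_lin)
    moreover have "dd (Some i) (mm 0 {i} (dd None p)) = 0"
      using * xi_ddt[OF p(1)] by blast
    ultimately show False
      using p \<open>j = None\<close> by simp
  qed
  then obtain i where i: "dd (Some i) q \<in> U" for q
    using spread by blast
  \<comment> \<open>\<open>U\<close> contains \<partial>_i P, and on that space \<partial>_l does
    not vanish, so the spreading starts again with \<open>l\<close>.\<close>
  have all: "dd (Some l) q \<in> U" for l q
  proof (cases "l = i")
    case False
    then obtain p where "dd (Some l) (dd (Some i) p) \<noteq> 0"
      using dd_dd_nonzero by metis
    then show ?thesis
      using spread i by blast
  qed (simp add: i)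
  \<comment> \<open>Apply \<partial>_i \<xi>_i + \<xi>_i \<partial>_i = 1 to d/dt q: the first term
    lies in \<partial>_i P, the second is the field \<xi>_i d/dt applied to \<partial>_i q.\<close>
  have "dd None q \<in> U" for q
  proof -
    have "mm 0 {i} (dd None (dd (Some i) q)) \<in> U"
      using xi_ddt i by blast
    then have "dd (Some i) (mm 0 {i} (dd None q)) + mm 0 {i} (dd None (dd (Some i) q)) \<in> U"
      by (intro subspace_add U(1) i)
    moreover have "dd None q = dd (Some i) (mm 0 {i} (dd None q)) + mm 0 {i} (dd None (dd (Some i) q))"
      using dd_dd[of "Some i" None q] by (simp add: dd_mm_self)
    ultimately show ?thesis
      by simp
  qed
  then have "dd j q \<in> U" for j q
    using all by (cases j) simp_all
  then show ?thesis
    by (rule Delta_subset[OF U(1)])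
qed

subsection \<open>Invariants and the natural module\<close>

lemma r_mult:
  assumes "a \<in> K_alg" "\<And>j. dd j p = 0"
  shows "r a (mult f p) = mult (a f) p"
  using assms(1)
proof (induction arbitrary: f rule: K_alg.induct)
  case (partial j)
  show ?case
  proof (cases j)
    case None
    then show ?thesis
      using ddt_mult[of f p] assms(2)[of None] r_zero[OF lmult_K_alg, of f] by (simp add: partial.simps(1))
  next
    case (Some i)
    then show ?thesis
      using dxi_mult[of i f p] assms(2)[of "Some i"] r_zero[OF lmult_K_alg, of "linvol f"] by (simp add: partial.simps(2))
  qed
next
  case (add a b)
  then show ?case
    using r_op_add[of a b "mult f p"] by (simp add: mult_add plus_fun_def)
next
  case (scale a c)
  then show ?case
    using r_op_scale[of a c "mult f p"] by (simp add: mult_scale op_scale_def)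
next
  case (comp a b)
  then show ?case
    using r_comp[of a b "mult f p"] by (simp add: comp_def)
qed (simp_all add: mult_mult r_unit)

lemma mult_diff: "mult (f - g) p = mult f p - mult g p"
  using mult_add[of f "- g" p] mult_scale[of "-1" g p] by simp

lemma invariant_isomorphic:
  assumes inv: "\<And>j. dd j p = 0" and "p \<noteq> 0"
  shows "isomorphic (homogeneous K_alg) (supermodule_on sc V r UNIV) A_mod"
proof -
  \<comment> \<open>The derivations are homogeneous, so both components of an invariant are
    invariant, and one of them is nonzero.\<close>
  obtain e p where p: "p \<in> V e" "p \<noteq> 0" "\<And>j. dd j p = 0"
  proof -
    obtain a b where ab: "a \<in> V 0" "b \<in> V 1" "p = a + b" by (rule V_decompose)
    have *: "dd j a = 0 \<and> dd j b = 0" for j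
    proof -
      have "dd j a + dd j b = 0"
        using inv[of j] by (simp add: ab r_lin)
      moreover have "dd j a \<in> V (par j + 0)" "dd j b \<in> V (par j + 1)"
        using r_V[OF partial_homogeneous] ab by blast+
      ultimately show ?thesis
        using V_unique[of "dd j a" "dd j b" 0 0] V_unique[of "dd j b" "dd j a" 0 0] subspace_0[OF V_subspace]
        by (cases "par j") (auto simp: add.commute)
    qed
    show ?thesis
    proof (cases "a = 0")
      case True
      with ab assms(2) have "b \<noteq> 0" by simp
      then show ?thesis using that[of b 1] ab * by simp
    next
      case False
      then show ?thesis using that[of a 0] ab * by simp
    qed
  qed
  define g where "g f = mult f p" for f
  have g: "g (f + h) = g f + g h" "g (pscale (*) c f) = sc c (g f)" "g (f - h) = g f - g h" for f h c
    by (simp_all add: g_def mult_add mult_scale mult_diff)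
  have g_r: "g (a f) = r a (g f)" if "a \<in> K_alg" for a f
    using r_mult[OF that p(3)] by (simp add: g_def)
  have "{f. g f = 0} = {0}"
  proof (rule ccontr)
    assume *: "{f. g f = 0} \<noteq> {0}"
    have "mon 0 {} \<in> {f. g f = 0}"
    proof (rule K_stable_contains_one[OF _ _ *])
      show "laurent.subspace {f. g f = 0}"
        by (rule laurent.subspaceI) (simp_all add: g, simp add: g_def)
      show "a f \<in> {f. g f = 0}" if "a \<in> K_alg" "f \<in> {f. g f = 0}" for a f
        using that g_r r_zero by simp
    qed
    then show False
      using p by (simp add: g_def)
  qed
  then have ker: "f = 0" if "g f = 0" for f
    using that by auto
  have inj: "f = h" if "g f = g h" for f h
    using ker[of "f - h"] that by (simp add: g)
  have g_V: "g f \<in> V (q + e)" if "f \<in> lpart q" for f q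
    unfolding g_def using r_V[OF lmult_homogeneous[OF that] p(1)] .
  have surj: "v \<in> range g" for v
  proof (rule K_stable_eq_UNIV[where q = p])
    show "subspace (range g)"
    proof (rule subspaceI)
      show "0 \<in> range g" using g(2)[of 0 0] by (metis rangeI scale_zero_left)
      show "v + w \<in> range g" if "v \<in> range g" "w \<in> range g" for v w
        using that by (auto simp: g(1)[symmetric])
      show "sc c v \<in> range g" if "v \<in> range g" for c v
        using that by (auto simp: g(2)[symmetric])
    qed
    show "tau v \<in> range g" if "v \<in> range g" for v
    proof -
      obtain f where f: "v = g f" using \<open>v \<in> range g\<close> by auto
      obtain a b where ab: "a \<in> lpart 0" "b \<in> lpart 1" "f = a + b"
        using lpart_decompose by blast
      have "tau (g a) = sc (psign e) (g a)" "tau (g b) = sc (psign (1 + e)) (g b)"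
        using twist_V[OF g_V[OF ab(1)], of 1] twist_V[OF g_V[OF ab(2)], of 1] by simp_all
      then have "tau v = g (pscale (*) (psign e) a + pscale (*) (psign (1 + e)) b)"
        by (simp add: f ab g twist_add)
      then show ?thesis by auto
    qed
    show "r a v \<in> range g" if "a \<in> K_alg" "v \<in> range g" for a v
      using that by (auto simp: g_r[symmetric])
    show "p \<in> range g"
      using rangeI[of g "mon 0 {}"] by (simp add: g_def)
  qed (rule p)
  \<comment> \<open>\<open>g\<close> commutes with the action without signs. For odd
    \<open>p\<close> the parity involution supplies the sign (-1)^(e|x|) that
    \<open>isomorphic\<close> demands of an odd map.\<close>
  define f where "f v = the_inv g (twist sc V e v)" for v
  have bij: "bij g"
    using inj surj by (auto simp: bij_def inj_on_def)
  have f_iff: "f v = h \<longleftrightarrow> twist sc V e v = g h" for v h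
    unfolding f_def using bij by (metis bij_is_inj the_inv_f_f f_the_inv_into_f_bij_betw bij_betw_def UNIV_I surj)
  have gf: "g (f v) = twist sc V e v" for v
    using f_iff by metis
  have part: "f ` V q = lpart (q + e)" for q
  proof (intro subset_antisym subsetI)
    fix h :: "'n laurent" assume "h \<in> f ` V q"
    then obtain v where v: "v \<in> V q" "h = f v" by auto
    have "g h \<in> V q"
      using v by (simp add: gf twist_V V_subspace subspace_scale)
    obtain h0 h1 where h: "h0 \<in> lpart (q + e)" "h1 \<in> lpart (q + e + 1)" "h = h0 + h1"
      using lpart_decompose[of h] by (cases "q + e") (auto simp: add.commute)
    have "g h1 = g h - g h0"
      by (simp add: h g)
    moreover have "g h0 \<in> V q" "g h1 \<in> V (q + 1)"
      using g_V[OF h(1)] g_V[OF h(2)] by (simp_all add: ac_simps)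
    ultimately have "g h1 \<in> V q \<inter> V (q + 1)"
      using \<open>g h \<in> V q\<close> by (simp add: V_subspace subspace_diff)
    then have "g h1 = 0"
      using V_Int by (cases q) auto
    then have "h1 = 0" by (rule ker)
    then show "h \<in> lpart (q + e)"
      using h by simp
  next
    fix h :: "'n laurent" assume h: "h \<in> lpart (q + e)"
    then have "g h \<in> V q"
      using g_V[OF h] by (simp add: add.assoc)
    then have "twist sc V e (g h) \<in> V q"
      by (simp add: twist_V V_subspace subspace_scale)
    moreover have "f (twist sc V e (g h)) = h"
      by (simp add: f_iff)
    ultimately show "h \<in> f ` V q" by force
  qed
  show ?thesis
    unfolding isomorphic_def A_mod_def
  proof (intro exI[of _ f] exI[of _ e] conjI allI ballI)
    show "bij_betw f (carrier (supermodule_on sc V r UNIV)) (carrier (supermodule_on (pscale (*)) lpart (\<lambda>x. x) UNIV))"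
      by (simp add: bij_def inj_on_def surj_def) (metis gf f_iff twist_involution)
    show "f ` part (supermodule_on sc V r UNIV) q = part (supermodule_on (pscale (*)) lpart (\<lambda>x. x) UNIV) (q + e)" for q
      by (simp add: part)
    fix v w c q x
    show "f (v \<oplus>\<^bsub>supermodule_on sc V r UNIV\<^esub> w) = f v \<oplus>\<^bsub>supermodule_on (pscale (*)) lpart (\<lambda>x. x) UNIV\<^esub> f w"
      by (simp add: f_iff g gf twist_add)
    show "f (c \<odot>\<^bsub>supermodule_on sc V r UNIV\<^esub> v) = c \<odot>\<^bsub>supermodule_on (pscale (*)) lpart (\<lambda>x. x) UNIV\<^esub> f v"
      by (simp add: f_iff g gf twist_scale)
    show "f (act (supermodule_on sc V r UNIV) x v) =
       psign (e * q) \<odot>\<^bsub>supermodule_on (pscale (*)) lpart (\<lambda>x. x) UNIV\<^esub>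
         act (supermodule_on (pscale (*)) lpart (\<lambda>x. x) UNIV) x (f v)"
      if x: "x \<in> homogeneous K_alg q"
    proof -
      have "x \<in> K_alg" using x by (simp add: homogeneous_def)
      then show ?thesis
        by (simp add: f_iff g g_r gf twist_r[OF x])
    qed
  qed
qed

end

section \<open>Operators on \<open>A^+\<close>\<close>

lemma tmult_add: "tmult i (v + w) = tmult i v + tmult i w"
proof -
  have "tmult i v = (\<Sum>m\<in>supp v. if fst m i + 1 < 0
     then single ((fst m)(i := fst m i + 1), snd m) (coef v m) else 0)" for v :: "'a aplus"
    by (auto simp: tmult_def intro!: sum.cong)
  then show ?thesis
    by (simp only:, intro sum_supp_add) (simp add: single_add[symmetric])
qed

lemma tder_add: "tder i (v + w) = tder i v + tder i w"
proof -
  have "tder i v = (\<Sum>m\<in>supp v. single ((fst m)(i := fst m i - 1), snd m) (of_int (fst m i) * coef v m))"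
    for v :: "'a aplus"
    by (auto simp: tder_def intro!: sum.cong)
  then show ?thesis
    by (simp only:, intro sum_supp_add) (simp add: single_add[symmetric] algebra_simps)
qed

lemma xmult_add: "xmult (v + w) = xmult v + xmult w"
proof -
  have "xmult v = (\<Sum>m\<in>supp v. if snd m = 0 then single (fst m, 1) (coef v m) else 0)" for v :: "'a aplus"
    by (auto simp: xmult_def intro!: sum.cong)
  then show ?thesis
    by (simp only:, intro sum_supp_add) (simp add: single_add[symmetric])
qed

lemma xder_add: "xder (v + w) = xder v + xder w"
proof -
  have "xder v = (\<Sum>m\<in>supp v. if snd m = 1 then single (fst m, 0) (coef v m) else 0)" for v :: "'a aplus"
    by (auto simp: xder_def intro!: sum.cong)
  then show ?thesis
    by (simp only:, intro sum_supp_add) (simp add: single_add[symmetric])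
qed

lemma aplus_single [simp]:
  "tmult i (single (\<alpha>, e) c) = (if \<alpha> i + 1 < 0 then single (\<alpha>(i := \<alpha> i + 1), e) c else 0)"
  "tder i (single (\<alpha>, e) c) = single (\<alpha>(i := \<alpha> i - 1), e) (of_int (\<alpha> i) * c)"
  "xmult (single (\<alpha>, e) c) = (if e = 0 then single (\<alpha>, 1) c else 0)"
  "xder (single (\<alpha>, e) c) = (if e = 1 then single (\<alpha>, 0) c else 0)"
  by (simp_all add: tmult_def tder_def xmult_def xder_def)

lemma aplus_zero [simp]: "tmult i 0 = 0" "tder i 0 = 0" "xmult 0 = 0" "xder 0 = 0"
  by (simp_all add: tmult_def tder_def xmult_def xder_def)

text \<open>The eigenvalue on a monomial of the Euler operator whose eigenspaces are the modules
  \<open>N_mod\<close>.\<close>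

definition mdeg :: "('n::finite) amon \<Rightarrow> int" where
  "mdeg m = sum (fst m) UNIV + of_bool (snd m = 1)"

definition negative :: "'n amon \<Rightarrow> bool" where
  "negative m \<longleftrightarrow> (\<forall>i. fst m i < 0)"

lemma sum_fun_upd:
  fixes \<alpha> :: "'n::finite \<Rightarrow> int"
  shows "sum (\<alpha>(i := x)) UNIV = sum \<alpha> UNIV - \<alpha> i + x"
proof -
  have "sum (\<alpha>(i := x)) UNIV = (\<alpha>(i := x)) i + sum (\<alpha>(i := x)) (UNIV - {i})"
    by (rule sum.remove) auto
  moreover have "sum (\<alpha>(i := x)) (UNIV - {i}) = sum \<alpha> (UNIV - {i})"
    by (rule sum.cong) auto
  moreover have "sum \<alpha> UNIV = \<alpha> i + sum \<alpha> (UNIV - {i})"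
    by (rule sum.remove) auto
  ultimately show ?thesis by (simp only: fun_upd_same)
qed

lemma mdeg_simps [simp]:
  "mdeg (\<alpha>(i := x), e) = mdeg (\<alpha>, e) - \<alpha> i + x"
  "mdeg (\<alpha>, 1) = mdeg (\<alpha>, 0) + 1"
  by (simp_all add: mdeg_def sum_fun_upd del: fun_upd_apply)

lemma N_mod_iff: "v \<in> N_mod \<mu> \<longleftrightarrow> (\<forall>m\<in>supp v. negative m \<and> mdeg m = (\<Sum>s\<in>UNIV. \<mu> s))"
proof (cases "v \<in> A_plus")
  case True
  let ?E = "\<lambda>v. xmult (xder v) + (\<Sum>s\<in>UNIV. tmult s (tder s v))"
  have "coef (?E v) m = of_int (mdeg m) * coef v m" for m
  proof (rule additive_ext[where F = "\<lambda>v. coef (?E v) m" and G = "\<lambda>v. of_int (mdeg m) * coef v m"])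
    fix k c assume k: "k \<in> supp v"
    obtain \<alpha> e where [simp]: "k = (\<alpha>, e)" by (metis surj_pair)
    have neg: "\<alpha> i < 0" for i
      using True k by (auto simp: A_plus_def)
    \<comment> \<open>The exponent is lowered before it is raised, hence ends at its old negative
      value, and the truncation in \<open>tmult\<close> does not interfere.\<close>
    have "?E (single k c) = single (\<alpha>, e) (of_bool (e = 1) * c) + (\<Sum>s\<in>UNIV. single (\<alpha>, e) (of_int (\<alpha> s) * c))"
      using neg by (cases e) (simp_all add: fun_upd_idem)
    also have "\<dots> = single (\<alpha>, e) (of_int (mdeg k) * c)"
    proof -
      have "(\<Sum>s\<in>A. single (\<alpha>, e) (of_int (\<alpha> s) * c)) = single (\<alpha>, e) (of_int (sum \<alpha> A) * c)" for A
        by (induction A rule: infinite_finite_induct) (simp_all add: single_add[symmetric] algebra_simps)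
      then show ?thesis
        by (simp add: mdeg_def single_add[symmetric] algebra_simps)
    qed
    finally show "coef (?E (single k c)) m = of_int (mdeg m) * coef (single k c) m"
      by (simp add: lookup_single when_def)
  qed (simp_all add: xmult_add xder_add tmult_add tder_add lookup_add sum.distrib algebra_simps)
  then have "?E v = pscale (*) (of_int (\<Sum>s\<in>UNIV. \<mu> s)) v \<longleftrightarrow>
      (\<forall>m. of_int (mdeg m) * coef v m = of_int (\<Sum>s\<in>UNIV. \<mu> s) * coef v m)"
    by (simp add: poly_mapping_eq_iff fun_eq_iff)
  also have "\<dots> \<longleftrightarrow> (\<forall>m\<in>supp v. mdeg m = (\<Sum>s\<in>UNIV. \<mu> s))"
    by (auto simp: in_keys_iff simp del: of_int_sum)
  finally show ?thesis
    using True by (auto simp: N_mod_def A_plus_def negative_def split_paired_all)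
next
  case False
  then show ?thesis
    by (auto simp: N_mod_def A_plus_def negative_def split_paired_all)
qed

section \<open>The tensor product as a graded space\<close>

context complex_space
begin

lemma pscale_coef [simp]: "coef (pscale sc c u) m = sc c (coef u m)"
  by (simp add: pscale_def coef_map)

lemma pscale_single [simp]: "pscale sc c (single m p) = single m (sc c p)"
  by (simp add: pscale_def map_single)

lemma vector_space_pscale: "vector_space (pscale sc :: complex \<Rightarrow> ('k \<Rightarrow>\<^sub>0 'v) \<Rightarrow> _)"
  by unfold_locales (auto intro!: poly_mapping_eqI simp: lookup_add scale_right_distrib scale_left_distrib)

interpretation F: complex_space "pscale sc :: complex \<Rightarrow> ('k amon \<Rightarrow>\<^sub>0 'v) \<Rightarrow> _"
  by (simp add: complex_space_def vector_space_pscale)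

lemma tensor_coef: "coef (tensor sc p v) m = sc (coef v m) p"
  by (simp add: tensor_def coef_map)

lemma tensor_single [simp]: "tensor sc p (single m c) = single m (sc c p)"
  by (rule poly_mapping_eqI) (simp add: tensor_coef lookup_single when_def)

lemma tensor_zero [simp]: "tensor sc p 0 = 0" "tensor sc 0 v = 0"
  by (rule poly_mapping_eqI; simp add: tensor_coef)+

lemma tensor_add: "tensor sc (p + q) v = tensor sc p v + tensor sc q v"
  by (rule poly_mapping_eqI) (simp add: tensor_coef lookup_add scale_right_distrib)

definition homog :: "int \<Rightarrow> ('k::finite amon \<Rightarrow>\<^sub>0 'v) set" where
  "homog k = {u. \<forall>m\<in>supp u. negative m \<and> mdeg m = k}"

lemma homog_iff: "u \<in> homog k \<longleftrightarrow> (\<forall>m. coef u m \<noteq> 0 \<longrightarrow> negative m \<and> mdeg m = k)"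
  by (auto simp: homog_def in_keys_iff)

lemma homog_subspace: "F.subspace (homog k)"
proof (rule F.subspaceI)
  show "u + v \<in> homog k" if "u \<in> homog k" "v \<in> homog k" for u v
    using that unfolding homog_iff by (metis add.right_neutral lookup_add)
qed (auto simp: homog_iff)

lemma homog_single: "negative m \<Longrightarrow> mdeg m = k \<Longrightarrow> single m p \<in> homog k"
  by (auto simp: homog_iff lookup_single when_def)

lemma additive_homog:
  assumes add: "\<And>u v. T (u + v) = T u + T v"
    and single: "\<And>m p. negative m \<Longrightarrow> mdeg m = k \<Longrightarrow> T (single m p) \<in> homog l"
    and u: "u \<in> homog k"
  shows "T u \<in> homog l"
proof -
  interpret Modules.additive T by unfold_locales (rule add)
  have "T u = (\<Sum>m\<in>supp u. T (single m (coef u m)))"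
    by (subst sum_singles[symmetric], subst sum) simp
  also have "\<dots> \<in> homog l"
    using u by (intro F.subspace_sum homog_subspace single) (auto simp: homog_def)
  finally show ?thesis .
qed

text \<open>\<open>N_mod\<close> depends on its weight only through the sum of the entries. The
  terms of the filtration therefore come from single degrees of P \<otimes> A^+, on which diff acts
  as a complex.\<close>

lemma carrier_F_mod:
  fixes \<mu> :: "'k::{finite,linorder} \<Rightarrow> int"
  shows "carrier (F_mod sc V r (N_mod \<mu>)) = homog (\<Sum>s\<in>UNIV. \<mu> s)"
proof -
  have "F.span {tensor sc p v | p v. v \<in> N_mod \<mu>} = homog (\<Sum>s\<in>UNIV. \<mu> s)"
  proof (rule subset_antisym)
    show "F.span {tensor sc p v | p v. v \<in> N_mod \<mu>} \<subseteq> homog (\<Sum>s\<in>UNIV. \<mu> s)"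
      by (rule F.span_minimal[OF _ homog_subspace]) (auto simp: homog_iff N_mod_iff tensor_coef in_keys_iff)
    show "homog (\<Sum>s\<in>UNIV. \<mu> s) \<subseteq> F.span {tensor sc p v | p v. v \<in> N_mod \<mu>}"
    proof
      fix u :: "'k amon \<Rightarrow>\<^sub>0 'v" assume u: "u \<in> homog (\<Sum>s\<in>UNIV. \<mu> s)"
      have "single m p \<in> F.span {tensor sc p v | p v. v \<in> N_mod \<mu>}" if "m \<in> supp u" for m and p :: 'v
      proof (rule F.span_base)
        have "single m p = tensor sc p (single m 1)" by simp
        moreover have "single m 1 \<in> N_mod \<mu>"
          using that u by (simp add: N_mod_iff homog_def)
        ultimately show "single m p \<in> {tensor sc p v | p v. v \<in> N_mod \<mu>}" by blast
      qed
      then have "(\<Sum>m\<in>supp u. single m (coef u m)) \<in> F.span {tensor sc p v | p v. v \<in> N_mod \<mu>}"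
        by (intro F.span_sum)
      then show "u \<in> F.span {tensor sc p v | p v. v \<in> N_mod \<mu>}"
        by (simp add: sum_singles)
    qed
  qed
  then show ?thesis
    by (simp add: F_mod_def)
qed

end

context graded_space
begin

interpretation F: complex_space "pscale sc :: complex \<Rightarrow> ('k amon \<Rightarrow>\<^sub>0 'p) \<Rightarrow> _"
  by (simp add: complex_space_def vector_space_pscale)

lemma F_part_iff: "u \<in> F_part V e \<longleftrightarrow> (\<forall>\<alpha> q. coef u (\<alpha>, q) \<in> V (e + q))"
  using subspace_0[OF V_subspace] by (fastforce simp: F_part_def in_keys_iff)

lemma F_part_subspace: "F.subspace (F_part V e)"
  by (rule F.subspaceI)
    (auto simp: F_part_iff lookup_add subspace_0[OF V_subspace] subspace_add[OF V_subspace] subspace_scale[OF V_subspace])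

lemma F_part_single: "p \<in> V (e + q) \<Longrightarrow> single (\<alpha>, q) p \<in> F_part V e"
  by (auto simp: F_part_iff lookup_single when_def subspace_0[OF V_subspace])

lemma graded_space_F: "graded_space (pscale sc) (F_part V :: bit \<Rightarrow> ('k amon \<Rightarrow>\<^sub>0 'p) set)"
proof (intro_locales, unfold graded_space_axioms_def, intro conjI allI)
  fix e :: bit and u :: "'k amon \<Rightarrow>\<^sub>0 'p"
  show "F.subspace (F_part V e :: ('k amon \<Rightarrow>\<^sub>0 'p) set)"
    by (rule F_part_subspace)
  have "u = 0" if "u \<in> F_part V 0" "u \<in> F_part V 1" for u :: "'k amon \<Rightarrow>\<^sub>0 'p"
  proof (rule poly_mapping_eqI)
    fix m :: "'k amon"
    obtain \<alpha> q where m: "m = (\<alpha>, q)" by (metis surj_pair)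
    have "coef u (\<alpha>, q) \<in> V 0 \<inter> V 1"
      using that[unfolded F_part_iff, rule_format, of \<alpha> q] by (cases q) auto
    then show "coef u m = coef 0 m"
      using V_Int by (simp add: m)
  qed
  then show "F_part V 0 \<inter> F_part V 1 = {0 :: 'k amon \<Rightarrow>\<^sub>0 'p}"
    using F.subspace_0[OF F_part_subspace] by auto
  obtain A B where AB: "\<And>p. A p \<in> V 0" "\<And>p. B p \<in> V 1" "\<And>p. p = A p + B p"
    using V_sum by metis
  \<comment> \<open>At an odd monomial the parity of the coefficient is shifted, hence the exchange
    of \<open>A\<close> and \<open>B\<close>.\<close>
  define a where "a = (\<Sum>m\<in>supp u. single m (if snd m = 0 then A (coef u m) else B (coef u m)))"
  define b where "b = (\<Sum>m\<in>supp u. single m (if snd m = 0 then B (coef u m) else A (coef u m)))"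
  have "a \<in> F_part V 0"
    unfolding a_def
  proof (intro F.subspace_sum F_part_subspace)
    show "single m (if snd m = 0 then A (coef u m) else B (coef u m)) \<in> F_part V 0" for m
      using AB by (cases m; cases "snd m") (auto intro!: F_part_single)
  qed
  moreover have "b \<in> F_part V 1"
    unfolding b_def
  proof (intro F.subspace_sum F_part_subspace)
    show "single m (if snd m = 0 then B (coef u m) else A (coef u m)) \<in> F_part V 1" for m
      using AB by (cases m; cases "snd m") (auto intro!: F_part_single)
  qed
  moreover have "u = a + b"
  proof -
    have "(if snd m = 0 then A (coef u m) else B (coef u m)) +
        (if snd m = 0 then B (coef u m) else A (coef u m)) = coef u m" for m
      using AB(3)[of "coef u m"] by (simp add: add.commute)
    then have "a + b = (\<Sum>m\<in>supp u. single m (coef u m))"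
      unfolding a_def b_def sum.distrib[symmetric] single_add[symmetric] by simp
    then show ?thesis by (simp add: sum_singles)
  qed
  ultimately show "\<exists>a\<in>F_part V 0. \<exists>b\<in>F_part V 1. u = a + b"
    by blast
qed

interpretation FV: graded_space "pscale sc" "F_part V :: bit \<Rightarrow> ('k amon \<Rightarrow>\<^sub>0 'p) set"
  by (rule graded_space_F)

lemma FV_tau_single: "FV.tau (single (\<alpha>, q) p) = single (\<alpha>, q) (sc (psign q) (twist sc V 1 p))"
proof -
  obtain a b where ab: "a \<in> V 0" "b \<in> V 1" "p = a + b" by (rule V_decompose)
  show ?thesis
  proof (cases q)
    case zero
    then have "FV.tau (single (\<alpha>, q) a + single (\<alpha>, q) b) = single (\<alpha>, q) a - single (\<alpha>, q) b"
      using ab by (intro FV.tau_eq F_part_single) auto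
    then show ?thesis
      using ab zero by (simp add: single_add single_diff tau_eq)
  next
    case one
    then have "FV.tau (single (\<alpha>, q) b + single (\<alpha>, q) a) = single (\<alpha>, q) b - single (\<alpha>, q) a"
      using ab by (intro FV.tau_eq F_part_single) auto
    then show ?thesis
      using ab one by (simp add: single_add[symmetric] single_diff[symmetric] single_uminus[symmetric] tau_eq add.commute)
  qed
qed

lemma tau_homog: "u \<in> homog k \<Longrightarrow> FV.tau u \<in> homog k"
proof (rule additive_homog[of FV.tau k k])
  show "FV.tau (single m p) \<in> homog k" if "negative m" "mdeg m = k" for m p
    using that by (cases m) (auto simp: FV_tau_single homog_single)
qed (rule FV.twist_add)

end

section \<open>The Cartan formula\<close>

context K_mod
begin

sublocale F: complex_space "pscale sc :: complex \<Rightarrow> ('n amon \<Rightarrow>\<^sub>0 'p) \<Rightarrow> _"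
  by (simp add: complex_space_def vector_space_pscale)

sublocale FV: graded_space "pscale sc" "F_part V :: bit \<Rightarrow> ('n amon \<Rightarrow>\<^sub>0 'p) set"
  by (rule graded_space_F)

abbreviation top :: "('p \<Rightarrow> 'p) \<Rightarrow> bit \<Rightarrow> ('n aplus \<Rightarrow> 'n aplus) \<Rightarrow> ('n amon \<Rightarrow>\<^sub>0 'p) \<Rightarrow> ('n amon \<Rightarrow>\<^sub>0 'p)" where
  "top a e b \<equiv> tensor_op sc V a e b"

abbreviation df :: "('n amon \<Rightarrow>\<^sub>0 'p) \<Rightarrow> ('n amon \<Rightarrow>\<^sub>0 'p)" where
  "df \<equiv> diff sc V r"

abbreviation pib :: "int \<Rightarrow> 'n set \<Rightarrow> 'n option \<Rightarrow> ('n amon \<Rightarrow>\<^sub>0 'p) \<Rightarrow> ('n amon \<Rightarrow>\<^sub>0 'p)" where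
  "pib \<equiv> pi_basis sc V r"

abbreviation pia :: "'n lop \<Rightarrow> ('n amon \<Rightarrow>\<^sub>0 'p) \<Rightarrow> ('n amon \<Rightarrow>\<^sub>0 'p)" where
  "pia \<equiv> pi_act sc V r"

lemma top_add: "a \<in> K_alg \<Longrightarrow> top (r a) e b (u + v) = top (r a) e b u + top (r a) e b v"
  unfolding tensor_op_def
  by (rule sum_supp_add[where \<phi> = "\<lambda>m p. tensor sc (r a (twist sc V e p)) (b (single m 1))"])
    (simp add: twist_add r_add tensor_add)

lemma top_single: "a \<in> K_alg \<Longrightarrow> top (r a) e b (single m p) = tensor sc (r a (twist sc V e p)) (b (single m 1))"
  unfolding tensor_op_def
  by (subst sum_supp_single[where \<phi> = "\<lambda>m p. tensor sc (r a (twist sc V e p)) (b (single m 1))"])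
    (simp_all add: twist_lin r_zero)

lemma tensor_scale: "tensor sc (sc c p) v = pscale sc c (tensor sc p v)"
  by (rule poly_mapping_eqI) (simp add: tensor_coef mult.commute)

lemma top_scale: "a \<in> K_alg \<Longrightarrow> top (r a) e b (pscale sc c u) = pscale sc c (top (r a) e b u)"
  by (rule additive_ext[where f = u])
    (simp_all add: top_add F.scale_right_distrib top_single twist_scale r_scale tensor_scale)

lemmas top_K = lmult_K_alg K_alg.partial K_alg.comp[OF lmult_K_alg K_alg.partial]
  K_alg.partial[of None, unfolded partial.simps] K_alg.partial[of "Some _", unfolded partial.simps]

lemma pib_add: "pib k I j (u + v) = pib k I j u + pib k I j v"
  unfolding pi_basis_def
  by (simp add: top_add top_K F.scale_right_distrib sum.distrib algebra_simps)

lemma pib_scale: "pib k I j (pscale sc c u) = pscale sc c (pib k I j u)"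
  unfolding pi_basis_def
  by (simp add: top_scale top_K F.scale_right_distrib F.scale_sum_right mult.commute)

lemma pia_add: "pia x (u + v) = pia x u + pia x v"
  unfolding pi_act_def
  by (simp add: pib_add F.scale_right_distrib sum.distrib case_prod_beta)

lemma pia_scale: "pia x (pscale sc c u) = pscale sc c (pia x u)"
  unfolding pi_act_def
  by (simp add: pib_scale F.scale_sum_right case_prod_beta mult.commute)

lemma df_add: "df (u + v) = df u + df v"
  unfolding diff_def
  by (simp add: top_add top_K sum.distrib algebra_simps)

lemma df_scale: "df (pscale sc c u) = pscale sc c (df u)"
  unfolding diff_def
  by (simp add: top_scale top_K F.scale_right_diff_distrib F.scale_sum_right)

lemma df_single:
  "df (single (\<alpha>, e) p) = (if e = 0 then single (\<alpha>, 1) (dd None (tau p)) else 0)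
    - (\<Sum>s\<in>UNIV. if \<alpha> s + 1 < 0 then single (\<alpha>(s := \<alpha> s + 1), e) (dd (Some s) p) else 0)"
  unfolding diff_def
  by (simp add: top_single top_K partial.simps) (intro sum.cong, auto simp: partial.simps)

lemma top_field: "top (r (lmult (mon k I) \<circ> partial j)) 0 (\<lambda>v. v) (single m p) = single m (mm k I (dd j p))"
  by (simp add: top_single top_K r_comp)

lemma pib_None_single:
  "pib k I None (single (\<alpha>, e) p) = single (\<alpha>, e) (mm k I (dd None p))
    + (if e = 1 then single (\<alpha>, e) (sc (of_int k) (mm (k - 1) I p)) else 0)
    + (if e = 1 then pscale sc (- ((-1) ^ card I)) (\<Sum>s\<in>UNIV. if \<alpha> s + 1 < 0
        then single (\<alpha>(s := \<alpha> s + 1), 0) (mult (dxi s (mon k I)) (tau p)) else 0) else 0)"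
proof -
  have "top (mult (dxi s (mon k I))) (E_par (Some s) None) (E_op (Some s) None) (single (\<alpha>, e) p) =
      (if e = 1 \<and> \<alpha> s + 1 < 0 then single (\<alpha>(s := \<alpha> s + 1), 0) (mult (dxi s (mon k I)) (tau p)) else 0)" for s
    by (simp add: top_single top_K)
  then show ?thesis
    unfolding pi_basis_def
    by (cases e) (simp_all add: top_field, simp_all add: top_single top_K)
qed

lemma pib_Some_single:
  "pib k I (Some i) (single (\<alpha>, e) p) = single (\<alpha>, e) (mm k I (dd (Some i) p))
    + (if e = 0 then single (\<alpha>(i := \<alpha> i - 1), 1) (sc (of_int (k * \<alpha> i)) (mm (k - 1) I (tau p))) else 0)
    + pscale sc (- ((-1) ^ card I)) (\<Sum>s\<in>UNIV. if (\<alpha>(i := \<alpha> i - 1)) s + 1 < 0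
        then single (\<alpha>(i := \<alpha> i - 1, s := (\<alpha>(i := \<alpha> i - 1)) s + 1), e)
          (sc (of_int (\<alpha> i)) (mult (dxi s (mon k I)) p)) else 0)"
proof -
  have "top (mult (dxi s (mon k I))) (E_par (Some s) (Some i)) (E_op (Some s) (Some i)) (single (\<alpha>, e) p) =
      (if (\<alpha>(i := \<alpha> i - 1)) s + 1 < 0
        then single (\<alpha>(i := \<alpha> i - 1, s := (\<alpha>(i := \<alpha> i - 1)) s + 1), e)
          (sc (of_int (\<alpha> i)) (mult (dxi s (mon k I)) p)) else 0)" for s
    by (simp add: top_single top_K del: fun_upd_apply)
  then show ?thesis
    unfolding pi_basis_def
    by (cases e) (simp_all add: top_field del: fun_upd_apply, simp_all add: top_single top_K del: fun_upd_apply)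
qed

text \<open>diff pairs d/dt with multiplication by \<xi>, and \<partial>/\<partial>\<xi>_i with
  multiplication by t_i. The contraction uses the dual derivations of A^+ instead, so the Weyl
  relations there reproduce the field in the supercommutator. The parity 1 in the first case is that
  of \<open>xder\<close>.\<close>

definition iota :: "int \<Rightarrow> 'n set \<Rightarrow> 'n option \<Rightarrow> ('n amon \<Rightarrow>\<^sub>0 'p) \<Rightarrow> ('n amon \<Rightarrow>\<^sub>0 'p)" where
  "iota k I j = (case j of None \<Rightarrow> top (mm k I) 1 xder | Some i \<Rightarrow> top (mm k I) 0 (tder i))"

lemma iota_add: "iota k I j (u + v) = iota k I j u + iota k I j v"
  by (cases j) (simp_all add: iota_def top_add top_K)

lemma iota_single:
  "iota k I None (single (\<alpha>, e) p) = (if e = 1 then single (\<alpha>, 0) (mm k I (tau p)) else 0)"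
  "iota k I (Some i) (single (\<alpha>, e) p) = single (\<alpha>(i := \<alpha> i - 1), e) (sc (of_int (\<alpha> i)) (mm k I p))"
  by (simp_all add: iota_def top_single top_K)

sublocale df: Modules.additive df
  by unfold_locales (rule df_add)

sublocale iota: Modules.additive "iota k I j" for k I j
  by unfold_locales (rule iota_add)

lemma dd_mm: "dd j (mm k I p) = mult (partial j (mon k I)) p + sc (psign (par j * of_nat (card I))) (mm k I (dd j p))"
  by (rule dd_mult[OF mon_lpart]) simp

lemma ddt_mon: "ddt (mon k I) = pscale (*) (of_int k) (mon (k - 1) I)"
  by (simp add: mon_def)

lemma dxi_mm: "dd (Some i) (mm k I p) = mult (dxi i (mon k I)) p + sc ((-1) ^ card I) (mm k I (dd (Some i) p))"
  using dd_mm[of "Some i" k I p] by (simp add: partial.simps psign_of_nat)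

lemma ddt_mm: "dd None (mm k I p) = sc (of_int k) (mm (k - 1) I p) + mm k I (dd None p)"
  using dd_mm[of None k I p] by (simp add: partial.simps ddt_mon mult_scale)

text \<open>
  Cartan's formula: the action of a field is the supercommutator of \<open>diff\<close> with the contraction
  \<open>iota\<close> by that field, up to the sign of the coefficient.
\<close>

lemma iota_if: "iota k I j (if b then u else 0) = (if b then iota k I j u else 0)"
  by (simp add: iota.zero)

lemma df_if: "df (if b then u else 0) = (if b then df u else 0)"
  by (simp add: df.zero)

lemma card_sign [simp]: "(-1) ^ card I * ((-1) ^ card I * c) = (c :: complex)"
  by (simp flip: mult.assoc power_add)

lemma cartan_formula_None:
  "pib k I None u = pscale sc ((-1) ^ card I) (df (iota k I None u)) + iota k I None (df u)"
proof (rule additive_ext[where f = u])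
  fix m :: "'n amon" and p :: 'p
  obtain \<alpha> e where m: "m = (\<alpha>, e)" by (metis surj_pair)
  let ?s = "(-1) ^ card I :: complex"
  show "pib k I None (single m p) = pscale sc ?s (df (iota k I None (single m p))) + iota k I None (df (single m p))"
  proof (cases e)
    case zero
    then show ?thesis
      unfolding m by (simp add: pib_None_single iota_single df_single iota.diff iota.sum iota_if iota.zero df.zero twist_dd cong: if_cong)
  next
    case one
    \<comment> \<open>The Leibniz rule for \<partial>_s. The term with \<partial>_s on
      \<open>p\<close> is rewritten by tau \<partial>_s = - \<partial>_s tau so as to match the
      contraction of \<open>df\<close>.\<close>
    have pt: "pscale sc ?s (if b then single x (mult (dxi s (mon k I)) (tau p)) else 0) =
        pscale sc ?s (if b then single x (dd (Some s) (mm k I (tau p))) else 0)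
        + (if b then single x (mm k I (tau (dd (Some s) p))) else 0)" for b s and x :: "'n amon"
      by (simp add: dxi_mm twist_dd r_lin scale_right_distrib F.scale_right_distrib single_add single_uminus)
    have first: "sc ?s (dd None (tau (mm k I (tau p)))) = mm k I (dd None p) + sc (of_int k) (mm (k - 1) I p)"
      by (simp add: twist_mm r_lin psign_of_nat ddt_mm add.commute)
    show ?thesis
      unfolding m one
      by (simp add: pib_None_single iota_single df_single iota.diff iota.minus iota.sum iota_if F.scale_right_diff_distrib
          F.scale_sum_right pt first sum.distrib sum_subtractf sum_negf single_add if_distrib[of single] cong: if_cong)
  qed
qed (simp_all add: pib_add iota_add df_add F.scale_right_distrib)

lemma cartan_formula_Some:
  assumes "\<And>m. m \<in> supp u \<Longrightarrow> negative m"
  shows "pib k I (Some i) u = pscale sc ((-1) ^ card I) (df (iota k I (Some i) u)) - iota k I (Some i) (df u)"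
proof (rule additive_ext[where f = u])
  fix m :: "'n amon" and p :: 'p assume "m \<in> supp u"
  obtain \<alpha> e where m: "m = (\<alpha>, e)" by (metis surj_pair)
  have neg: "\<alpha> i < 0" for i
    using assms[OF \<open>m \<in> supp u\<close>] by (simp add: m negative_def)
  let ?s = "(-1) ^ card I :: complex"
  define \<beta> where "\<beta> = \<alpha>(i := \<alpha> i - 1)"
  define up where "up \<gamma> s = (\<gamma> :: 'n \<Rightarrow> int)(s := \<gamma> s + 1)" for \<gamma> s
  define A where "A s = (if \<beta> s + 1 < 0 then single (up \<beta> s, e) (sc (of_int (\<alpha> i)) (mult (dxi s (mon k I)) p)) else 0)" for s
  define B where "B s = (if \<beta> s + 1 < 0 then single (up \<beta> s, e) (sc (of_int (\<alpha> i)) (dd (Some s) (mm k I p))) else 0)" for s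
  define C where "C s = (if \<alpha> s + 1 < 0 then single ((up \<alpha> s)(i := up \<alpha> s i - 1), e) (sc (of_int (up \<alpha> s i)) (mm k I (dd (Some s) p))) else 0)" for s
  \<comment> \<open>Up to sign, \<open>A\<close>, \<open>B\<close> and \<open>C\<close> are the
    terms with index \<open>s\<close> of the action, of \<open>df\<close> after \<open>iota\<close>
    and of \<open>iota\<close> after \<open>df\<close>. For \<open>s \<noteq> i\<close> this is the
    Leibniz rule; for \<open>s = i\<close> the relation between t_i and \<partial>/\<partial>t_i
    leaves the field itself as an extra term.\<close>
  have pt: "pscale sc ?s (A s) = pscale sc ?s (B s) - C s + (if s = i then single (\<alpha>, e) (mm k I (dd (Some i) p)) else 0)" for s
  proof -
    have dd: "dd (Some s) (mm k I p) = mult (dxi s (mon k I)) p + sc ?s (mm k I (dd (Some s) p))"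
      by (rule dxi_mm)
    show ?thesis
    proof (cases "s = i")
      case True
      have eqs: "\<beta> i + 1 < 0" "up \<beta> i = \<alpha>" "(up \<alpha> i)(i := \<alpha> i) = \<alpha>" "up \<alpha> i i = \<alpha> i + 1"
        using neg[of i] by (simp_all add: \<beta>_def up_def)
      \<comment> \<open>At exponent -1 the product t_i t_i^-1 has class zero. The general formula
        agrees, because its factor \<open>\<alpha> i + 1\<close> vanishes there.\<close>
      have "\<alpha> i = - 1 \<or> \<alpha> i + 1 < 0"
        using neg[of i] by linarith
      then show ?thesis
        by (auto simp: A_def B_def C_def True dd[unfolded True] eqs scale_right_distrib F.scale_right_distrib scale_left_distrib single_add single_uminus mult_ac)
    next
      case False
      then have "\<beta> s = \<alpha> s" "(up \<alpha> s)(i := up \<alpha> s i - 1) = up \<beta> s" "up \<alpha> s i = \<alpha> i"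
        by (auto simp: \<beta>_def up_def)
      then show ?thesis
        using False by (simp add: A_def B_def C_def dd scale_right_distrib F.scale_right_distrib single_add single_uminus mult_ac)
    qed
  qed
  have first: "e = 0 \<Longrightarrow> sc ?s (dd None (tau (mm k I p))) = sc (of_int k) (mm (k - 1) I (tau p)) + mm k I (dd None (tau p))"
    by (simp add: twist_mm r_lin psign_of_nat ddt_mm)
  have pib: "pib k I (Some i) (single m p) = single (\<alpha>, e) (mm k I (dd (Some i) p))
      + (if e = 0 then single (\<beta>, 1) (sc (of_int (k * \<alpha> i)) (mm (k - 1) I (tau p))) else 0)
      + pscale sc (- ?s) (\<Sum>s\<in>UNIV. A s)"
    unfolding m pib_Some_single A_def \<beta>_def up_def by simp
  have di: "df (iota k I (Some i) (single m p)) =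
      (if e = 0 then single (\<beta>, 1) (sc (of_int (\<alpha> i)) (dd None (tau (mm k I p)))) else 0) - (\<Sum>s\<in>UNIV. B s)"
    unfolding m iota_single df_single B_def \<beta>_def up_def r_lin twist_scale ..
  have id: "iota k I (Some i) (df (single m p)) =
      (if e = 0 then single (\<beta>, 1) (sc (of_int (\<alpha> i)) (mm k I (dd None (tau p)))) else 0) - (\<Sum>s\<in>UNIV. C s)"
    unfolding m df_single iota.diff iota.sum iota_if iota_single C_def \<beta>_def up_def by simp
  have sums: "pscale sc (- ?s) (\<Sum>s\<in>UNIV. A s) = - pscale sc ?s (\<Sum>s\<in>UNIV. B s) + (\<Sum>s\<in>UNIV. C s) - single (\<alpha>, e) (mm k I (dd (Some i) p))"
    by (simp add: F.scale_sum_right pt sum.distrib sum_subtractf sum_negf)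
  have head: "pscale sc ?s (if e = 0 then single (\<beta>, 1 :: bit) (sc (of_int (\<alpha> i)) (dd None (tau (mm k I p)))) else 0) =
      (if e = 0 then single (\<beta>, 1) (sc (of_int (k * \<alpha> i)) (mm (k - 1) I (tau p))) else 0) +
      (if e = 0 then single (\<beta>, 1) (sc (of_int (\<alpha> i)) (mm k I (dd None (tau p)))) else 0)"
    using arg_cong[OF first, of "sc (of_int (\<alpha> i))"]
    by (simp add: single_add[symmetric] scale_right_distrib mult_ac)
  show "pib k I (Some i) (single m p) = pscale sc ?s (df (iota k I (Some i) (single m p))) - iota k I (Some i) (df (single m p))"
    unfolding pib di id sums F.scale_right_diff_distrib head by (simp only: algebra_simps add_minus_cancel)
qed (simp_all add: pib_add iota_add df_add F.scale_right_distrib)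

text \<open>The \<partial>_s anticommute while the t_s commute, so their double sum is
  antisymmetric. The summand with d/dt anticommutes with the others and squares to zero because
  \<xi> does.\<close>

lemma df_df: "df (df u) = 0"
proof (rule additive_ext[where f = u and F = "\<lambda>u. df (df u)" and G = "\<lambda>_. 0"])
  fix m :: "'n amon" and p :: 'p
  obtain \<alpha> e where m: "m = (\<alpha>, e)" by (metis surj_pair)
  define up where "up \<gamma> s = (\<gamma> :: 'n \<Rightarrow> int)(s := \<gamma> s + 1)" for \<gamma> s
  define Z where "Z s t = (if \<alpha> s + 1 < 0 \<and> up \<alpha> s t + 1 < 0
      then single (up (up \<alpha> s) t, e) (dd (Some t) (dd (Some s) p)) else 0)" for s t
  have Z_anti: "Z s t = - Z t s" for s t
  proof (cases "s = t")
    case True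
    then show ?thesis by (simp add: Z_def dd_square)
  next
    case False
    then have "up (up \<alpha> s) t = up (up \<alpha> t) s" "up \<alpha> s t = \<alpha> t" "up \<alpha> t s = \<alpha> s"
      by (auto simp: up_def fun_upd_twist)
    then show ?thesis
      using dd_dd_odd[of t s p] by (simp add: Z_def single_uminus)
  qed
  have "(\<Sum>s\<in>UNIV. \<Sum>t\<in>UNIV. Z s t) = (\<Sum>s\<in>UNIV. \<Sum>t\<in>UNIV. - Z t s)"
    by (intro sum.cong refl Z_anti)
  also have "\<dots> = - (\<Sum>s\<in>UNIV. \<Sum>t\<in>UNIV. Z t s)"
    by (simp only: sum_negf)
  also have "(\<Sum>s\<in>UNIV. \<Sum>t\<in>UNIV. Z t s) = (\<Sum>s\<in>UNIV. \<Sum>t\<in>UNIV. Z s t)"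
    by (rule sum.swap)
  finally have "(\<Sum>s\<in>UNIV. \<Sum>t\<in>UNIV. Z s t) + (\<Sum>s\<in>UNIV. \<Sum>t\<in>UNIV. Z s t) = 0"
    by (simp only: eq_neg_iff_add_eq_0)
  moreover have "u = 0" if "u + u = 0" for u :: "'n amon \<Rightarrow>\<^sub>0 'p"
  proof -
    have "pscale sc 2 u = 0"
      using that F.scale_left_distrib[of 1 1 u] by simp
    then show ?thesis by simp
  qed
  ultimately have Z: "(\<Sum>s\<in>UNIV. \<Sum>t\<in>UNIV. Z s t) = 0"
    by blast
  have dfs: "df (single (\<gamma>, e) q) = (if e = 0 then single (\<gamma>, 1) (dd None (tau q)) else 0)
      - (\<Sum>s\<in>UNIV. if \<gamma> s + 1 < 0 then single (up \<gamma> s, e) (dd (Some s) q) else 0)" for \<gamma> e q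
    unfolding df_single up_def ..
  have nested: "(\<Sum>s\<in>UNIV. if \<alpha> s + 1 < 0 then \<Sum>t\<in>UNIV. if up \<alpha> s t + 1 < 0
      then single (up (up \<alpha> s) t, e) (dd (Some t) (dd (Some s) p)) else 0 else 0) = 0"
    by (rule trans[OF _ Z]) (auto simp: Z_def intro!: sum.cong)
  have anti: "dd None (tau (dd (Some s) p)) = - dd (Some s) (dd None (tau p))" for s
    using dd_dd[of None "Some s" "tau p"] by (simp add: twist_dd r_lin)
  show "df (df (single m p)) = 0"
  proof (cases e)
    case zero
    have "(\<Sum>s\<in>UNIV. if \<alpha> s + 1 < 0 then single (up \<alpha> s, 1 :: bit) (dd None (tau (dd (Some s) p))) else 0) =
        - (\<Sum>s\<in>UNIV. if \<alpha> s + 1 < 0 then single (up \<alpha> s, 1) (dd (Some s) (dd None (tau p))) else 0)"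
      unfolding sum_negf[symmetric] anti by (intro sum.cong) (auto simp: single_uminus)
    moreover have "(\<Sum>s\<in>UNIV. df (if \<alpha> s + 1 < 0 then single (up \<alpha> s, 0) (dd (Some s) p) else 0)) =
        (\<Sum>s\<in>UNIV. if \<alpha> s + 1 < 0 then single (up \<alpha> s, 1) (dd None (tau (dd (Some s) p))) else 0) - 
        (\<Sum>s\<in>UNIV. if \<alpha> s + 1 < 0 then \<Sum>t\<in>UNIV. if up \<alpha> s t + 1 < 0
          then single (up (up \<alpha> s) t, 0) (dd (Some t) (dd (Some s) p)) else 0 else 0)"
      unfolding df_if dfs sum_subtractf[symmetric] by (intro sum.cong) auto
    ultimately show ?thesis
      using nested unfolding m zero by (simp add: dfs df.diff df.sum)
  next
    case one
    have "(\<Sum>s\<in>UNIV. df (if \<alpha> s + 1 < 0 then single (up \<alpha> s, 1) (dd (Some s) p) else 0)) =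
        - (\<Sum>s\<in>UNIV. if \<alpha> s + 1 < 0 then \<Sum>t\<in>UNIV. if up \<alpha> s t + 1 < 0
          then single (up (up \<alpha> s) t, 1) (dd (Some t) (dd (Some s) p)) else 0 else 0)"
      unfolding df_if dfs sum_negf[symmetric] by (intro sum.cong) auto
    then show ?thesis
      using nested unfolding m one by (simp add: dfs df.diff df.sum df.minus)
  qed
qed (simp_all add: df_add)

end

section \<open>The component \<open>N(-1)\<close> and its neighbours\<close>

abbreviation low :: "'n \<Rightarrow> 'n \<Rightarrow> int" where
  "low i \<equiv> (\<lambda>_. - 1)(i := - 2)"

abbreviation omega :: "'n amon" where
  "omega \<equiv> (\<lambda>_. - 1, 1)"

text \<open>The monomials of N(-1), indexed like the derivations: up to sign they are the images of
  \<open>omega\<close> under \<partial>/\<partial>\<xi> and \<partial>/\<partial>t_i, which is what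
  makes coefficients at them components of a vector field.\<close>

fun wk :: "'n option \<Rightarrow> 'n amon" where
  "wk None = (\<lambda>_. - 1, 0)"
| "wk (Some i) = (low i, 1)"

lemma low_eq_iff [simp]: "low i = low j \<longleftrightarrow> i = j"
  by (auto simp: fun_eq_iff split: if_splits)

lemma wk_eq_iff [simp]: "wk c = wk d \<longleftrightarrow> c = d"
  by (cases c; cases d) (simp_all del: fun_upd_apply)

lemma sum_if_single:
  fixes f :: "'a::finite \<Rightarrow> 'b::comm_monoid_add"
  assumes "\<And>s. P s \<longleftrightarrow> s = i"
  shows "(\<Sum>s\<in>UNIV. if P s then f s else 0) = f i"
  by (simp add: assms)

lemma low_less [simp]: "low i s + 1 < 0 \<longleftrightarrow> s = i"
  by simp

lemma low_up: "(\<lambda>_. - 1 :: int)(i := low i i + 1) = (\<lambda>_. - 1)"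
  by auto

lemma sum_low: "sum (low i) (UNIV :: 'n::finite set) = - int CARD('n) - 1"
  by (simp add: sum_fun_upd del: fun_upd_apply)

lemma negative_sum_le:
  fixes \<alpha> :: "'n::finite \<Rightarrow> int"
  assumes "\<And>i. \<alpha> i < 0"
  shows "sum \<alpha> UNIV \<le> - int CARD('n)"
proof -
  have "sum \<alpha> UNIV \<le> (\<Sum>i\<in>(UNIV :: 'n set). - 1)"
  proof (rule sum_mono)
    show "\<alpha> i \<le> - 1" for i
      using assms[of i] by linarith
  qed
  then show ?thesis by simp
qed

lemma negative_sum_eq:
  fixes \<alpha> :: "'n::finite \<Rightarrow> int"
  assumes "\<And>i. \<alpha> i < 0" "sum \<alpha> UNIV = - int CARD('n)"
  shows "\<alpha> = (\<lambda>_. - 1)"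
proof
  fix i
  have "- 1 - \<alpha> i = 0"
  proof (rule sum_nonneg_0[of UNIV "\<lambda>i. - 1 - \<alpha> i"])
    show "(\<Sum>i\<in>UNIV. - 1 - \<alpha> i) = 0"
      using assms(2) by (simp add: sum_subtractf)
    show "0 \<le> - 1 - \<alpha> i" for i
      using assms(1)[of i] by linarith
  qed auto
  then show "\<alpha> i = - 1" by simp
qed

lemma negative_sum_less:
  fixes \<alpha> :: "'n::finite \<Rightarrow> int"
  assumes "\<And>i. \<alpha> i < 0" "sum \<alpha> UNIV < - int CARD('n)"
  obtains i \<beta> where "\<alpha> = \<beta>(i := \<beta> i - 1)" "\<And>i. \<beta> i < 0" "sum \<beta> UNIV = sum \<alpha> UNIV + 1"
proof -
  obtain i where i: "\<alpha> i < - 1"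
  proof (rule ccontr)
    assume *: "\<not> thesis"
    have "\<alpha> = (\<lambda>_. - 1)"
    proof
      show "\<alpha> i = - 1" for i
        using assms(1)[of i] that[of i] * by linarith
    qed
    then show False using assms(2) by simp
  qed
  show ?thesis
  proof (rule that[of "\<alpha>(i := \<alpha> i + 1)" i])
    show "sum (\<alpha>(i := \<alpha> i + 1)) UNIV = sum \<alpha> UNIV + 1"
      by (simp only: sum_fun_upd)
    show "\<alpha> = (\<alpha>(i := \<alpha> i + 1))(i := (\<alpha>(i := \<alpha> i + 1)) i - 1)"
      by simp
    show "(\<alpha>(i := \<alpha> i + 1)) j < 0" for j
      using assms(1)[of j] i by simp
  qed
qed

text \<open>Negative exponents sum to at most -n, so degree 1 - n leaves room only for the factor
  \<xi> and exponents -1. Hence diff has a single copy of P as its target.\<close>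

lemma key_top:
  fixes m :: "'n::finite amon"
  assumes "negative m" "mdeg m = 1 - int CARD('n)"
  shows "m = omega"
proof -
  obtain \<alpha> e where m: "m = (\<alpha>, e)" by (metis surj_pair)
  have neg: "\<alpha> i < 0" for i
    using assms(1) by (simp add: m negative_def)
  have "e = 1" "sum \<alpha> UNIV = - int CARD('n)"
    using negative_sum_le[of \<alpha>, OF neg] assms(2) by (cases e; simp add: m mdeg_def)+
  then show ?thesis
    using negative_sum_eq[OF neg] by (simp add: m)
qed

lemma key_mid:
  fixes m :: "'n::finite amon"
  assumes "negative m" "mdeg m = - int CARD('n)"
  obtains c where "m = wk c"
proof -
  obtain \<alpha> e where m: "m = (\<alpha>, e)" by (metis surj_pair)
  have neg: "\<alpha> i < 0" for i
    using assms(1) by (simp add: m negative_def)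
  show ?thesis
  proof (cases e)
    case zero
    then have "\<alpha> = (\<lambda>_. - 1)"
      using assms(2) by (intro negative_sum_eq neg) (simp add: m mdeg_def)
    then show ?thesis
      using that[of None] zero m by simp
  next
    case one
    then have *: "sum \<alpha> UNIV = - int CARD('n) - 1"
      using assms(2) by (simp add: m mdeg_def)
    obtain i \<beta> where \<beta>: "\<alpha> = \<beta>(i := \<beta> i - 1)" "\<And>i. \<beta> i < 0" "sum \<beta> UNIV = sum \<alpha> UNIV + 1"
      by (rule negative_sum_less[of \<alpha>]) (use neg * in auto)
    have "\<beta> = (\<lambda>_. - 1)"
      using \<beta>(2,3) * by (intro negative_sum_eq) auto
    then show ?thesis
      using that[of "Some i"] one m \<beta>(1) by simp
  qed
qed

text \<open>In the second alternative \<open>i = j\<close> is allowed and gives the exponent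
  -3.\<close>

lemma key_bot:
  fixes m :: "'n::finite amon"
  assumes "negative m" "mdeg m = - 1 - int CARD('n)"
  obtains i where "m = (low i, 0)" | i j where "m = ((low i)(j := low i j - 1), 1)"
proof -
  obtain \<alpha> e where m: "m = (\<alpha>, e)" by (metis surj_pair)
  have neg: "\<alpha> i < 0" for i
    using assms(1) by (simp add: m negative_def)
  have low: "\<exists>i. \<beta> = low i" if "\<And>i. \<beta> i < 0" "sum \<beta> UNIV = - 1 - int CARD('n)" for \<beta> :: "'n \<Rightarrow> int"
  proof -
    have "negative (\<beta>, 1)" "mdeg (\<beta>, 1) = - int CARD('n)"
      using that by (simp_all add: negative_def mdeg_def)
    from key_mid[OF this] obtain c where "(\<beta>, 1) = wk c" .
    then show ?thesis by (cases c) auto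
  qed
  show ?thesis
  proof (cases e)
    case zero
    then have "sum \<alpha> UNIV = - 1 - int CARD('n)"
      using assms(2) by (simp add: m mdeg_def)
    then obtain i where "\<alpha> = low i"
      using low[of \<alpha>] neg by blast
    then show ?thesis
      using that(1)[of i] zero m by simp
  next
    case one
    then have *: "sum \<alpha> UNIV = - 2 - int CARD('n)"
      using assms(2) by (simp add: m mdeg_def)
    obtain j \<beta> where \<beta>: "\<alpha> = \<beta>(j := \<beta> j - 1)" "\<And>i. \<beta> i < 0" "sum \<beta> UNIV = sum \<alpha> UNIV + 1"
      by (rule negative_sum_less[of \<alpha>]) (use neg * in auto)
    obtain i where "\<beta> = low i"
      using low[of \<beta>] \<beta>(2,3) * by auto
    then show ?thesis
      using that(2)[of i j] one m \<beta>(1) by simp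
  qed
qed

lemma negative_wk: "negative (wk c)"
  by (cases c) (simp_all add: negative_def)

lemma mdeg_wk: "mdeg (wk c :: 'n::finite amon) = - int CARD('n)"
  by (cases c) (simp_all add: mdeg_def sum_low del: fun_upd_apply)

context K_mod
begin

subsection \<open>The action and the filtration\<close>

abbreviation H0 :: "('n amon \<Rightarrow>\<^sub>0 'p) set" where
  "H0 \<equiv> homog (- int CARD('n))"

abbreviation H1 :: "('n amon \<Rightarrow>\<^sub>0 'p) set" where
  "H1 \<equiv> homog (- 1 - int CARD('n))"

lemma homog_negative: "u \<in> homog k \<Longrightarrow> m \<in> supp u \<Longrightarrow> negative m"
  by (auto simp: homog_def)

lemma df_homog:
  assumes "u \<in> homog k" shows "df u \<in> homog (k + 1)"
proof (rule additive_homog[of df, OF df_add _ assms])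
  fix m :: "'n amon" and p :: 'p assume m: "negative m" "mdeg m = k"
  obtain \<alpha> e where m': "m = (\<alpha>, e)" by (metis surj_pair)
  have sub: "F.subspace (homog (k + 1))" by (rule homog_subspace)
  have "single (\<alpha>(s := \<alpha> s + 1), e) q \<in> homog (k + 1)" if "\<alpha> s + 1 < 0" for s and q :: 'p
    using m that by (intro homog_single) (auto simp: m' negative_def simp del: mdeg_simps(2))
  moreover have "single (\<alpha>, 1) q \<in> homog (k + 1)" if "e = 0" for q :: 'p
    using m that by (intro homog_single) (auto simp: m' negative_def)
  ultimately show "df (single m p) \<in> homog (k + 1)"
    unfolding m' df_single
    by (intro F.subspace_diff[OF sub] F.subspace_sum[OF sub]) (auto intro: F.subspace_0[OF sub])
qed

lemma iota_homog:
  assumes "u \<in> homog k" shows "iota l I j u \<in> homog (k - 1)"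
proof (rule additive_homog[of "iota l I j", OF iota_add _ assms])
  fix m :: "'n amon" and p :: 'p assume m: "negative m" "mdeg m = k"
  obtain \<alpha> e where m': "m = (\<alpha>, e)" by (metis surj_pair)
  have sub: "F.subspace (homog (k - 1))" by (rule homog_subspace)
  have neg: "\<alpha> i < 0" for i
    using m by (simp add: m' negative_def)
  show "iota l I j (single m p) \<in> homog (k - 1)"
  proof (cases j)
    case None
    then show ?thesis
      using m F.subspace_0[OF sub] unfolding m' by (auto simp: iota_single negative_def intro!: homog_single)
  next
    case (Some i)
    have "negative (\<alpha>(i := \<alpha> i - 1), e)"
      by (simp add: negative_def neg less_trans[OF neg zero_less_one])
    then show ?thesis
      using m unfolding m' Some iota_single by (intro homog_single) auto
  qed
qed

lemma pib_cases:
  assumes "u \<in> homog l"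
  shows "pib k I j u = pscale sc ((-1) ^ card I) (df (iota k I j u)) + pscale sc (psign (par j)) (iota k I j (df u))"
  using cartan_formula_None[of k I u] cartan_formula_Some[of u k I] homog_negative[OF assms]
  by (cases j) simp_all

lemma pib_homog: "u \<in> homog l \<Longrightarrow> pib k I j u \<in> homog l"
  using df_homog[OF iota_homog[of u l k I j]] iota_homog[OF df_homog[of u l], of k I j]
  by (subst pib_cases) (auto intro!: F.subspace_add[OF homog_subspace] F.subspace_scale[OF homog_subspace])

lemma df_pib:
  assumes "u \<in> homog l"
  shows "df (pib k I j u) = pscale sc ((-1) ^ card I * psign (par j)) (pib k I j (df u))"
  by (simp add: pib_cases[OF assms] pib_cases[OF df_homog[OF assms]] df_add df_scale df_df iota.zero mult_ac)

lemma pib_image: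
  assumes "u \<in> homog l" "df u = 0"
  shows "pib k I j u \<in> df ` homog (l - 1)"
proof -
  have "pib k I j u = df (pscale sc ((-1) ^ card I) (iota k I j u))"
    by (simp add: pib_cases[OF assms(1)] assms(2) iota.zero df_scale)
  then show ?thesis
    using iota_homog[OF assms(1), of k I j] F.subspace_scale[OF homog_subspace] by blast
qed

lemma df_image_subspace: "F.subspace (df ` homog l)"
proof (rule F.subspaceI)
  show "0 \<in> df ` homog l"
    using F.subspace_0[OF homog_subspace] df.zero by (metis imageI)
  show "u + v \<in> df ` homog l" if "u \<in> df ` homog l" "v \<in> df ` homog l" for u v
    using that F.subspace_add[OF homog_subspace] by (auto simp: df_add[symmetric])
  show "pscale sc c u \<in> df ` homog l" if "u \<in> df ` homog l" for c u
    using that F.subspace_scale[OF homog_subspace] by (auto simp: df_scale[symmetric])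
qed

lemma pia_subspace:
  assumes "F.subspace U" "\<And>k I j. pib k I j u \<in> U"
  shows "pia x u \<in> U"
  unfolding pi_act_def using assms by (auto intro!: F.subspace_sum F.subspace_scale)

lemma pia_homog: "u \<in> homog l \<Longrightarrow> pia x u \<in> homog l"
  by (rule pia_subspace[OF homog_subspace]) (rule pib_homog)

lemma pia_image: "u \<in> homog l \<Longrightarrow> df u = 0 \<Longrightarrow> pia x u \<in> df ` homog (l - 1)"
  by (rule pia_subspace[OF df_image_subspace]) (rule pib_image)

lemma df_pia:
  assumes u: "u \<in> homog l" and x: "\<And>j. coefficient x j \<in> lpart (q + par j)"
  shows "df (pia x u) = pscale sc (psign q) (pia x (df u))"
proof -
  have "df (pscale sc (coef (coefficient x j) (k, I)) (pib k I j u)) =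
      pscale sc (psign q) (pscale sc (coef (coefficient x j) (k, I)) (pib k I j (df u)))"
    if "(k, I) \<in> supp (coefficient x j)" for j k I
  proof -
    \<comment> \<open>Every term t^k \<xi>_I \<partial>_j of a field of parity \<open>q\<close>
      satisfies |I| + |\<partial>_j| = q, so the signs of \<open>df_pib\<close> are the same for all
      terms.\<close>
    have "of_nat (card I) = q + par j"
      using x[of j] that by (auto simp: lpart_iff in_keys_iff)
    then have "(-1) ^ card I * psign (par j) = psign q"
      by (simp add: psign_of_nat[symmetric] psign_add)
    then show ?thesis
      by (simp add: df_scale df_pib[OF u] mult_ac)
  qed
  then show ?thesis
    unfolding pi_act_def df.sum F.scale_sum_right by (intro sum.cong) auto
qed

lemma pia_field: "pia (lmult (mon k I) \<circ> partial j) u = pib k I j u"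
proof -
  have "coefficient (lmult (mon k I) \<circ> partial j) = (\<lambda>i. if i = j then mon k I else 0)"
    unfolding superderivation_single[symmetric] by (simp add: fun_eq_iff)
  moreover have "(\<Sum>(k', I')\<in>supp (if i = j then mon k I else 0).
      pscale sc (coef (if i = j then mon k I else 0) (k', I')) (pib k' I' i u)) = (if i = j then pib k I i u else 0)" for i
    by (auto simp: mon_def)
  ultimately show ?thesis
    by (simp add: pi_act_def)
qed

lemma pia_partial: "pia (partial j) u = pib 0 {} j u"
proof -
  have "lmult (mon 0 {}) \<circ> partial j = partial j"
    by (simp add: fun_eq_iff)
  then show ?thesis
    using pia_field[of 0 "{}" j u] by simp
qed

lemma pib_partial: "pib 0 {} j (single m p) = single m (dd j p)"
proof -
  obtain \<alpha> e where m: "m = (\<alpha>, e)" by (metis surj_pair)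
  have "dxi s (mon 0 {}) = 0" for s :: 'n by (simp add: mon_def)
  then show ?thesis
    by (cases j) (simp_all add: m pib_None_single pib_Some_single del: fun_upd_apply cong: if_cong)
qed

section \<open>The action on the volume form\<close>

lemma pib_omega:
  "pib k I None (single omega p) = single omega (mm k I (dd None p) + mult (ddt (mon k I)) p)"
  "pib k I (Some i) (single omega p) = single omega (mm k I (dd (Some i) p) + mult (dxi i (linvol (mon k I))) p)"
proof -
  show "pib k I None (single omega p) = single omega (mm k I (dd None p) + mult (ddt (mon k I)) p)"
    by (simp add: pib_None_single ddt_mon mult_scale single_add)
  show "pib k I (Some i) (single omega p) = single omega (mm k I (dd (Some i) p) + mult (dxi i (linvol (mon k I))) p)"
    unfolding pib_Some_single
    by (simp add: linvol_mon dxi_scale mult_scale single_add single_uminus low_up del: fun_upd_apply cong: if_cong)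
qed

lemma mult_expand:
  assumes add: "\<And>f g. D (f + g) = D f + D g" and scale: "\<And>c f. D (pscale (*) c f) = pscale (*) c (D f)"
  shows "mult (D f) p = (\<Sum>(k, I)\<in>supp f. sc (coef f (k, I)) (mult (D (mon k I)) p))"
proof -
  interpret Modules.additive "\<lambda>f. mult (D f) p"
    by unfold_locales (simp add: add mult_add)
  have "mult (D f) p = (\<Sum>m\<in>supp f. mult (D (single m (coef f m))) p)"
    by (subst sum_singles[symmetric], subst sum) simp
  also have "\<dots> = (\<Sum>(k, I)\<in>supp f. sc (coef f (k, I)) (mult (D (mon k I)) p))"
  proof (rule sum.cong)
    fix m assume "m \<in> supp f"
    obtain k I where m: "m = (k, I)" by (metis surj_pair)
    have "single m (coef f m) = pscale (*) (coef f m) (mon k I)"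
      by (simp add: mon_def m)
    then have "mult (D (single m (coef f m))) p = sc (coef f m) (mult (D (mon k I)) p)"
      by (simp add: scale mult_scale)
    then show "mult (D (single m (coef f m))) p = (case m of (k, I) \<Rightarrow> sc (coef f (k, I)) (mult (D (mon k I)) p))"
      by (simp add: m)
  qed simp
  finally show ?thesis .
qed

lemma ddt_scale: "ddt (pscale (*) c f) = pscale (*) c (ddt f)"
  by (rule additive_ext[where f = f]) (auto simp: ddt_add pscale_mult_add mult_ac)

lemma linvol_scale: "linvol (pscale (*) c f) = pscale (*) c (linvol f)"
  by (rule poly_mapping_eqI) (simp add: linvol_coef split_paired_all)

text \<open>The multiplications that \<open>pib_omega\<close> adds to the field sum up to its
  superdivergence, which is zero. This identifies P \<otimes> \<open>omega\<close> with the
  restriction of P.\<close>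

lemma pia_omega:
  assumes "x \<in> S_alg"
  shows "pia x (single omega p) = single omega (r x p)"
proof -
  obtain f where f: "x = superderivation f" "superdivergence f = 0"
    using assms by (auto simp: S_alg_def)
  define D where "D j = (case j of None \<Rightarrow> ddt | Some i \<Rightarrow> dxi i \<circ> linvol)" for j :: "'n option"
  have D: "D j (g + h) = D j g + D j h" for j g h
    by (cases j) (simp_all add: D_def ddt_add dxi_add linvol_add)
  have D': "D j (pscale (*) c g) = pscale (*) c (D j g)" for j g c
    by (cases j) (simp_all add: D_def ddt_scale dxi_scale linvol_scale)
  have pib: "pib k I j (single omega p) = single omega (mm k I (dd j p) + mult (D j (mon k I)) p)" for k I j
    by (cases j) (simp_all add: D_def pib_omega)
  have single_sum: "(\<Sum>a\<in>A. single omega (h a)) = single omega (sum h A :: 'p)" for h and A :: "'z set"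
    by (induction A rule: infinite_finite_induct) (simp_all add: single_add)
  have "pia x (single omega p) = single omega (\<Sum>j\<in>UNIV. \<Sum>(k, I)\<in>supp (f j).
      sc (coef (f j) (k, I)) (mm k I (dd j p) + mult (D j (mon k I)) p))"
    unfolding pi_act_def f coefficient_superderivation pib
    by (simp add: single_sum case_prod_beta)
  also have "(\<Sum>j\<in>UNIV. \<Sum>(k, I)\<in>supp (f j). sc (coef (f j) (k, I)) (mm k I (dd j p) + mult (D j (mon k I)) p)) =
      (\<Sum>j\<in>UNIV. mult (f j) (dd j p) + mult (D j (f j)) p)"
  proof (rule sum.cong)
    fix j
    have "mult (f j) (dd j p) = (\<Sum>(k, I)\<in>supp (f j). sc (coef (f j) (k, I)) (mm k I (dd j p)))"
      by (rule mult_expand) simp_all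
    moreover have "mult (D j (f j)) p = (\<Sum>(k, I)\<in>supp (f j). sc (coef (f j) (k, I)) (mult (D j (mon k I)) p))"
      by (rule mult_expand[OF D D'])
    ultimately show "(\<Sum>(k, I)\<in>supp (f j). sc (coef (f j) (k, I)) (mm k I (dd j p) + mult (D j (mon k I)) p)) =
        mult (f j) (dd j p) + mult (D j (f j)) p"
      by (simp only: case_prod_unfold scale_right_distrib sum.distrib)
  qed simp
  also have "\<dots> = (\<Sum>j\<in>UNIV. mult (f j) (dd j p)) + (\<Sum>j\<in>UNIV. mult (D j (f j)) p)"
    by (rule sum.distrib)
  also have "(\<Sum>j\<in>UNIV. mult (D j (f j)) p) = mult (\<Sum>j\<in>UNIV. D j (f j)) p"
  proof -
    interpret Modules.additive "\<lambda>f. mult f p" by unfold_locales (rule mult_add)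
    show ?thesis by (simp add: sum)
  qed
  also have "(\<Sum>j\<in>UNIV. D j (f j)) = superdivergence f"
    by (simp add: UNIV_option_sum D_def superdivergence_def)
  also have "(\<Sum>j\<in>UNIV. mult (f j) (dd j p)) = r x p"
    unfolding f superderivation_alt
    by (simp add: r_op_sum r_comp K_alg.comp K_alg.partial lmult_K_alg)
  finally show ?thesis
    unfolding f(2) mult_zero add_0_right .
qed

end

context K_mod
begin

subsection \<open>Coordinates on \<open>P \<otimes> N(-1)\<close>\<close>

definition vec :: "('n option \<Rightarrow> 'p) \<Rightarrow> ('n amon \<Rightarrow>\<^sub>0 'p)" where
  "vec p = (\<Sum>c\<in>UNIV. single (wk c) (p c))"

lemma coef_vec [simp]: "coef (vec p) (wk c) = p c"
  by (simp add: vec_def lookup_sum lookup_single when_def)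

lemma vec_homog: "vec p \<in> H0"
  unfolding vec_def by (intro F.subspace_sum homog_subspace homog_single negative_wk mdeg_wk)

lemma vec_coef:
  assumes "u \<in> H0"
  shows "u = vec (\<lambda>c. coef u (wk c))"
proof (rule poly_mapping_eqI)
  fix m
  show "coef u m = coef (vec (\<lambda>c. coef u (wk c))) m"
  proof (cases "\<exists>c. m = wk c")
    case False
    then have "\<not> (negative m \<and> mdeg m = - int CARD('n))"
      using key_mid by metis
    then show ?thesis
      using assms vec_homog[of "\<lambda>c. coef u (wk c)"] unfolding homog_iff by metis
  qed auto
qed

lemma vec_zero: "vec (\<lambda>_. 0) = 0"
  by (simp add: vec_def)

lemma vec_single: "single (wk d) q = vec (\<lambda>c. if c = d then q else 0)"
proof -
  have "vec (\<lambda>c. if c = d then q else 0) = (\<Sum>c\<in>UNIV. if c = d then single (wk d) q else 0)"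
    unfolding vec_def by (rule sum.cong) auto
  then show ?thesis by simp
qed

lemma sum_single: "(\<Sum>a\<in>A. single m (h a)) = single m (sum h A)"
  by (induction A rule: infinite_finite_induct) (simp_all add: single_add)

text \<open>Up to signs, the derivative of t^k \<xi>_J along the vector field with components
  \<open>p\<close>, as in the second half of a Lie bracket with t^k \<xi>_J \<partial>_i. It does
  not depend on \<open>i\<close> and enters only the component at
  \<open>wk (Some i)\<close>.\<close>

definition Gamma :: "int \<Rightarrow> 'n set \<Rightarrow> ('n option \<Rightarrow> 'p) \<Rightarrow> 'p" where
  "Gamma k J p = sc (- of_int k) (mm (k - 1) J (tau (p None)))
    + (\<Sum>j\<in>UNIV. sc ((-1) ^ card J) (mult (dxi j (mon k J)) (p (Some j))))"

lemma pib_odd_single: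
  assumes "i \<notin> J"
  shows "pib k J (Some i) (single (wk None) q) =
      single (wk None) (mm k J (dd (Some i) q)) + single (wk (Some i)) (sc (- of_int k) (mm (k - 1) J (tau q)))"
    and "pib k J (Some i) (single (wk (Some j)) q) =
      single (wk (Some j)) (mm k J (dd (Some i) q)) + single (wk (Some i)) (sc ((-1) ^ card J) (mult (dxi j (mon k J)) q))"
proof -
  have 0: "dxi i (mon k J) = 0"
    using assms by (simp add: mon_def)
  show "pib k J (Some i) (single (wk None) q) =
      single (wk None) (mm k J (dd (Some i) q)) + single (wk (Some i)) (sc (- of_int k) (mm (k - 1) J (tau q)))"
    by (simp add: pib_Some_single 0 del: fun_upd_apply cong: if_cong)
  show "pib k J (Some i) (single (wk (Some j)) q) =
      single (wk (Some j)) (mm k J (dd (Some i) q)) + single (wk (Some i)) (sc ((-1) ^ card J) (mult (dxi j (mon k J)) q))"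
  proof (cases "i = j")
    case True
    have "((low i)(i := low i i - 1)) s + 1 < 0 \<longleftrightarrow> s = i" for s by simp
    then show ?thesis
      by (simp add: pib_Some_single True[symmetric] 0 del: fun_upd_apply cong: if_cong)
  next
    case False
    \<comment> \<open>Two exponents are below -1, but the term \<open>s = i\<close> drops out
      because the coefficient does not involve \<xi>_i.\<close>
    have *: "((low j)(i := low j i - 1)) s + 1 < 0 \<longleftrightarrow> s = i \<or> s = j" for s
      using False by auto
    have "(\<Sum>s\<in>UNIV. if ((low j)(i := low j i - 1)) s + 1 < 0
        then single ((low j)(i := low j i - 1, s := ((low j)(i := low j i - 1)) s + 1), 1 :: bit)
          (sc (of_int (low j i)) (mult (dxi s (mon k J)) q)) else 0) =
      (\<Sum>s\<in>UNIV. if s = j then single (low i, 1) (- mult (dxi j (mon k J)) q) else 0)"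
    proof (rule sum.cong)
      fix s
      have "(low j)(i := low j i - 1, j := ((low j)(i := low j i - 1)) j + 1) = low i" "low j i = - 1"
        using False by (auto simp: fun_eq_iff)
      then show "(if ((low j)(i := low j i - 1)) s + 1 < 0
        then single ((low j)(i := low j i - 1, s := ((low j)(i := low j i - 1)) s + 1), 1 :: bit)
          (sc (of_int (low j i)) (mult (dxi s (mon k J)) q)) else 0) =
        (if s = j then single (low i, 1) (- mult (dxi j (mon k J)) q) else 0)"
        unfolding * using 0 by (auto simp del: fun_upd_apply)
    qed simp
    then show ?thesis
      by (simp add: pib_Some_single single_uminus del: fun_upd_apply)
  qed
qed

lemma pib_odd_vec:
  assumes "i \<notin> J"
  shows "pib k J (Some i) (vec p) = vec (\<lambda>c. mm k J (dd (Some i) (p c))) + single (wk (Some i)) (Gamma k J p)"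
proof -
  interpret Modules.additive "pib k J (Some i)" by unfold_locales (rule pib_add)
  have "pib k J (Some i) (vec p) = (\<Sum>c\<in>UNIV. pib k J (Some i) (single (wk c) (p c)))"
    by (simp add: vec_def sum)
  also have "\<dots> = vec (\<lambda>c. mm k J (dd (Some i) (p c))) + single (wk (Some i)) (Gamma k J p)"
    unfolding UNIV_option_sum vec_def Gamma_def single_add sum_single[symmetric]
    by (simp only: pib_odd_single[OF assms] sum.distrib) (simp only: ac_simps)
  finally show ?thesis .
qed

lemma pib_ddt_single:
  "pib 0 {j} None (single (wk None) q) = single (wk None) (mm 0 {j} (dd None q))"
  "pib 0 {j} None (single (wk (Some i)) q) = single (wk (Some i)) (mm 0 {j} (dd None q))
    + (if i = j then single (wk None) (tau q) else 0)"
proof -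
  show "pib 0 {j} None (single (wk None) q) = single (wk None) (mm 0 {j} (dd None q))"
    by (simp add: pib_None_single)
  have "i \<noteq> j \<Longrightarrow> dxi i (mon 0 {j}) = 0"
    by (simp add: mon_def)
  then show "pib 0 {j} None (single (wk (Some i)) q) = single (wk (Some i)) (mm 0 {j} (dd None q))
    + (if i = j then single (wk None) (tau q) else 0)"
    by (simp add: pib_None_single low_up del: fun_upd_apply cong: if_cong)
qed

lemma pib_ddt_vec:
  "pib 0 {j} None (vec p) = vec (\<lambda>c. mm 0 {j} (dd None (p c))) + single (wk None) (tau (p (Some j)))"
proof -
  interpret Modules.additive "pib 0 {j} None" by unfold_locales (rule pib_add)
  have "pib 0 {j} None (vec p) = (\<Sum>c\<in>UNIV. pib 0 {j} None (single (wk c) (p c)))"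
    by (simp add: vec_def sum)
  also have "\<dots> = vec (\<lambda>c. mm 0 {j} (dd None (p c))) + single (wk None) (tau (p (Some j)))"
    unfolding UNIV_option_sum vec_def
    by (simp only: pib_ddt_single sum.distrib) (simp only: sum.delta finite UNIV_I if_True add.assoc)
  finally show ?thesis .
qed

lemma coef_wk_single: "coef (single (wk c) q) (wk d) = (if c = d then q else 0)"
  by (simp add: lookup_single when_def)

text \<open>Up to sign, \<open>a\<close>, \<open>b\<close> and \<open>c\<close> are the images under
  diff of P tensored with the three kinds of monomials in degree -1 - n that \<open>key_bot\<close>
  yields.\<close>

lemma df_image_minimal:
  assumes U: "F.subspace U"
    and a: "\<And>i p. single (wk (Some i)) (dd (Some i) p) \<in> U"
    and b: "\<And>i j p. i \<noteq> j \<Longrightarrow> single (wk (Some i)) (dd (Some j) p) + single (wk (Some j)) (dd (Some i) p) \<in> U"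
    and c: "\<And>i p. single (wk (Some i)) (dd None (tau p)) - single (wk None) (dd (Some i) p) \<in> U"
  shows "df ` H1 \<subseteq> U"
proof
  fix v assume "v \<in> df ` H1"
  then obtain u where u: "u \<in> H1" "v = df u" by auto
  have "df (single m p) \<in> U" if "negative m" "mdeg m = - 1 - int CARD('n)" for m p
  proof (rule key_bot[OF that])
    fix i assume "m = (low i, 0)"
    then show "df (single m p) \<in> U"
      using c[of i p] by (simp add: df_single low_up del: fun_upd_apply cong: if_cong)
  next
    fix i j assume m: "m = ((low i)(j := low i j - 1), 1)"
    show "df (single m p) \<in> U"
    proof (cases "i = j")
      case True
      have *: "((low j)(j := low j j - 1)) s + 1 < 0 \<longleftrightarrow> s = j" for s by simp
      have **: "(low j)(j := low j j - 1, j := ((low j)(j := low j j - 1)) j + 1) = low j" by auto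
      show ?thesis
        unfolding m True df_single sum_if_single[of "\<lambda>s. ((low j)(j := low j j - 1)) s + 1 < 0", OF *] **
        using F.subspace_neg[OF U a[of j p]] by simp
    next
      case False
      have "(\<Sum>s\<in>UNIV. if ((low i)(j := low i j - 1)) s + 1 < 0
          then single ((low i)(j := low i j - 1, s := ((low i)(j := low i j - 1)) s + 1), 1 :: bit) (dd (Some s) p) else 0) =
        (\<Sum>s\<in>UNIV. (if s = i then single (low j, 1) (dd (Some i) p) else 0) + (if s = j then single (low i, 1) (dd (Some j) p) else 0))"
      proof (rule sum.cong)
        fix s
        have *: "((low i)(j := low i j - 1)) s + 1 < 0 \<longleftrightarrow> s = i \<or> s = j"
          using False by auto
        have "(low i)(j := low i j - 1, i := ((low i)(j := low i j - 1)) i + 1) = low j"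
          "(low i)(j := low i j - 1, j := ((low i)(j := low i j - 1)) j + 1) = low i"
          using False by (auto simp: fun_eq_iff)
        then show "(if ((low i)(j := low i j - 1)) s + 1 < 0
          then single ((low i)(j := low i j - 1, s := ((low i)(j := low i j - 1)) s + 1), 1 :: bit) (dd (Some s) p) else 0) =
          (if s = i then single (low j, 1) (dd (Some i) p) else 0) + (if s = j then single (low i, 1) (dd (Some j) p) else 0)"
          unfolding * using False by (auto simp del: fun_upd_apply)
      qed simp
      then have "df (single m p) = - (single (wk (Some i)) (dd (Some j) p) + single (wk (Some j)) (dd (Some i) p))"
        unfolding m df_single by (simp add: sum.distrib del: fun_upd_apply)
      then show ?thesis
        using F.subspace_neg[OF U b[OF False, of p]] by simp
    qed
  qed
  then have "(\<Sum>m\<in>supp u. df (single m (coef u m))) \<in> U"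
    using u by (intro F.subspace_sum[OF U]) (auto simp: homog_def)
  then show "v \<in> U"
    unfolding u df.sum[symmetric] sum_singles .
qed

end

context simple_K_mod
begin

subsection \<open>The smallest nonzero submodule\<close>

text \<open>\<open>Xs i\<close> describes the elements of \<open>U\<close> concentrated at
  \<open>wk (Some i)\<close> by a subspace of P, to which the spreading argument applies. The
  component of a vector at \<open>wk (Some i)\<close> itself drops out of the products that lead
  there; hence the condition \<open>c \<noteq> Some i\<close> in \<open>spread\<close>, and the
  separate argument that a suitable component exists.\<close>

lemma df_image_smallest:
  assumes U: "F.subspace U" "\<And>u. u \<in> U \<Longrightarrow> FV.tau u \<in> U" "\<And>x u. x \<in> S'_alg \<Longrightarrow> u \<in> U \<Longrightarrow> pia x u \<in> U"
    and "U \<subseteq> H0" "U \<noteq> {0}"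
  shows "df ` H1 \<subseteq> U"
proof -
  define Xs where "Xs i = {z. single (wk (Some i)) z \<in> U}" for i
  have Xs_sub: "subspace (Xs i)" for i
  proof (rule subspaceI)
    show "0 \<in> Xs i"
      using F.subspace_0[OF U(1)] by (simp add: Xs_def)
    show "v + w \<in> Xs i" if "v \<in> Xs i" "w \<in> Xs i" for v w
      using that F.subspace_add[OF U(1)] by (simp add: Xs_def single_add)
    show "sc c v \<in> Xs i" if "v \<in> Xs i" for c v
      using that F.subspace_scale[OF U(1), of _ c] by (fastforce simp: Xs_def simp flip: pscale_single)
  qed
  have Xs_dd: "dd j z \<in> Xs i" if "z \<in> Xs i" for i j z
    using U(3)[OF S'_alg_partial[OF n, of j], of "single (wk (Some i)) z"] that
    by (simp add: Xs_def pia_partial pib_partial del: wk.simps)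
  have Xs_tau: "tau z \<in> Xs i" if "z \<in> Xs i" for i z
    using F.subspace_neg[OF U(1) U(2)[of "single (wk (Some i)) z"]] that
    by (simp add: Xs_def FV_tau_single single_uminus)
  have double: "z \<in> Xs i" if "z + z \<in> Xs i" for z i
  proof -
    have "sc (1/2) (z + z) \<in> Xs i"
      using that Xs_sub by (rule subspace_scale[rotated])
    moreover have "sc (1/2) (z + z) = z"
    proof -
      have "z + z = sc 2 z"
        by (metis one_add_one scale_left_distrib scale_one)
      then show ?thesis by simp
    qed
    ultimately show ?thesis by simp
  qed
  have field: "pib k J (Some i) u \<in> U" if "u \<in> U" "i \<notin> J" for i k J u
    using U(3)[OF S'_alg_lmult_dxi[OF n that(2), of k] that(1)] pia_field[of k J "Some i" u]
    by (simp add: partial.simps)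
  have xi_ddt: "pib 0 {j} None u \<in> U" if "u \<in> U" for j u
    using U(3)[OF S'_alg_xi_ddt[OF n, of j] that] pia_field[of 0 "{j}" None u]
    by (simp add: partial.simps)
  have U_vec: "u = vec (\<lambda>c. coef u (wk c))" if "u \<in> U" for u
    using that \<open>U \<subseteq> H0\<close> by (intro vec_coef) auto

  \<comment> \<open>The product of two odd fields along \<open>\<partial>_i\<close> kills every component except the one at \<open>wk (Some i)\<close>.\<close>
  have two: "Gamma k J (\<lambda>c. mm l L (dd (Some i) (p c))) + mm k J (dd (Some i) (Gamma l L p)) \<in> Xs i"
    if "vec p \<in> U" "i \<notin> J" "i \<notin> L" for p i k J l L
  proof -
    have 0: "dxi i (mon k J) = 0" "dxi i (mon l L) = 0"
      using that by (simp_all add: mon_def)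
    have "dd (Some i) (mm l L (dd (Some i) z)) = 0" for z
      by (simp add: dxi_mm 0 dd_square r_lin)
    then have "pib k J (Some i) (vec (\<lambda>c. mm l L (dd (Some i) (p c)))) =
        single (wk (Some i)) (Gamma k J (\<lambda>c. mm l L (dd (Some i) (p c))))"
      by (simp add: pib_odd_vec[OF that(2)] r_lin vec_zero del: wk.simps)
    moreover have "pib k J (Some i) (single (wk (Some i)) z) = single (wk (Some i)) (mm k J (dd (Some i) z))" for z
      by (simp add: pib_odd_single(2)[OF that(2)] 0 del: wk.simps)
    ultimately have "pib k J (Some i) (pib l L (Some i) (vec p)) = single (wk (Some i))
        (Gamma k J (\<lambda>c. mm l L (dd (Some i) (p c))) + mm k J (dd (Some i) (Gamma l L p)))"
      by (simp add: pib_odd_vec[OF that(3)] pib_add single_add del: wk.simps)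
    then show ?thesis
      using field[OF field[OF that(1,3)] that(2), of k l] by (simp add: Xs_def del: wk.simps)
  qed

  have field_None: "mm k J (dd (Some i) (tau (p None))) \<in> Xs i"
    and field_sum: "(\<Sum>j\<in>UNIV. mult (dxi j (mon k J)) (dd (Some i) (p (Some j)))) \<in> Xs i"
    if "vec p \<in> U" "i \<notin> J" for p i k J
  proof -
    define S where "S k = (\<Sum>j\<in>UNIV. sc ((-1) ^ card J) (mult (dxi j (mon k J)) (dd (Some i) (p (Some j)))))" for k
    \<comment> \<open>The product of t^k \<xi>_J \<partial>_i and t^l \<partial>_i depends on
      \<open>k - l\<close> only through the coefficient of the component at d/dt, and otherwise on
      \<open>k + l\<close>.\<close>
    have Y: "sc (of_int (k - l)) (mm (k + l - 1) J (dd (Some i) (tau (p None)))) + S (k + l) \<in> Xs i" for k l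
    proof -
      have 1: "tau (mm l {} (dd (Some i) (p None))) = - mm l {} (dd (Some i) (tau (p None)))"
        by (simp add: twist_mm twist_dd r_lin)
      have "lmult (dxi j (mon k J)) (mon l {}) = dxi j (mon (k + l) J)" for j
        by (simp add: mon_def)
      then have 2: "mult (dxi j (mon k J)) (mm l {} z) = mult (dxi j (mon (k + l) J)) z" for j z
        by (simp add: mult_mult)
      have 3: "dxi j (mon l {}) = 0" for j l
        by (simp add: mon_def)
      have 4: "dd (Some i) (mm (l - 1) {} z) = mm (l - 1) {} (dd (Some i) z)" for z
        by (simp add: dxi_mm 3)
      have 5: "k - 1 + l = k + l - 1" "k + (l - 1) = k + l - 1"
        by simp_all
      have 6: "mm (k - 1) J (mm l {} z) = mm (k + l - 1) J z" for z
        by (simp add: mm_mm 5)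
      have "Gamma k J (\<lambda>c. mm l {} (dd (Some i) (p c))) =
          sc (of_int k) (mm (k + l - 1) J (dd (Some i) (tau (p None)))) + S (k + l)"
        by (simp add: Gamma_def S_def 1 r_lin 2 6)
      moreover have "mm k J (dd (Some i) (Gamma l {} p)) = - sc (of_int l) (mm (k + l - 1) J (dd (Some i) (tau (p None))))"
        by (simp add: Gamma_def 3 r_lin 4 mm_mm 5)
      ultimately show ?thesis
        using two[OF that, of "{}" k l] by (simp add: scale_left_diff_distrib algebra_simps)
    qed
    have None': "mm (k - 1) J (dd (Some i) (tau (p None))) \<in> Xs i" for k
    proof -
      \<comment> \<open>The pairs (k + 1, -1) and (k, 0) have the same sum, so \<open>S\<close>
        cancels; their differences k + 2 and k leave the factor 2.\<close>
      have "(sc (of_int (k + 1 - - 1)) (mm (k + 1 + - 1 - 1) J (dd (Some i) (tau (p None)))) + S (k + 1 + - 1))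
          - (sc (of_int (k - 0)) (mm (k + 0 - 1) J (dd (Some i) (tau (p None)))) + S (k + 0)) \<in> Xs i"
        by (intro subspace_diff Xs_sub Y)
      then have "sc 2 (mm (k - 1) J (dd (Some i) (tau (p None)))) \<in> Xs i"
        by (simp add: scale_left_distrib algebra_simps)
      from subspace_scale[OF Xs_sub this, of "1 / 2"] show ?thesis by simp
    qed
    show None'': "mm k J (dd (Some i) (tau (p None))) \<in> Xs i"
      using None'[of "k + 1"] by simp
    have "S k \<in> Xs i"
      using subspace_diff[OF Xs_sub Y[of k 0] subspace_scale[OF Xs_sub None'[of k], of "of_int k"]] by simp
    then have "sc ((-1) ^ card J) (S k) \<in> Xs i"
      by (rule subspace_scale[OF Xs_sub])
    then show "(\<Sum>j\<in>UNIV. mult (dxi j (mon k J)) (dd (Some i) (p (Some j)))) \<in> Xs i"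
      by (simp add: S_def scale_sum_right[symmetric])
  qed

  have field_Some: "mm k J (dd (Some i) (p (Some j))) \<in> Xs i" if "vec p \<in> U" "i \<notin> J" "j \<noteq> i" for p i j k J
  proof -
    define y where "y = mm k J (dd (Some i) (p (Some j)))"
    define s where "s = ((-1) ^ card J :: complex)"
    \<comment> \<open>Two memberships in \<open>Xs i\<close> are compared. The product with the
      field \<xi>_j \<partial>_i gives s T - y, and \<open>field_sum\<close> for
      \<open>J \<union> {j}\<close>, expanded by the Leibniz rule, gives T + s y. As s is a sign,
      the second times s minus the first is 2 y.\<close>
    define T where "T = (\<Sum>m\<in>UNIV. mult (lmult (dxi m (mon k J)) (mon 0 {j})) (dd (Some i) (p (Some m))))"
    have dj: "dxi m (mon 0 {j}) = (if m = j then mon 0 {} else 0)" for m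
    proof (cases "m = j")
      case False
      then show ?thesis by (simp add: mon_def)
    qed simp
    have "i \<notin> {j}" using that(3) by simp
    have G: "Gamma 0 {j} p = - p (Some j)"
      by (simp add: Gamma_def dj if_distrib[of "\<lambda>f. mult f _"] if_distrib[of "sc _"] sum_negf cong: if_cong)
    have 1: "tau (mm 0 {j} (dd (Some i) (p None))) = mm 0 {j} (dd (Some i) (tau (p None)))"
      by (simp add: twist_mm twist_dd r_lin)
    have "Gamma k J (\<lambda>c. mm 0 {j} (dd (Some i) (p c))) =
        sc (- of_int k * xi_sign J {j}) (mm (k - 1) (J \<union> {j}) (dd (Some i) (tau (p None)))) + sc s T"
      by (simp add: Gamma_def 1 mm_mm T_def mult_mult[symmetric] s_def scale_sum_right)
    moreover have "mm k J (dd (Some i) (Gamma 0 {j} p)) = - y"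
      by (simp add: G r_lin y_def)
    ultimately have "sc (- of_int k * xi_sign J {j}) (mm (k - 1) (J \<union> {j}) (dd (Some i) (tau (p None)))) + sc s T - y \<in> Xs i"
      using two[OF that(1,2) \<open>i \<notin> {j}\<close>, of k 0] by simp
    moreover have "sc (- of_int k * xi_sign J {j}) (mm (k - 1) (J \<union> {j}) (dd (Some i) (tau (p None)))) \<in> Xs i"
      using that by (intro subspace_scale Xs_sub field_None) auto
    ultimately have a: "sc s T - y \<in> Xs i"
      using subspace_diff[OF Xs_sub] by (metis add_diff_cancel_left' add_diff_eq)
    have "sc (xi_sign J {j}) (\<Sum>m\<in>UNIV. mult (dxi m (mon k (J \<union> {j}))) (dd (Some i) (p (Some m)))) \<in> Xs i"
      using that by (intro subspace_scale Xs_sub field_sum) auto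
    also have "sc (xi_sign J {j}) (\<Sum>m\<in>UNIV. mult (dxi m (mon k (J \<union> {j}))) (dd (Some i) (p (Some m)))) =
        (\<Sum>m\<in>UNIV. mult (dxi m (lmult (mon k J) (mon 0 {j}))) (dd (Some i) (p (Some m))))"
    proof -
      have "lmult (mon k J) (mon 0 {j}) = pscale (*) (xi_sign J {j}) (mon k (J \<union> {j}))"
        by (simp add: mon_def)
      then show ?thesis
        by (simp add: dxi_scale mult_scale scale_sum_right)
    qed
    also have "\<dots> = T + sc s y"
      by (simp add: dxi_lmult dj linvol_mon lmult_scale_left mult_add T_def sum.distrib if_distrib[of "lmult _"]
          if_distrib[of "\<lambda>f. mult f _"] mult_scale s_def y_def if_distrib[of "pscale _ _"] cong: if_cong)
    finally have "sc s (T + sc s y) \<in> Xs i"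
      by (rule subspace_scale[OF Xs_sub])
    then have "sc s T + y \<in> Xs i"
      by (simp add: scale_right_distrib s_def)
    from subspace_diff[OF Xs_sub this a] have "y + y \<in> Xs i"
      by simp
    then show ?thesis
      unfolding y_def[symmetric] by (rule double)
  qed

  have spread: "dd (Some i) z \<in> Xs i" if asm: "vec p \<in> U" "c \<noteq> Some i" "dd (Some i) (p c) \<noteq> 0" for p c i z
  proof -
    \<comment> \<open>The vector is \<partial>_i applied to the chosen component, after
      \<open>tau\<close> in the case of d/dt. It is killed by \<partial>_i, which is what
      \<open>dd_mm_kernel\<close> asks for.\<close>
    obtain q where q: "q \<noteq> 0" "dd (Some i) q = 0" "\<And>k J. i \<notin> J \<Longrightarrow> mm k J q \<in> Xs i"
    proof (cases c)
      case None
      have "dd (Some i) (tau (p None)) \<noteq> 0"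
      proof
        assume "dd (Some i) (tau (p None)) = 0"
        then have "tau (dd (Some i) (p None)) = 0"
          by (simp add: twist_dd)
        then have "tau (tau (dd (Some i) (p None))) = 0"
          by (simp only: twist_lin)
        then show False
          using asm None by simp
      qed
      then show ?thesis
        using asm(1) field_None by (intro that[of "dd (Some i) (tau (p None))"]) (auto simp: dd_square)
    next
      case (Some j)
      then show ?thesis
        using asm field_Some by (intro that[of "dd (Some i) (p (Some j))"]) (auto simp: dd_square)
    qed
    show ?thesis
      by (rule dd_spread[OF Xs_sub Xs_dd Xs_tau dd_mm_kernel[OF Xs_sub q(2,3)] q(1)])
  qed

  have "\<exists>p c i. vec p \<in> U \<and> c \<noteq> Some i \<and> dd (Some i) (p c) \<noteq> 0"
  proof (rule ccontr)
    assume *: "\<not> ?thesis"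
    have none: "dd (Some i) (p c) = 0" if "vec p \<in> U" "c \<noteq> Some i" for p c i
      using * that by blast
    have none': "dd (Some i) (coef u (wk c)) = 0" if "u \<in> U" "c \<noteq> Some i" for u c i
      using none[of "\<lambda>c. coef u (wk c)" c i] U_vec[OF that(1)] that by simp
    \<comment> \<open>Probe with t^k \<xi>_j \<partial>_i for \<open>j \<noteq> i\<close>: the new
      component at \<open>wk (Some i)\<close> must be killed by \<partial>_j, which is an identity
      for each k. The case k = 0 equates \<partial>_i p_i and \<partial>_j p_j, and k = 1 then
      leaves only the component at d/dt.\<close>
    have p_None: "p None = 0" if "vec p \<in> U" for p
    proof -
      define i :: 'n where "i = undefined"
      obtain j where j: "j \<noteq> i"
        using exists_other[OF n] .
      have "i \<notin> {j}" using j by simp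
      have dj: "dxi m (mon k {j}) = (if m = j then mon k {} else 0)" for m k
      proof (cases "m = j")
        case False
        then show ?thesis by (simp add: mon_def)
      qed simp
      have G: "Gamma k {j} p = - sc (of_int k) (mm (k - 1) {j} (tau (p None))) - mm k {} (p (Some j))" for k
        by (simp add: Gamma_def dj if_distrib[of "\<lambda>f. mult f _"] if_distrib[of "sc _"] sum_negf cong: if_cong)
      have "coef (pib k {j} (Some i) (vec p)) (wk (Some i)) = mm k {j} (dd (Some i) (p (Some i))) + Gamma k {j} p" for k
        unfolding pib_odd_vec[OF \<open>i \<notin> {j}\<close>] lookup_add coef_vec coef_wk_single by simp
      moreover have "dd (Some j) (coef (pib k {j} (Some i) (vec p)) (wk (Some i))) = 0" for k
        using field[OF that \<open>i \<notin> {j}\<close>] j by (intro none') auto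
      ultimately have eq: "dd (Some j) (mm k {j} (dd (Some i) (p (Some i))) + Gamma k {j} p) = 0" for k
        by simp
      have d1: "dd (Some j) (dd (Some i) (p (Some i))) = 0"
        using none[OF that, of "Some i" j] j by (simp add: dd_dd_odd[of j i] r_lin)
      have d2: "dd (Some j) (tau (p None)) = 0"
        using none[OF that, of None j] twist_dd[of 1 "Some j" "p None"] by (simp add: twist_lin)
      have d3: "dd (Some j) (mm k {j} z) = mm k {} z" if "dd (Some j) z = 0" for k z
        by (simp add: dxi_mm that r_lin dj)
      have d4: "dd (Some j) (mm k {} z) = mm k {} (dd (Some j) z)" for k z
      proof -
        have "dxi j (mon k {}) = 0" by (simp add: mon_def)
        then show ?thesis by (simp add: dxi_mm)
      qed
      have eq': "mm k {} (dd (Some i) (p (Some i))) - sc (of_int k) (mm (k - 1) {} (tau (p None)))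
          - mm k {} (dd (Some j) (p (Some j))) = 0" for k
        using eq[of k] by (simp add: G r_lin d3[OF d1] d3[OF d2] d4 add_diff_eq)
      have "dd (Some i) (p (Some i)) = dd (Some j) (p (Some j))"
        using eq'[of 0] by simp
      then have "tau (p None) = 0"
        using eq'[of 1] by simp
      then have "tau (tau (p None)) = 0"
        by (simp only: twist_lin)
      then show ?thesis by simp
    qed
    \<comment> \<open>The field \<xi>_j d/dt moves this component, up to \<open>tau\<close>, to
      \<open>wk None\<close>, where all vectors of \<open>U\<close> are already known to
      vanish.\<close>
    have "p (Some j) = 0" if "vec p \<in> U" for p j
    proof -
      define u where "u = pib 0 {j} None (vec p)"
      have u: "u \<in> U" unfolding u_def by (rule xi_ddt[OF that])
      have "coef u (wk None) = 0"
        using p_None[of "\<lambda>c. coef u (wk c)"] U_vec[OF u] u by simp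
      then have "tau (p (Some j)) = 0"
        unfolding u_def pib_ddt_vec lookup_add coef_vec coef_wk_single by (simp add: p_None[OF that] r_lin)
      then have "tau (tau (p (Some j))) = 0"
        by (simp only: twist_lin)
      then show ?thesis by simp
    qed
    then have "p = (\<lambda>_. 0)" if "vec p \<in> U" for p
      using p_None that by (metis option.exhaust ext)
    then have "u = 0" if "u \<in> U" for u
      using U_vec[OF that] that vec_zero by metis
    then show False
      using \<open>U \<noteq> {0}\<close> F.subspace_0[OF U(1)] by auto
  qed
  then obtain i where i: "dd (Some i) z \<in> Xs i" for z
    using spread by blast
  \<comment> \<open>The elements of \<partial>_i P placed at \<open>wk (Some i)\<close> are vectors
    of \<open>U\<close> whose nonzero component is not the one at \<open>j\<close>, so
    \<open>spread\<close> applies with \<open>j\<close>.\<close>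
  have all: "dd (Some j) z \<in> Xs j" for j z
  proof (cases "j = i")
    case False
    then obtain p where "dd (Some j) (dd (Some i) p) \<noteq> 0"
      using dd_dd_nonzero by metis
    moreover have "vec (\<lambda>c. if c = Some i then dd (Some i) p else 0) \<in> U"
      using i[of p] by (simp add: Xs_def vec_single[symmetric] del: wk.simps)
    ultimately show ?thesis
      using spread[of "\<lambda>c. if c = Some i then dd (Some i) p else 0" "Some i" j] False by simp
  qed (simp add: i)
  have base: "single (wk (Some i)) (dd (Some i) z) \<in> U" for i z
    using all[of i z] by (simp add: Xs_def)
  show ?thesis
  proof (rule df_image_minimal[OF U(1) base])
    fix i j :: 'n and p assume "i \<noteq> j"
    then have "j \<notin> {i}" by simp
    \<comment> \<open>The field \<xi>_i \<partial>_j sends an element of \<partial>_i P at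
      \<open>wk (Some i)\<close> to minus the mixed generator, up to another element of \<partial>_i
      P at \<open>wk (Some i)\<close>.\<close>
    have "pib 0 {i} (Some j) (single (wk (Some i)) (dd (Some i) p)) =
        single (wk (Some i)) (mm 0 {i} (dd (Some j) (dd (Some i) p))) + single (wk (Some j)) (- dd (Some i) p)"
      unfolding pib_odd_single(2)[OF \<open>j \<notin> {i}\<close>] by simp
    moreover have "mm 0 {i} (dd (Some j) (dd (Some i) p)) = dd (Some i) (mm 0 {i} (dd (Some j) p)) - dd (Some j) p"
      by (simp add: dd_mm_self dd_dd_odd[of j i] r_lin)
    ultimately have "single (wk (Some i)) (dd (Some j) p) + single (wk (Some j)) (dd (Some i) p) =
        single (wk (Some i)) (dd (Some i) (mm 0 {i} (dd (Some j) p)))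
        - pib 0 {i} (Some j) (single (wk (Some i)) (dd (Some i) p))"
      by (simp add: single_diff single_uminus del: wk.simps)
    also have "\<dots> \<in> U"
      by (intro F.subspace_diff U(1) base field \<open>j \<notin> {i}\<close>)
    finally show "single (wk (Some i)) (dd (Some j) p) + single (wk (Some j)) (dd (Some i) p) \<in> U" .
  next
    fix i :: 'n and p
    \<comment> \<open>In the same way \<xi>_i d/dt produces the generators that involve the
      component at d/dt.\<close>
    have "pib 0 {i} None (single (wk (Some i)) (dd (Some i) (tau p))) =
        single (wk (Some i)) (mm 0 {i} (dd None (dd (Some i) (tau p)))) - single (wk None) (dd (Some i) p)"
      by (simp add: pib_ddt_single twist_dd single_uminus del: wk.simps)
    moreover have "mm 0 {i} (dd None (dd (Some i) (tau p))) = dd None (tau p) - dd (Some i) (mm 0 {i} (dd None (tau p)))"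
      using dd_dd[of None "Some i" "tau p"] by (simp add: dd_mm_self)
    ultimately have "single (wk (Some i)) (dd None (tau p)) - single (wk None) (dd (Some i) p) =
        single (wk (Some i)) (dd (Some i) (mm 0 {i} (dd None (tau p))))
        + pib 0 {i} None (single (wk (Some i)) (dd (Some i) (tau p)))"
      by (simp add: single_diff del: wk.simps)
    also have "\<dots> \<in> U"
      by (intro F.subspace_add U(1) base xi_ddt)
    finally show "single (wk (Some i)) (dd None (tau p)) - single (wk None) (dd (Some i) p) \<in> U" .
  qed
qed

end

section \<open>The natural module: invariants and simplicity\<close>

lemma mon_one_neq_zero: "pscale (*) c (mon 0 {}) = 0 \<longleftrightarrow> c = 0"
  by (auto simp: mon_def poly_mapping_eq_iff fun_eq_iff lookup_single when_def)

text \<open>By the diagonal operators t d/dt and \<xi>_i \<partial>_i, the coefficient at a monomial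
  killed by all derivations is annihilated by each of its exponents.\<close>

lemma constants_iff:
  "f \<in> constants \<longleftrightarrow> (\<forall>j. partial j (f :: 'n::{finite,linorder} laurent) = 0)"
proof
  assume "f \<in> constants"
  then obtain c where "f = pscale (*) c (mon 0 {})"
    by (auto simp: constants_def)
  then have "partial j f = 0" for j
    by (cases j) (simp_all add: mon_def partial.simps)
  then show "\<forall>j. partial j f = 0" ..
next
  assume *: "\<forall>j. partial j f = 0"
  have "of_int m * coef f (m, L) = 0" for m L
    using coef_t_ddt[of f m L] *[rule_format, of None] by (simp add: partial.simps)
  moreover have "of_bool (i \<in> L) * coef f (m, L) = 0" for i m L
    using coef_xi_dxi[of i f m L] *[rule_format, of "Some i"] by (simp add: partial.simps)
  ultimately have "coef f (m, L) = 0" if "(m, L) \<noteq> (0, {})" for m L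
    using that by (metis ex_in_conv mult_eq_0_iff of_bool_eq(2) of_int_eq_0_iff one_neq_zero)
  then have "f = pscale (*) (coef f (0, {})) (mon 0 {})"
    by (intro poly_mapping_eqI) (auto simp: mon_def lookup_single when_def split_paired_all)
  then show "f \<in> constants"
    unfolding constants_def by blast
qed

lemma simple_A_mod:
  "simple_module K_alg (supermodule_on (pscale (*)) lpart (\<lambda>x. x :: 'n::{finite,linorder} lop) UNIV)"
proof -
  interpret A: complex_space "pscale (*) :: complex \<Rightarrow> 'n laurent \<Rightarrow> _"
    by (simp add: complex_space_def vector_space_pscale_mult)
  have "U = {0} \<or> U = UNIV" if "graded_submodule K_alg (supermodule_on (pscale (*)) lpart (\<lambda>x. x) UNIV) U" for U :: "'n laurent set"
  proof (cases "U = {0}")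
    case False
    have U: "laurent.subspace U" "\<And>a f. a \<in> K_alg \<Longrightarrow> f \<in> U \<Longrightarrow> a f \<in> U"
      using that by (auto simp: A.graded_submodule_iff)
    have "mon 0 {} \<in> U"
      by (rule K_stable_contains_one[OF U(1) _ False]) (rule U(2))
    then have "lmult f (mon 0 {}) \<in> U" for f
      by (rule U(2)[OF lmult_K_alg])
    then show ?thesis by auto
  qed simp
  moreover have "UNIV \<noteq> {0 :: 'n laurent}"
    using mon_one_neq_zero[of 1] by (metis UNIV_I singletonD one_neq_zero)
  ultimately show ?thesis
    by (simp add: A.simple_module_iff)
qed

lemma simple_K_mod_laurent:
  assumes "CARD('n::{finite,linorder}) \<ge> 2"
  shows "simple_K_mod (pscale (*)) lpart (\<lambda>x. x :: 'n lop)"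
  using assms K_module_laurent simple_A_mod by (simp add: simple_K_mod_def simple_K_mod_axioms_def K_mod_def)

section \<open>The divergence map and the quotients of the filtration\<close>

context K_mod
begin

abbreviation Ft :: "('n amon \<Rightarrow>\<^sub>0 'p) set" where
  "Ft \<equiv> {u \<in> H0. df u = 0}"

lemma F_mod_eq:
  "F_mod sc V r (N_mod \<mu>) = supermodule_on (pscale sc) (F_part V) pia (homog (\<Sum>s\<in>UNIV. \<mu> s))"
  using carrier_F_mod[of V r \<mu>] by (simp add: F_mod_def)

lemma graded_submodule_F_iff:
  "graded_submodule L (supermodule_on (pscale sc) (F_part V) pia (homog k)) U \<longleftrightarrow>
    U \<subseteq> homog k \<and> F.subspace U \<and> (\<forall>u\<in>U. FV.tau u \<in> U) \<and> (\<forall>x\<in>L. \<forall>u\<in>U. pia x u \<in> U)"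
  by (simp add: F.graded_submodule_iff[OF homog_subspace] FV.graded_iff_tau cong: conj_cong)

lemma tau_df: "FV.tau (df u) = - df (FV.tau u)"
proof (rule additive_ext[where f = u])
  fix m :: "'n amon" and p :: 'p
  obtain \<alpha> e where m: "m = (\<alpha>, e)" by (metis surj_pair)
  have if_tau: "FV.tau (if b then v else 0) = (if b then FV.tau v else 0)" for b v
    by (simp add: FV.twist_lin)
  have "FV.tau (df (single m p)) = (if e = 0 then single (\<alpha>, 1) (- tau (dd None (tau p))) else 0)
    - (\<Sum>s\<in>UNIV. if \<alpha> s + 1 < 0 then single (\<alpha>(s := \<alpha> s + 1), e) (sc (psign e) (tau (dd (Some s) p))) else 0)"
    unfolding m df_single FV.twist_lin if_tau FV_tau_single by simp
  also have "\<dots> = - ((if e = 0 then single (\<alpha>, 1) (dd None (tau (sc (psign e) (tau p)))) else 0)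
    - (\<Sum>s\<in>UNIV. if \<alpha> s + 1 < 0 then single (\<alpha>(s := \<alpha> s + 1), e) (dd (Some s) (sc (psign e) (tau p))) else 0))"
  proof -
    have "single (\<alpha>(s := \<alpha> s + 1), e) (sc (psign e) (tau (dd (Some s) p))) =
        - single (\<alpha>(s := \<alpha> s + 1), e) (dd (Some s) (sc (psign e) (tau p)))" for s
      by (simp add: twist_dd r_lin single_uminus)
    then have "(\<Sum>s\<in>UNIV. if \<alpha> s + 1 < 0 then single (\<alpha>(s := \<alpha> s + 1), e) (sc (psign e) (tau (dd (Some s) p))) else 0) =
        - (\<Sum>s\<in>UNIV. if \<alpha> s + 1 < 0 then single (\<alpha>(s := \<alpha> s + 1), e) (dd (Some s) (sc (psign e) (tau p))) else 0)"
      unfolding sum_negf[symmetric] by (intro sum.cong) auto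
    then show ?thesis
      by (cases e) (simp_all add: twist_dd twist_lin r_lin single_uminus)
  qed
  also have "\<dots> = - df (FV.tau (single m p))"
    unfolding m FV_tau_single df_single ..
  finally show "FV.tau (df (single m p)) = - df (FV.tau (single m p))" .
qed (simp_all add: FV.twist_add df_add)

text \<open>diff maps \<open>H0\<close> to degree 1 - n, where \<open>omega\<close> is the only
  monomial, so this one coefficient determines its value.\<close>

definition dv :: "('n amon \<Rightarrow>\<^sub>0 'p) \<Rightarrow> 'p" where
  "dv u = coef (df u) omega"

lemma df_dv: "u \<in> H0 \<Longrightarrow> df u = single omega (dv u)"
proof (rule poly_mapping_eqI)
  fix m assume u: "u \<in> H0"
  show "coef (df u) m = coef (single omega (dv u)) m"
  proof (cases "m = omega")
    case False
    then have "\<not> (negative m \<and> mdeg m = - int CARD('n) + 1)"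
      using key_top[of m] by auto
    then have "coef (df u) m = 0"
      using df_homog[OF u] unfolding homog_iff by blast
    then show ?thesis
      using False by (simp add: lookup_single_not_eq)
  qed (simp add: dv_def)
qed

lemma dv_zero_iff: "u \<in> H0 \<Longrightarrow> dv u = 0 \<longleftrightarrow> df u = 0"
  by (metis df_dv dv_def lookup_zero single_zero)

lemma dv_add: "dv (u + v) = dv u + dv v"
  by (simp add: dv_def df_add lookup_add)

lemma dv_scale: "dv (pscale sc c u) = sc c (dv u)"
  by (simp add: dv_def df_scale)

sublocale dv: Modules.additive dv
  by unfold_locales (rule dv_add)

lemma dv_tau: "u \<in> H0 \<Longrightarrow> dv (FV.tau u) = tau (dv u)"
proof -
  assume u: "u \<in> H0"
  have "df (FV.tau u) = - FV.tau (df u)"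
    by (simp add: tau_df)
  also have "\<dots> = single omega (tau (dv u))"
    by (simp add: df_dv[OF u] FV_tau_single single_uminus)
  finally show ?thesis by (simp add: dv_def)
qed

lemma dv_pia:
  assumes "u \<in> H0" "x \<in> homogeneous S'_alg q"
  shows "dv (pia x u) = sc (psign q) (r x (dv u))"
proof -
  have x: "x \<in> S_alg" "\<And>q'. x ` lpart q' \<subseteq> lpart (q + q')"
    using assms S'_alg_subset_S_alg by (auto simp: homogeneous_def)
  have "df (pia x u) = pscale sc (psign q) (single omega (r x (dv u)))"
    by (simp add: df_pia[OF assms(1) coefficient_homogeneous[OF x(2)]] df_dv[OF assms(1)] pia_omega[OF x(1)])
  then show ?thesis by (simp add: dv_def)
qed

lemma dv_single:
  "dv (single (wk None) q) = dd None (tau q)" "dv (single (wk (Some i)) q) = - dd (Some i) q"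
  by (simp_all add: dv_def df_single low_up lookup_minus del: fun_upd_apply cong: if_cong)

lemma dv_vec: "dv (vec p) = dd None (tau (p None)) - (\<Sum>i\<in>UNIV. dd (Some i) (p (Some i)))"
  unfolding vec_def UNIV_option_sum dv_add dv.sum dv_single by (simp add: sum_negf)

lemma dv_image: "dv ` H0 = Delta r"
proof (intro subset_antisym subsetI)
  fix v assume "v \<in> dv ` H0"
  then obtain u where "u \<in> H0" "v = dv u" by auto
  then obtain p where "v = dv (vec p)"
    using vec_coef[of u] by metis
  then show "v \<in> Delta r"
    unfolding dv_vec by (simp only:) (intro subspace_diff subspace_sum Delta_subspace dd_Delta)
next
  fix v assume "v \<in> Delta r"
  then obtain p where p: "v = (\<Sum>j\<in>UNIV. dd j (p j))" by (rule DeltaE)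
  have "v = dv (vec (\<lambda>c. case c of None \<Rightarrow> tau (p None) | Some i \<Rightarrow> - p (Some i)))"
    by (simp add: p dv_vec UNIV_option_sum r_lin sum_negf)
  then show "v \<in> dv ` H0"
    using vec_homog by blast
qed

lemma dv_part: "dv ` (F_part V q \<inter> H0) = V q \<inter> Delta r"
proof (intro subset_antisym subsetI)
  fix v assume "v \<in> dv ` (F_part V q \<inter> H0)"
  then obtain u where u: "u \<in> F_part V q" "u \<in> H0" "v = dv u" by auto
  have "tau v = sc (psign q) v"
    using dv_tau[OF u(2)] FV.V_iff_tau[of u q] u(1) by (simp add: u(3) dv_scale)
  then show "v \<in> V q \<inter> Delta r"
    using u dv_image by (auto simp: V_iff_tau)
next
  fix v assume v: "v \<in> V q \<inter> Delta r"
  then obtain u where u: "u \<in> H0" "v = dv u"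
    using dv_image by auto
  \<comment> \<open>The projection of a preimage to parity \<open>q\<close>. It is still a preimage
    of \<open>v\<close>, because \<open>dv\<close> commutes with \<open>tau\<close>.\<close>
  define w where "w = pscale sc (1/2) (u + pscale sc (psign q) (FV.tau u))"
  have "w \<in> H0"
    unfolding w_def using tau_homog[OF u(1)] u(1)
    by (intro F.subspace_scale F.subspace_add homog_subspace)
  moreover have "w \<in> F_part V q"
    unfolding FV.V_iff_tau w_def
    by (simp add: FV.twist_scale FV.twist_add F.scale_right_distrib add.commute mult.commute)
  moreover have "dv w = v"
  proof -
    have "v + v = sc 2 v" by (metis one_add_one scale_left_distrib scale_one)
    then have "sc (1/2) (v + v) = v" by simp
    moreover have "sc (psign q) (tau v) = v"
      using v by (simp add: V_iff_tau)
    ultimately show ?thesis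
      using u by (simp add: w_def dv_scale dv_add dv_tau)
  qed
  ultimately show "v \<in> dv ` (F_part V q \<inter> H0)"
    by blast
qed

lemma Ft_subspace: "F.subspace Ft"
  by (rule F.subspaceI)
    (auto simp: df_add df_scale df.zero intro: F.subspace_0 F.subspace_add F.subspace_scale homog_subspace)

lemma image_subset_Ft: "df ` H1 \<subseteq> Ft"
  using df_homog[of _ "- 1 - int CARD('n)"] by (auto simp: df_df)

lemma pia_Ft: "u \<in> Ft \<Longrightarrow> pia x u \<in> df ` H1"
proof -
  have "- int CARD('n) - 1 = - 1 - int CARD('n)" by simp
  then show "u \<in> Ft \<Longrightarrow> pia x u \<in> df ` H1"
    using pia_image[of u "- int CARD('n)" x] by (simp only: mem_Collect_eq)
qed

lemma tau_Ft: "u \<in> Ft \<Longrightarrow> FV.tau u \<in> Ft"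
  using tau_homog[of u "- int CARD('n)"] tau_df[of u] by (auto simp: FV.twist_lin)

lemma tau_image: "u \<in> df ` H1 \<Longrightarrow> FV.tau u \<in> df ` H1"
proof -
  assume "u \<in> df ` H1"
  then obtain w where w: "w \<in> H1" "u = df w" by auto
  have "FV.tau u = df (- FV.tau w)"
    by (simp add: w tau_df df.minus)
  then show ?thesis
    using F.subspace_neg[OF homog_subspace tau_homog[OF w(1)]] by blast
qed

lemma r_subspace_Delta: "x \<in> S'_alg \<Longrightarrow> r x p \<in> Delta r"
  using r_S_alg S'_alg_subset_S_alg by blast

abbreviation Fmod where
  "Fmod \<equiv> supermodule_on (pscale sc) (F_part V) pia H0"

lemma graded_submodules:
  "graded_submodule S'_alg Fmod {0}" "graded_submodule S'_alg Fmod (df ` H1)"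
  "graded_submodule S'_alg Fmod Ft" "graded_submodule S'_alg Fmod H0"
proof -
  have pia0: "pia x 0 = 0" for x
    using pia_scale[of x 0 0] by simp
  show "graded_submodule S'_alg Fmod {0}"
    by (auto simp: graded_submodule_F_iff FV.twist_lin pia0 F.subspace_0[OF homog_subspace] F.subspace_single_0)
  show "graded_submodule S'_alg Fmod (df ` H1)"
    unfolding graded_submodule_F_iff using image_subset_Ft pia_Ft tau_image df_image_subspace by blast
  show "graded_submodule S'_alg Fmod Ft"
    unfolding graded_submodule_F_iff using image_subset_Ft pia_Ft tau_Ft Ft_subspace by blast
  show "graded_submodule S'_alg Fmod H0"
    unfolding graded_submodule_F_iff using tau_homog pia_homog homog_subspace by blast
qed

sublocale Q: quotient_space "pscale sc" "F_part V" pia H0 Ft S'_alg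
proof unfold_locales
  show "pia x v \<in> Ft" if "v \<in> Ft" for x v
    using pia_Ft[OF that] image_subset_Ft by (rule subsetD[rotated])
qed (use homog_subspace Ft_subspace pia_homog pia_add FV.V_subspace in auto)

sublocale Q': quotient_space "pscale sc" "F_part V" pia Ft "df ` H1" S'_alg
proof unfold_locales
  show "df ` H1 \<subseteq> Ft"
    by (rule image_subset_Ft)
  show "pia x v \<in> Ft" if "v \<in> Ft" for x v
    using pia_Ft[OF that] image_subset_Ft by (rule subsetD[rotated])
  show "pia x v \<in> df ` H1" if "v \<in> df ` H1" for x v
    by (rule pia_Ft) (rule subsetD[OF image_subset_Ft that])
qed (rule Ft_subspace df_image_subspace pia_add FV.V_subspace)+

text \<open>\<open>dv\<close> keeps the parity index, as the oddness of diff and that of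
  \<open>omega\<close> cancel, but it intertwines the actions up to (-1)^|x|. So it is an odd map
  onto \<Pi>(\<Delta>P) in the sense of \<open>isomorphic\<close>.\<close>

lemma quotient_Delta_isomorphic:
  "isomorphic (homogeneous S'_alg) (quotient_by Fmod Ft)
    (parity_change (supermodule_on sc V r (Delta r)))"
  unfolding parity_change_supermodule_on
proof (rule Q.quotient_isomorphic[where g = dv and e = 1])
  show "dv ` (F_part V q \<inter> H0) = V (q + 1 + 1) \<inter> Delta r" for q
    by (simp add: dv_part add.assoc)
  show "dv (pia x v) = sc (psign (1 * q)) (r x (dv v))" if "x \<in> homogeneous S'_alg q" "v \<in> H0" for q x v
    using dv_pia[OF that(2,1)] by simp
qed (auto simp: dv_add dv_scale dv_image dv_zero_iff homogeneous_def)

text \<open>\<open>dv\<close> is composed with the given isomorphism, which carries \<Delta>P to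
  \<Delta>A because it supercommutes with the derivations. The parities 1 and \<open>e\<close> of
  the two maps add.\<close>

lemma quotient_Delta_A_isomorphic:
  assumes "isomorphic (homogeneous K_alg) (supermodule_on sc V r UNIV) A_mod"
  shows "isomorphic (homogeneous S'_alg) (quotient_by Fmod Ft)
    (parity_change (supermodule_on (pscale (*)) lpart (\<lambda>x. x) (Delta (\<lambda>x :: 'n lop. x))))"
proof -
  obtain \<theta> e where bij: "bij \<theta>" and add: "\<And>v w. \<theta> (v + w) = \<theta> v + \<theta> w"
    and scale: "\<And>c v. \<theta> (sc c v) = pscale (*) c (\<theta> v)" and part: "\<And>q. \<theta> ` V q = lpart (q + e)"
    and act: "\<And>q x v. x \<in> homogeneous K_alg q \<Longrightarrow> \<theta> (r x v) = pscale (*) (psign (e * q)) (x (\<theta> v))"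
    using assms by (auto simp: isomorphic_def A_mod_def)
  interpret \<theta>: Modules.additive \<theta> by unfold_locales (rule add)
  interpret A: K_mod "pscale (*)" lpart "\<lambda>x. x :: 'n lop"
    by unfold_locales (rule K_module_laurent)
  have inj: "\<theta> v = \<theta> w \<longleftrightarrow> v = w" for v w
    using bij by (metis bij_def inj_def)
  have zero: "\<theta> v = 0 \<longleftrightarrow> v = 0" for v
    using inj[of v 0] \<theta>.zero by simp
  have act_dd: "\<theta> (dd j v) = pscale (*) (psign (e * par j)) (partial j (\<theta> v))" for j v
    by (rule act[OF partial_homogeneous])
  have Delta: "\<theta> ` Delta r = Delta (\<lambda>x :: 'n lop. x)"
  proof (intro subset_antisym subsetI)
    fix f assume "f \<in> \<theta> ` Delta r"
    then obtain p where "f = \<theta> (\<Sum>j\<in>UNIV. dd j (p j))"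
      using DeltaE by blast
    then have "f = (\<Sum>j\<in>UNIV. pscale (*) (psign (e * par j)) (partial j (\<theta> (p j))))"
      by (simp add: \<theta>.sum act_dd)
    then show "f \<in> Delta (\<lambda>x :: 'n lop. x)"
      by (simp only:) (intro laurent.subspace_sum laurent.subspace_scale A.Delta_subspace A.dd_Delta)
  next
    fix f :: "'n laurent" assume "f \<in> Delta (\<lambda>x :: 'n lop. x)"
    then obtain h where h: "f = (\<Sum>j\<in>UNIV. partial j (h j))"
      by (rule A.DeltaE)
    have "partial j (h j) = \<theta> (dd j (sc (psign (e * par j)) (inv_into UNIV \<theta> (h j))))" for j
      by (simp add: act_dd scale partial_scale surj_f_inv_f[OF bij_is_surj[OF bij]])
    then have "f = \<theta> (\<Sum>j\<in>UNIV. dd j (sc (psign (e * par j)) (inv_into UNIV \<theta> (h j))))"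
      by (simp add: h \<theta>.sum)
    then show "f \<in> \<theta> ` Delta r"
      by (simp only:) (rule imageI, rule DeltaI)
  qed
  show ?thesis
    unfolding parity_change_supermodule_on
  proof (rule Q.quotient_isomorphic[where g = "\<lambda>u. \<theta> (dv u)" and e = "e + 1"])
    show "(\<lambda>u. \<theta> (dv u)) ` (F_part V q \<inter> H0) = lpart (q + (e + 1) + 1) \<inter> Delta (\<lambda>x. x)" for q
    proof -
      have "(\<lambda>u. \<theta> (dv u)) ` (F_part V q \<inter> H0) = \<theta> ` (V q \<inter> Delta r)"
        by (simp only: dv_part[symmetric] image_image)
      also have "\<dots> = \<theta> ` V q \<inter> \<theta> ` Delta r"
        by (rule image_Int) (use bij in \<open>simp add: bij_def\<close>)
      finally show ?thesis
        by (simp add: part Delta add.assoc)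
    qed
    show "(\<lambda>u. \<theta> (dv u)) ` H0 = Delta (\<lambda>x. x)"
      by (simp only: Delta[symmetric] dv_image[symmetric] image_image)
    show "\<theta> (dv (pia x v)) = pscale (*) (psign ((e + 1) * q)) (x (\<theta> (dv v)))"
      if "x \<in> homogeneous S'_alg q" "v \<in> H0" for q x v
      using dv_pia[OF that(2,1)] act[OF homogeneous_S'_alg[OF that(1)]]
      by (simp add: scale distrib_right psign_add mult.commute[of "psign q"])
  qed (auto simp: dv_add add dv_scale scale zero dv_zero_iff homogeneous_def)
qed

end

section \<open>The filtration for simple P\<close>

context simple_K_mod
begin

text \<open>\<partial>_i p placed at \<open>wk (Some i)\<close> lies in the kernel of diff, since
  \<partial>_i squares to zero. The field \<xi>_i \<partial>_j sends it into the image of diff, with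
  component -\<partial>_i p at \<open>wk (Some j)\<close>.\<close>

lemma image_nonzero: "df ` H1 \<noteq> {0}"
proof -
  define i :: 'n where "i = undefined"
  obtain j where j: "j \<noteq> i" using exists_other[OF n] .
  then have "j \<notin> {i}" by simp
  obtain p where p: "dd (Some i) p \<noteq> 0" by (rule dd_nonzero)
  define u where "u = single (wk (Some i)) (dd (Some i) p)"
  have "u \<in> H0"
    unfolding u_def by (intro homog_single negative_wk mdeg_wk)
  moreover have "dv u = 0"
    by (simp add: u_def dv_single dd_square del: wk.simps)
  ultimately have "u \<in> Ft"
    by (simp add: dv_zero_iff)
  from pia_Ft[OF this, of "lmult (mon 0 {i}) \<circ> partial (Some j)"]
  have *: "pib 0 {i} (Some j) u \<in> df ` H1"
    by (simp add: pia_field)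
  have "coef (pib 0 {i} (Some j) u) (wk (Some j)) = - dd (Some i) p"
    unfolding u_def pib_odd_single(2)[OF \<open>j \<notin> {i}\<close>] lookup_add coef_wk_single using j by simp
  then have "pib 0 {i} (Some j) u \<noteq> 0"
    using p by (metis lookup_zero neg_equal_0_iff_equal)
  then show ?thesis
    using * by auto
qed

lemma Ft_proper: "Ft \<noteq> H0"
proof -
  obtain p where p: "dd (Some undefined) p \<noteq> 0" by (rule dd_nonzero)
  have "single (wk (Some undefined)) p \<in> H0"
    by (intro homog_single negative_wk mdeg_wk)
  moreover have "dv (single (wk (Some undefined)) p) \<noteq> 0"
    using p by (simp add: dv_single del: wk.simps)
  ultimately show ?thesis
    using dv_zero_iff by blast
qed

lemma image_minimal:
  assumes "graded_submodule S'_alg Fmod U" "U \<noteq> {0}"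
  shows "df ` H1 \<subseteq> U"
  using assms by (intro df_image_smallest) (auto simp: graded_submodule_F_iff)

lemma image_simple: "simple_module S'_alg (supermodule_on (pscale sc) (F_part V) pia (df ` H1))"
proof -
  have "U = {0} \<or> U = df ` H1"
    if U: "graded_submodule S'_alg (supermodule_on (pscale sc) (F_part V) pia (df ` H1)) U" for U
  proof (cases "U = {0}")
    case False
    have "U \<subseteq> df ` H1"
      using U by (simp add: F.graded_submodule_iff[OF df_image_subspace])
    moreover have "graded_submodule S'_alg Fmod U"
      using U \<open>U \<subseteq> df ` H1\<close> image_subset_Ft
      by (auto simp: F.graded_submodule_iff[OF df_image_subspace] F.graded_submodule_iff[OF homog_subspace])
    ultimately show ?thesis
      using image_minimal False by blast
  qed simp
  then show ?thesis
    using image_nonzero by (simp add: F.simple_module_iff[OF df_image_subspace])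
qed

lemma image_unique:
  assumes "graded_submodule S'_alg Fmod U" "simple_module S'_alg (restrict_to Fmod U)"
  shows "U = df ` H1"
proof -
  have U: "U \<subseteq> H0" "F.subspace U"
    using assms(1) by (simp_all add: graded_submodule_F_iff)
  then have s: "simple_module S'_alg (supermodule_on (pscale sc) (F_part V) pia U)"
    using assms(2) by (simp add: restrict_to_supermodule_on)
  then have "U \<noteq> {0}"
    using F.simple_module_iff[OF U(2)] by auto
  then have sub: "df ` H1 \<subseteq> U"
    using image_minimal assms(1) by blast
  then have "graded_submodule S'_alg (supermodule_on (pscale sc) (F_part V) pia U) (df ` H1)"
    using graded_submodules(2) by (simp add: F.graded_submodule_iff[OF U(2)] F.graded_submodule_iff[OF homog_subspace])
  then have "df ` H1 = {0} \<or> df ` H1 = U"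
    using s unfolding F.simple_module_iff[OF U(2)] by blast
  then show ?thesis
    using image_nonzero by simp
qed

lemma F_quotient_simple:
  assumes "\<not> isomorphic (homogeneous K_alg) (supermodule_on sc V r UNIV) A_mod"
  shows "simple_module S'_alg (quotient_by Fmod Ft)"
proof (rule Q.quotient_simple[OF _ Ft_proper])
  show "\<exists>a\<in>Ft \<inter> F_part V 0. \<exists>b\<in>Ft \<inter> F_part V 1. v = a + b" if "v \<in> Ft" for v
    using FV.graded_iff_tau[OF Ft_subspace] tau_Ft that by blast
  fix G assume "graded_submodule S'_alg Fmod G" and Ft: "Ft \<subseteq> G"
  then have G: "G \<subseteq> H0" "F.subspace G" "\<And>u. u \<in> G \<Longrightarrow> FV.tau u \<in> G" "\<And>x u. x \<in> S'_alg \<Longrightarrow> u \<in> G \<Longrightarrow> pia x u \<in> G"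
    by (simp_all add: graded_submodule_F_iff)
  show "G = Ft \<or> G = H0"
  proof (cases "\<exists>u\<in>G. \<exists>j. dd j (dv u) \<noteq> 0")
    case True
    then obtain u j where u: "u \<in> G" "dd j (dv u) \<noteq> 0" by blast
    have "Delta r \<subseteq> dv ` G"
    proof (rule Delta_minimal[where p = "dv u" and j = j])
      show "subspace (dv ` G)"
      proof (rule subspaceI)
        show "0 \<in> dv ` G"
          using F.subspace_0[OF G(2)] dv.zero by (metis imageI)
        show "v + w \<in> dv ` G" if "v \<in> dv ` G" "w \<in> dv ` G" for v w
          using that F.subspace_add[OF G(2)] by (auto simp: dv_add[symmetric])
        show "sc c v \<in> dv ` G" if "v \<in> dv ` G" for c v
          using that F.subspace_scale[OF G(2)] by (auto simp: dv_scale[symmetric])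
      qed
      show "tau p \<in> dv ` G" if "p \<in> dv ` G" for p
      proof -
        obtain w where w: "w \<in> G" "p = dv w" using \<open>p \<in> dv ` G\<close> by auto
        then have "tau p = dv (FV.tau w)"
          using dv_tau[of w] G(1) by auto
        then show ?thesis
          using G(3)[OF w(1)] by simp
      qed
      show "r x p \<in> dv ` G" if x: "x \<in> homogeneous S'_alg q" and "p \<in> dv ` G" for q x p
      proof -
        obtain w where w: "w \<in> G" "p = dv w" using \<open>p \<in> dv ` G\<close> by auto
        have "r x p = dv (pscale sc (psign q) (pia x w))"
          using dv_pia[of w x q] w G(1) x by (simp add: dv_scale subsetD)
        moreover have "pscale sc (psign q) (pia x w) \<in> G"
          using w x by (intro F.subspace_scale G) (auto simp: homogeneous_def)
        ultimately show ?thesis by blast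
      qed
    qed (use u in auto)
    have "v \<in> G" if "v \<in> H0" for v
    proof -
      have "dv v \<in> dv ` G"
        using \<open>Delta r \<subseteq> dv ` G\<close> dv_image that by blast
      then obtain w where w: "w \<in> G" "dv v = dv w" by auto
      then have "dv (v - w) = 0" by (simp add: dv.diff)
      moreover have "v - w \<in> H0"
        using that w G(1) by (intro F.subspace_diff homog_subspace) auto
      ultimately have "v - w \<in> G"
        using Ft by (auto simp: dv_zero_iff)
      from F.subspace_add[OF G(2) this w(1)] show ?thesis by simp
    qed
    then show ?thesis using G(1) by blast
  next
    case False
    then have "dv u = 0" if "u \<in> G" for u
      using that invariant_isomorphic assms by blast
    then have "G \<subseteq> Ft"
      using G(1) dv_zero_iff by blast
    then show ?thesis using Ft by blast
  qed
qed

end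

section \<open>The quotient of \<open>\<Delta>A\<close> by the constants\<close>

lemma constants_subspace: "laurent.subspace constants"
proof (rule laurent.subspaceI)
  show "0 \<in> constants" 
    unfolding constants_def by (auto intro: exI[of _ 0])
  show "f + g \<in> constants" if "f \<in> constants" "g \<in> constants" for f g :: "'a laurent"
    using that by (auto simp: constants_def laurent.scale_left_distrib[symmetric])
  show "pscale (*) c f \<in> constants" if "f \<in> constants" for c and f :: "'a laurent"
    using that by (auto simp: constants_def)
qed

lemma constants_lpart: "constants \<subseteq> lpart 0"
  by (auto simp: constants_def mon_def lpart_single)

context
  fixes \<Delta>A :: "'n::{finite,linorder} laurent set"
  assumes n: "CARD('n) \<ge> 2" and \<Delta>A: "\<Delta>A = Delta (\<lambda>x :: 'n lop. x)"
begin

interpretation A: simple_K_mod "pscale (*)" lpart "\<lambda>x. x :: 'n lop"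
  by (rule simple_K_mod_laurent[OF n])

lemma constants_subset: "constants \<subseteq> \<Delta>A"
proof
  fix f :: "'n laurent" assume "f \<in> constants"
  then obtain c where c: "f = pscale (*) c (mon 0 {})" by (auto simp: constants_def)
  define i :: 'n where "i = undefined"
  have "f = partial (Some i) (pscale (*) c (mon 0 {i}))"
    by (simp add: c partial.simps dxi_scale)
  then show "f \<in> \<Delta>A"
    using A.dd_Delta by (simp add: \<Delta>A)
qed

lemma S'_constants: "x \<in> S'_alg \<Longrightarrow> f \<in> constants \<Longrightarrow> x f = (0 :: 'n laurent)"
  by (erule S'_alg_superderivation) (auto simp: constants_iff superderivation_def)

lemma constants_parts:
  assumes "f \<in> constants"
  shows "\<exists>a\<in>constants \<inter> lpart 0. \<exists>b\<in>constants \<inter> lpart 1. f = a + (b :: 'n laurent)"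
  using assms constants_lpart laurent.subspace_0[OF constants_subspace] by (intro bexI[of _ f] bexI[of _ 0]) auto

lemma constants_graded_submodule:
  "graded_submodule S'_alg (parity_change (supermodule_on (pscale (*)) lpart (\<lambda>x. x) \<Delta>A)) constants"
proof -
  have "\<exists>a\<in>constants \<inter> lpart (0 + 1). \<exists>b\<in>constants \<inter> lpart (1 + 1). f = a + b"
    if "f \<in> constants" for f :: "'n laurent"
    using constants_parts[OF that] by (auto simp: add.commute Bex_def)
  moreover have "x f \<in> constants" if "x \<in> S'_alg" "f \<in> constants" for x :: "'n lop" and f
    using S'_constants[OF that] laurent.subspace_0[OF constants_subspace] by simp
  ultimately show ?thesis
    unfolding parity_change_supermodule_on
    using constants_subset S'_constants laurent.subspace_0[OF constants_subspace]
    by (simp add: A.graded_submodule_iff[OF A.Delta_subspace, folded \<Delta>A] constants_subspace)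
qed

lemma constants_trivial:
  "trivial_module S'_alg (restrict_to (parity_change (supermodule_on (pscale (*)) lpart (\<lambda>x. x) \<Delta>A)) constants)"
proof -
  have "pscale (*) 1 (mon 0 {}) \<in> (constants :: 'n laurent set)"
    unfolding constants_def by blast
  then have "constants \<noteq> {0 :: 'n laurent}"
    using mon_one_neq_zero[of 1] by (metis singletonD one_neq_zero)
  then show ?thesis
    using S'_constants constants_subset
    by (simp add: trivial_module_def parity_change_supermodule_on restrict_to_supermodule_on zero_module_supermodule_on)
qed

text \<open>The constants are the invariants of the natural module, so a submodule strictly above
  them has a vector to which \<open>Delta_minimal\<close> applies.\<close>

lemma constants_quotient_simple:
  "simple_module S'_alg (quotient_by (supermodule_on (pscale (*)) lpart (\<lambda>x. x) \<Delta>A) constants)"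
proof -
  have S': "x f \<in> \<Delta>A" if "x \<in> S'_alg" for x f
    using A.r_subspace_Delta[OF that] by (simp add: \<Delta>A)
  interpret Q: quotient_space "pscale (*)" lpart "\<lambda>x. x :: 'n lop" \<Delta>A constants S'_alg
  proof unfold_locales
    show "laurent.subspace \<Delta>A" by (simp add: \<Delta>A A.Delta_subspace)
    show "x (v + w) = x v + x w" if "x \<in> S'_alg" for x :: "'n lop" and v w
      using that S'_alg_subset_K_alg K_alg_additive by blast
    show "x f \<in> constants" if "x \<in> S'_alg" "f \<in> constants" for x :: "'n lop" and f
      using S'_constants[OF that] laurent.subspace_0[OF constants_subspace] by simp
  qed (use constants_subset constants_subspace lpart_subspace S' S'_constants laurent.subspace_0[OF constants_subspace] in auto)
  show ?thesis
  proof (rule Q.quotient_simple[OF constants_parts])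
    define i :: 'n where "i = undefined"
    \<comment> \<open>t = \<partial>_i (t \<xi>_i) shows that \<Delta>A is larger than the
      constants.\<close>
    have "mon 1 {} = partial (Some i) (mon 1 {i})"
      by (simp add: partial.simps)
    then have "mon 1 {} \<in> \<Delta>A"
      using A.dd_Delta by (simp add: \<Delta>A)
    moreover have "mon 1 {} \<notin> (constants :: 'n laurent set)"
    proof
      assume "mon 1 {} \<in> (constants :: 'n laurent set)"
      then have "partial None (mon 1 {} :: 'n laurent) = 0"
        by (simp only: constants_iff)
      moreover have "partial None (mon 1 {} :: 'n laurent) = mon 0 {}"
        by (simp add: partial.simps mon_def)
      ultimately show False
        using mon_one_neq_zero[of 1, where 'a = 'n] by simp
    qed
    ultimately show "constants \<noteq> \<Delta>A" by blast
  next
    fix U assume "graded_submodule S'_alg (supermodule_on (pscale (*)) lpart (\<lambda>x. x) \<Delta>A) U" and const: "constants \<subseteq> U"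
    then have U: "U \<subseteq> \<Delta>A" "laurent.subspace U" "\<And>f. f \<in> U \<Longrightarrow> A.tau f \<in> U" "\<And>x f. x \<in> S'_alg \<Longrightarrow> f \<in> U \<Longrightarrow> x f \<in> U"
      using A.graded_iff_tau[of U] by (simp_all add: A.graded_submodule_iff[OF A.Delta_subspace, folded \<Delta>A])
    show "U = constants \<or> U = \<Delta>A"
    proof (cases "\<exists>f\<in>U. \<exists>j. partial j f \<noteq> 0")
      case True
      then obtain f j where f: "f \<in> U" "partial j f \<noteq> 0" by blast
      have "Delta (\<lambda>x :: 'n lop. x) \<subseteq> U"
        by (rule A.Delta_minimal[OF U(2,3) _ f]) (use U(4) in \<open>auto simp: homogeneous_def\<close>)
      then show ?thesis
        using U(1) \<Delta>A by blast
    next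
      case False
      then have "U \<subseteq> constants"
        by (auto simp: constants_iff)
      then show ?thesis
        using const by blast
    qed
  qed
qed

end

theorem proposition3p6:
  fixes sc :: "complex \<Rightarrow> 'p::ab_group_add \<Rightarrow> 'p"
    and V :: "bit \<Rightarrow> 'p set"
    and r :: "'n::{finite,linorder} lop \<Rightarrow> 'p \<Rightarrow> 'p"
    and \<mu>' :: "'n \<Rightarrow> int"
  defines "P \<equiv> supermodule_on sc V r UNIV"
    and "\<Delta>P \<equiv> supermodule_on sc V r (Delta r)"
    and "\<Delta>A \<equiv> restrict_to A_mod (Delta (\<lambda>x::'n lop. x))"
    and "F \<equiv> F_mod sc V r (N_mod (\<lambda>i::'n. - 1))"
    and "D \<equiv> diff sc V r ` carrier (F_mod sc V r (N_mod \<mu>'))"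
    and "Ft \<equiv> F_tilde sc V r (\<lambda>i::'n. - 1)"
  assumes n: "CARD('n) \<ge> 2"
    and P_module: "K_module sc V r"
    and P_simple: "simple_module K_alg P"
    and lam': "\<mu>' \<in> Gamma_neg" "(\<Sum>i\<in>UNIV. \<mu>' i) = - 1 - int CARD('n)"
  shows
    "({0} \<subseteq> D \<and> D \<subseteq> Ft \<and> Ft \<subseteq> carrier F \<and>
      graded_submodule S'_alg F {0} \<and> graded_submodule S'_alg F D \<and>
      graded_submodule S'_alg F Ft \<and> graded_submodule S'_alg F (carrier F)) \<and>
     (simple_module S'_alg (restrict_to F D) \<and>
      (\<forall>H. graded_submodule S'_alg F H \<and> simple_module S'_alg (restrict_to F H) \<longrightarrow> H = D)) \<and>
     (zero_module (quotient_by (restrict_to F Ft) D) \<or>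
      trivial_module S'_alg (quotient_by (restrict_to F Ft) D)) \<and>
     (\<not> isomorphic (homogeneous K_alg) P A_mod \<longrightarrow>
      isomorphic (homogeneous S'_alg) (quotient_by F Ft) (parity_change \<Delta>P) \<and>
      simple_module S'_alg (quotient_by F Ft)) \<and>
     (isomorphic (homogeneous K_alg) P A_mod \<longrightarrow>
      isomorphic (homogeneous S'_alg) (quotient_by F Ft) (parity_change \<Delta>A) \<and>
      graded_submodule S'_alg (parity_change \<Delta>A) constants \<and>
      trivial_module S'_alg (restrict_to (parity_change \<Delta>A) constants) \<and>
      simple_module S'_alg (quotient_by \<Delta>A constants)) \<and>
     \<not> simple_module S'_alg F"
proof -
  interpret simple_K_mod sc V r
    using n P_module P_simple by (simp add: simple_K_mod_def simple_K_mod_axioms_def K_mod_def P_def)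
  have F: "F = Fmod"
    by (simp add: F_def F_mod_eq)
  have D: "D = df ` H1"
    unfolding D_def carrier_F_mod lam'(2) ..
  have Ft: "Ft = {u \<in> H0. df u = 0}"
    by (simp add: Ft_def F_tilde_def carrier_F_mod)
  have \<Delta>A: "\<Delta>A = supermodule_on (pscale (*)) lpart (\<lambda>x. x) (Delta (\<lambda>x::'n lop. x))"
    by (simp add: \<Delta>A_def A_mod_def restrict_to_supermodule_on)
  have restrict: "restrict_to F D = supermodule_on (pscale sc) (F_part V) pia D"
    "restrict_to F Ft = supermodule_on (pscale sc) (F_part V) pia Ft"
    unfolding F using image_subset_Ft by (auto simp: D Ft intro!: restrict_to_supermodule_on)
  have filtration: "{0} \<subseteq> D \<and> D \<subseteq> Ft \<and> Ft \<subseteq> carrier F"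
    using image_subset_Ft F.subspace_0[OF df_image_subspace[of "- 1 - int CARD('n)"]]
    by (auto simp: F D Ft)
  have not_simple: "\<not> simple_module S'_alg F"
  proof
    assume "simple_module S'_alg F"
    then have "df ` H1 = {0} \<or> df ` H1 = H0"
      using graded_submodules(2) unfolding F F.simple_module_iff[OF homog_subspace] by blast
    then have "Ft = H0"
      using image_nonzero image_subset_Ft unfolding Ft by blast
    then show False
      using Ft_proper Ft by simp
  qed
  have triv: "zero_module (quotient_by (restrict_to F Ft) D) \<or> trivial_module S'_alg (quotient_by (restrict_to F Ft) D)"
    unfolding restrict unfolding D Ft Q'.quotient_zero_module_iff
    using Q'.quotient_trivial[OF pia_Ft] by blast
  have simple_D: "simple_module S'_alg (restrict_to F D)"
    unfolding restrict(1) unfolding D by (rule image_simple)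
  have graded: "graded_submodule S'_alg F {0} \<and> graded_submodule S'_alg F D \<and>
      graded_submodule S'_alg F Ft \<and> graded_submodule S'_alg F (carrier F)"
    using graded_submodules unfolding F D Ft supermodule_on_simps by (intro conjI)
  have unique: "\<forall>H. graded_submodule S'_alg F H \<and> simple_module S'_alg (restrict_to F H) \<longrightarrow> H = D"
    using image_unique unfolding F D by blast
  have iso_P: "isomorphic (homogeneous S'_alg) (quotient_by F Ft) (parity_change \<Delta>P)"
    unfolding F Ft \<Delta>P_def by (rule quotient_Delta_isomorphic)
  have simple_P: "simple_module S'_alg (quotient_by F Ft)" if "\<not> isomorphic (homogeneous K_alg) P A_mod"
    using F_quotient_simple that unfolding F Ft P_def .
  have iso_A: "isomorphic (homogeneous S'_alg) (quotient_by F Ft) (parity_change \<Delta>A)"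
    if "isomorphic (homogeneous K_alg) P A_mod"
    using quotient_Delta_A_isomorphic that unfolding F Ft P_def \<Delta>A .
  have constants: "graded_submodule S'_alg (parity_change \<Delta>A) constants \<and>
      trivial_module S'_alg (restrict_to (parity_change \<Delta>A) constants) \<and>
      simple_module S'_alg (quotient_by \<Delta>A constants)"
    unfolding \<Delta>A by (intro conjI constants_graded_submodule constants_trivial constants_quotient_simple n refl)
  show ?thesis
    using filtration graded simple_D unique triv iso_P simple_P iso_A constants not_simple
    by (intro conjI impI) (assumption | blast)+
qed

end
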